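(* Let $p$ be an odd prime, $k$ a field of characteristic $p$, and $E$ an elementary abelian $p$-group of rank $r$, with group algebra $kE$. If $r\geq 8$, then there is a bounded complex $F$ of free $kE$-modules of finite rank with $H(F)\neq 0$ and \[ \operatorname{rank}_k H(F)<2^r. \]
   Context: An elementary abelian $p$-group of rank $r$ is a group isomorphic to $(\mathbb{Z}/p)^r$. $H(F)=\bigoplus_i H_i(F)$ is the total homology of $F$, and $\operatorname{rank}_k H(F)=\sum_i\operatorname{rank}_k H_i(F)$ is its total dimension as a $k$-vector space. *)

theory Defs
  imports
    "HOL-Algebra.Elementary_Groups"
    "HOL-Algebra.Product_Groups"
    "HOL-Algebra.Module"
    "HOL-Algebra.AbelCoset"
    "HOL-Computational_Algebra.Primes"
    "HOL-Library.Extended_Nat"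
begin

definition elementary_abelian :: "nat \<Rightarrow> nat \<Rightarrow> ('g, 'a) monoid_scheme \<Rightarrow> bool" where
  "elementary_abelian p r G \<longleftrightarrow>
     group G \<and> G \<cong> product_group {..<r} (\<lambda>_. integer_mod_group p)"

definition ring_characteristic :: "('k, 'a) ring_scheme \<Rightarrow> nat" where
  "ring_characteristic R =
     (if \<exists>n>0. [(n::nat)] \<cdot>\<^bsub>R\<^esub> \<one>\<^bsub>R\<^esub> = \<zero>\<^bsub>R\<^esub>
      then LEAST n. n > 0 \<and> [n] \<cdot>\<^bsub>R\<^esub> \<one>\<^bsub>R\<^esub> = \<zero>\<^bsub>R\<^esub> else 0)"

(* Meant for finite G: every function G \<rightarrow> K is a formal K-linear combination of
   group elements; the product is convolution. *)
definition group_algebra ::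
    "('k, 'a) ring_scheme \<Rightarrow> ('g, 'b) monoid_scheme \<Rightarrow> ('g \<Rightarrow> 'k) ring" where
  "group_algebra K G =
     \<lparr>carrier = carrier G \<rightarrow>\<^sub>E carrier K,
      monoid.mult = (\<lambda>f g. \<lambda>x\<in>carrier G.
         \<Oplus>\<^bsub>K\<^esub>y\<in>carrier G. f y \<otimes>\<^bsub>K\<^esub> g (inv\<^bsub>G\<^esub> y \<otimes>\<^bsub>G\<^esub> x)),
      one = (\<lambda>x\<in>carrier G. if x = \<one>\<^bsub>G\<^esub> then \<one>\<^bsub>K\<^esub> else \<zero>\<^bsub>K\<^esub>),
      zero = (\<lambda>x\<in>carrier G. \<zero>\<^bsub>K\<^esub>),
      add = (\<lambda>f g. \<lambda>x\<in>carrier G. f x \<oplus>\<^bsub>K\<^esub> g x)\<rparr>"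

definition group_algebra_scalar ::
    "('k, 'a) ring_scheme \<Rightarrow> ('g, 'b) monoid_scheme \<Rightarrow> 'k \<Rightarrow> 'g \<Rightarrow> 'k" where
  "group_algebra_scalar K G c = (\<lambda>x\<in>carrier G. if x = \<one>\<^bsub>G\<^esub> then c else \<zero>\<^bsub>K\<^esub>)"

(* The record type of modules extends that of rings, so every module below also carries
   the fields mult and one, which have no meaning and are left undefined. *)

definition module_hom ::
    "('r, 'a) ring_scheme \<Rightarrow> ('r, 'm, 'b) module_scheme \<Rightarrow> ('r, 'n, 'c) module_scheme
      \<Rightarrow> ('m \<Rightarrow> 'n) set" where
  "module_hom R M N =
     {h \<in> carrier M \<rightarrow> carrier N.
        (\<forall>x\<in>carrier M. \<forall>y\<in>carrier M. h (x \<oplus>\<^bsub>M\<^esub> y) = h x \<oplus>\<^bsub>N\<^esub> h y) \<and>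
        (\<forall>a\<in>carrier R. \<forall>x\<in>carrier M. h (a \<odot>\<^bsub>M\<^esub> x) = a \<odot>\<^bsub>N\<^esub> h x)}"

definition finite_basis ::
    "('r, 'a) ring_scheme \<Rightarrow> ('r, 'm, 'b) module_scheme \<Rightarrow> 'm set \<Rightarrow> bool" where
  "finite_basis R M B \<longleftrightarrow>
     finite B \<and> B \<subseteq> carrier M \<and>
     (\<forall>x\<in>carrier M. \<exists>!a. a \<in> B \<rightarrow>\<^sub>E carrier R \<and> x = (\<Oplus>\<^bsub>M\<^esub>b\<in>B. a b \<odot>\<^bsub>M\<^esub> b))"

definition free_of_finite_rank ::
    "('r, 'a) ring_scheme \<Rightarrow> ('r, 'm, 'b) module_scheme \<Rightarrow> bool" where
  "free_of_finite_rank R M \<longleftrightarrow> Module.module R M \<and> (\<exists>B. finite_basis R M B)"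

(* Over a field all bases have the same cardinality, so the infimum is the dimension;
   it is \<infinity> (the infimum of the empty set) if there is no finite basis. *)
definition rank_over ::
    "('k, 'a) ring_scheme \<Rightarrow> ('k, 'm, 'b) module_scheme \<Rightarrow> enat" where
  "rank_over K M = (INF B\<in>{B. finite_basis K M B}. enat (card B))"

definition restrict_scalars ::
    "('k \<Rightarrow> 'r) \<Rightarrow> ('r, 'm, 'b) module_scheme \<Rightarrow> ('k, 'm) module" where
  "restrict_scalars \<phi> M =
     \<lparr>carrier = carrier M, monoid.mult = undefined, one = undefined,
      zero = \<zero>\<^bsub>M\<^esub>, add = (\<oplus>\<^bsub>M\<^esub>), smult = (\<lambda>c x. \<phi> c \<odot>\<^bsub>M\<^esub> x)\<rparr>"

definition quotient_module ::
    "('r, 'm, 'b) module_scheme \<Rightarrow> 'm set \<Rightarrow> ('r, 'm set) module" where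
  "quotient_module M N =
     \<lparr>carrier = a_rcosets\<^bsub>M\<^esub> N, monoid.mult = undefined, one = undefined,
      zero = N, add = (<+>\<^bsub>M\<^esub>), smult = (\<lambda>a X. \<Union>x\<in>X. N +>\<^bsub>M\<^esub> (a \<odot>\<^bsub>M\<^esub> x))\<rparr>"

definition direct_sum_module ::
    "('i \<Rightarrow> ('r, 'm, 'b) module_scheme) \<Rightarrow> ('r, 'i \<Rightarrow> 'm) module" where
  "direct_sum_module M =
     \<lparr>carrier = {f. (\<forall>i. f i \<in> carrier (M i)) \<and> finite {i. f i \<noteq> \<zero>\<^bsub>M i\<^esub>}},
      monoid.mult = undefined, one = undefined,
      zero = (\<lambda>i. \<zero>\<^bsub>M i\<^esub>), add = (\<lambda>f g i. f i \<oplus>\<^bsub>M i\<^esub> g i),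
      smult = (\<lambda>a f i. a \<odot>\<^bsub>M i\<^esub> f i)\<rparr>"

(* Homological grading: d i is the differential from degree i to degree i - 1. *)

locale chain_complex =
  fixes R :: "('r, 'a) ring_scheme"
    and F :: "int \<Rightarrow> ('r, 'm, 'b) module_scheme"
    and d :: "int \<Rightarrow> 'm \<Rightarrow> 'm"
  assumes module: "Module.module R (F i)"
    and differential: "d i \<in> module_hom R (F i) (F (i - 1))"
    and differential_squared: "x \<in> carrier (F i) \<Longrightarrow> d (i - 1) (d i x) = \<zero>\<^bsub>F (i - 1 - 1)\<^esub>"

locale bounded_free_complex = chain_complex +
  assumes bounded: "\<exists>a b. \<forall>i. i < a \<or> b < i \<longrightarrow> carrier (F i) = {\<zero>\<^bsub>F i\<^esub>}"
    and free: "free_of_finite_rank R (F i)"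

definition cycles ::
    "(int \<Rightarrow> ('r, 'm, 'b) module_scheme) \<Rightarrow> (int \<Rightarrow> 'm \<Rightarrow> 'm) \<Rightarrow> int \<Rightarrow> 'm set" where
  "cycles F d i = {x \<in> carrier (F i). d i x = \<zero>\<^bsub>F (i - 1)\<^esub>}"

definition boundaries ::
    "(int \<Rightarrow> ('r, 'm, 'b) module_scheme) \<Rightarrow> (int \<Rightarrow> 'm \<Rightarrow> 'm) \<Rightarrow> int \<Rightarrow> 'm set" where
  "boundaries F d i = d (i + 1) ` carrier (F (i + 1))"

definition homology ::
    "(int \<Rightarrow> ('r, 'm, 'b) module_scheme) \<Rightarrow> (int \<Rightarrow> 'm \<Rightarrow> 'm) \<Rightarrow> int \<Rightarrow> ('r, 'm set) module" where
  "homology F d i = quotient_module ((F i)\<lparr>carrier := cycles F d i\<rparr>) (boundaries F d i)"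

definition total_homology ::
    "(int \<Rightarrow> ('r, 'm, 'b) module_scheme) \<Rightarrow> (int \<Rightarrow> 'm \<Rightarrow> 'm) \<Rightarrow> ('r, int \<Rightarrow> 'm set) module" where
  "total_homology F d = direct_sum_module (homology F d)"

end

theory Submission
  imports "Jordan_Normal_Form.Missing_VectorSpace" Defs
begin

text \<open>
Let \<open>g\<^sub>0, \<dots>, g\<^sub>{r-1}\<close> be a basis of \<open>E\<close> and let \<open>L\<close> be the Koszul complex over \<open>kE\<close> on the
elements \<open>g\<^sub>i - 1\<close>. It is the tensor product of the complexes \<open>kC\<^sub>p \<rightarrow> kC\<^sub>p\<close> given by \<open>g\<^sub>i - 1\<close>, and each
of these has one-dimensional homology in degrees 0 and 1, spanned by the classes of \<open>1\<close> and of
\<open>z\<^sub>i = N\<^sub>i e\<^sub>i\<close>, where \<open>N\<^sub>i = 1 + g\<^sub>i + \<dots> + g\<^sub>i^(p-1)\<close>. Hence \<open>H(L)\<close> is the exterior algebra \<open>\<Lambda>\<close> on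
\<open>z\<^sub>0, \<dots>, z\<^sub>{r-1}\<close>, of dimension \<open>2^r\<close>.

The complex \<open>F\<close> is the mapping cone of multiplication by the cycle
\<open>w = z\<^sub>0 z\<^sub>1 + z\<^sub>2 z\<^sub>3 + z\<^sub>4 z\<^sub>5 + z\<^sub>6 z\<^sub>7\<close> on \<open>L\<close>. Its homology is the direct sum of the kernel and the
cokernel of \<open>w\<close> on \<open>\<Lambda>\<close>, so its dimension is \<open>2 (2^r - rank w)\<close>, and it has to be shown that the rank
of \<open>w\<close> exceeds \<open>2^(r-1)\<close>. The variables \<open>z\<^sub>8, \<dots>, z\<^sub>{r-1}\<close> are mere bystanders. In the exterior algebra
on the first eight variables, multiplication by \<open>w\<close> is injective in degrees at most 3, which have
total dimension \<open>1 + 8 + 28 + 56 = 93\<close>, and reaches everything in degrees at least 6, of total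
dimension \<open>28 + 8 + 1 = 37\<close>; both facts rest on 2 being invertible. As \<open>w\<close> raises the degree by 2, the
image of the first part lies in degrees at most 5, so the rank is at least \<open>130 \<cdot> 2^(r-8)\<close> and
\<open>dim H(F) \<le> 252 \<cdot> 2^(r-8) < 256 \<cdot> 2^(r-8) = 2^r\<close>.
The homology is nonzero because the class of \<open>1\<close> in degree 0 survives: the differential maps into
the augmentation ideal there.

The \<open>k\<close>-basis of \<open>F\<close> formed by the products of group elements and exterior monomials makes all
maps integer matrices. The homotopy that contracts \<open>F\<close> onto \<open>\<Lambda> \<oplus> \<Lambda>\<close> (lemma \<open>emb_retr\<close>) is therefore
constructed and verified over the integers, where sums are easy to manipulate, and carried over to
\<open>k\<close> by letting integer matrices act on vectors over an abelian group (lemma \<open>act_comp\<close>). That an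
integer matrix is \<open>kE\<close>-linear amounts to its invariance under translation by group elements. The rank
of \<open>w\<close> is treated in \<open>lefschetz_lift_injective\<close>, and \<open>dim_subquotient_le\<close> turns it into the bound on
the homology.
\<close>

section \<open>Linear operators on integer-valued functions\<close>

text \<open>The operators between spaces of functions on \<open>X\<close> and on \<open>Y\<close> that are given by an integer matrix
with columns indexed by \<open>X\<close>. The functions live on whole types, so the last clause is what says
that values outside \<open>X\<close> do not matter.\<close>
definition int_linear :: "'a set \<Rightarrow> 'b set \<Rightarrow> (('a \<Rightarrow> int) \<Rightarrow> 'b \<Rightarrow> int) \<Rightarrow> bool" where
  "int_linear X Y f \<longleftrightarrow>
     (\<forall>u v. \<forall>y\<in>Y. f (\<lambda>x. u x + v x) y = f u y + f v y) \<and>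
     (\<forall>c u. \<forall>y\<in>Y. f (\<lambda>x. c * u x) y = c * f u y) \<and>
     (\<forall>u v. (\<forall>x\<in>X. u x = v x) \<longrightarrow> (\<forall>y\<in>Y. f u y = f v y))"

lemma int_linearI:
  assumes "\<And>u v y. y \<in> Y \<Longrightarrow> f (\<lambda>x. u x + v x) y = f u y + f v y"
    and "\<And>c u y. y \<in> Y \<Longrightarrow> f (\<lambda>x. c * u x) y = c * f u y"
    and "\<And>u v y. (\<And>x. x \<in> X \<Longrightarrow> u x = v x) \<Longrightarrow> y \<in> Y \<Longrightarrow> f u y = f v y"
  shows "int_linear X Y f"
  using assms unfolding int_linear_def by blast

lemma int_linear_add: "int_linear X Y f \<Longrightarrow> y \<in> Y \<Longrightarrow> f (\<lambda>x. u x + v x) y = f u y + f v y"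
  and int_linear_scale: "int_linear X Y f \<Longrightarrow> y \<in> Y \<Longrightarrow> f (\<lambda>x. c * u x) y = c * f u y"
  and int_linear_cong: "int_linear X Y f \<Longrightarrow> (\<And>x. x \<in> X \<Longrightarrow> u x = v x) \<Longrightarrow> y \<in> Y \<Longrightarrow> f u y = f v y"
  unfolding int_linear_def by blast+

lemma int_linear_diff:
  assumes "int_linear X Y f" "y \<in> Y"
  shows "f (\<lambda>x. u x - v x) y = f u y - f v y"
  using int_linear_add[OF assms, of u "\<lambda>x. -1 * v x"] int_linear_scale[OF assms, of "-1" v] by simp

lemma int_linear_zero:
  assumes "int_linear X Y f" "y \<in> Y" "\<And>x. x \<in> X \<Longrightarrow> u x = 0"
  shows "f u y = 0"
  using int_linear_cong[OF assms(1), of u "\<lambda>x. 0 * u x"] int_linear_scale[OF assms(1,2), of 0 u] assms by simp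

lemma int_linear_comp:
  assumes "int_linear X Y f" "int_linear Y Z g"
  shows "int_linear X Z (\<lambda>u. g (f u))"
proof (rule int_linearI)
  fix u v :: "'a \<Rightarrow> int" and y assume y: "y \<in> Z"
  have "g (f (\<lambda>x. u x + v x)) y = g (\<lambda>x. f u x + f v x) y"
    by (rule int_linear_cong[OF assms(2)]) (auto simp: int_linear_add[OF assms(1)] y)
  then show "g (f (\<lambda>x. u x + v x)) y = g (f u) y + g (f v) y"
    by (simp add: int_linear_add[OF assms(2) y])
next
  fix c and u :: "'a \<Rightarrow> int" and y assume y: "y \<in> Z"
  have "g (f (\<lambda>x. c * u x)) y = g (\<lambda>x. c * f u x) y"
    by (rule int_linear_cong[OF assms(2)]) (auto simp: int_linear_scale[OF assms(1)] y)
  then show "g (f (\<lambda>x. c * u x)) y = c * g (f u) y"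
    by (simp add: int_linear_scale[OF assms(2) y])
next
  fix u v :: "'a \<Rightarrow> int" and y assume "\<And>x. x \<in> X \<Longrightarrow> u x = v x" "y \<in> Z"
  then show "g (f u) y = g (f v) y"
    by (intro int_linear_cong[OF assms(2)] int_linear_cong[OF assms(1)]) auto
qed

lemma int_linear_plus:
  assumes "int_linear X Y f" "int_linear X Y g"
  shows "int_linear X Y (\<lambda>u y. f u y + g u y)"
proof (rule int_linearI, goal_cases)
  case (3 u v y)
  then have "f u y = f v y" "g u y = g v y"
    by (auto intro: int_linear_cong[OF assms(1)] int_linear_cong[OF assms(2)])
  then show ?case by simp
qed (simp_all add: int_linear_add[OF assms(1)] int_linear_add[OF assms(2)] int_linear_scale[OF assms(1)]
      int_linear_scale[OF assms(2)] algebra_simps)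

lemma int_linear_sum:
  assumes "finite I" "\<And>i. i \<in> I \<Longrightarrow> int_linear X Y (f i)"
  shows "int_linear X Y (\<lambda>u y. \<Sum>i\<in>I. f i u y)"
  using assms
proof (induction I rule: finite_induct)
  case empty
  show ?case by (rule int_linearI) auto
next
  case (insert i I)
  then have "int_linear X Y (\<lambda>u y. f i u y + (\<Sum>i\<in>I. f i u y))"
    by (intro int_linear_plus) auto
  with insert show ?case by simp
qed

lemma int_linear_sum_apply:
  assumes "int_linear X Y f" "y \<in> Y"
  shows "f (\<lambda>x. \<Sum>i\<in>I. g i x) y = (\<Sum>i\<in>I. f (g i) y)"
proof (induction I rule: infinite_finite_induct)
  case (insert i I)
  then show ?case using int_linear_add[OF assms, of "g i" "\<lambda>x. \<Sum>i\<in>I. g i x"] by simp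
qed (auto intro: int_linear_zero[OF assms])

section \<open>The Koszul complex and the mapping cone over the integers\<close>

text \<open>The sign of removing or inserting \<open>e\<^sub>i\<close> in the exterior monomial \<open>e\<^sub>S\<close>. Counting the indices above \<open>i\<close>
makes the additional index \<open>r\<close>, which marks the source of the mapping cone below, contribute the
sign of the shift.\<close>
definition koszul_sign :: "nat \<Rightarrow> nat set \<Rightarrow> int" where
  "koszul_sign i S = (-1) ^ card {l \<in> S. i < l}"

lemma koszul_sign_insert:
  assumes "finite S" "l \<notin> S"
  shows "koszul_sign i (insert l S) = (if i < l then - koszul_sign i S else koszul_sign i S)"
proof -
  have "{k \<in> insert l S. i < k} = (if i < l then insert l {k \<in> S. i < k} else {k \<in> S. i < k})"
    by auto
  with assms show ?thesis by (auto simp: koszul_sign_def)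
qed

lemma koszul_sign_sq [simp]: "koszul_sign i S * koszul_sign i S = 1"
  by (simp add: koszul_sign_def flip: power_mult_distrib)

lemma koszul_sign_sq_left [simp]: "koszul_sign i S * (koszul_sign i S * x) = x"
  by (simp flip: mult.assoc)

lemma koszul_sign_remove:
  assumes "finite S" "l \<in> S"
  shows "koszul_sign i (S - {l}) = (if i < l then - koszul_sign i S else koszul_sign i S)"
  using koszul_sign_insert[of "S - {l}" l i] assms by (auto simp: insert_absorb split: if_splits)

text \<open>Two encodings are fixed throughout. An element of the group is given by its exponents
\<open>\<alpha> 0, \<dots>, \<alpha> (r - 1)\<close> with respect to the generators \<open>g\<^sub>i\<close>. A free generator of the cone is given by a set
\<open>S \<subseteq> {0, \<dots>, r}\<close>: it is the exterior monomial \<open>e\<^sub>T\<close> with \<open>T = S - {r}\<close>, in the source copy of the Koszul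
complex if \<open>r \<in> S\<close> and in the target copy otherwise. A function \<open>u\<close> stands for the chain whose coefficient
at \<open>g^\<alpha> e\<^sub>S\<close> is \<open>u (S, \<alpha>)\<close>.\<close>
type_synonym chain = "nat set \<times> (nat \<Rightarrow> nat) \<Rightarrow> int"

locale cone_operators =
  fixes p r :: nat
  assumes p_pos: "0 < p" and r_ge: "8 \<le> r"
begin

text \<open>The part of the Koszul differential that sends \<open>e\<^sub>i\<close> to \<open>g\<^sub>i - 1\<close>. The coefficient of \<open>g\<^sub>i u\<close> at the exponent
\<open>\<alpha> i\<close> is that of \<open>u\<close> at \<open>\<alpha> i - 1\<close>, cyclically.\<close>
definition koszul_d :: "nat \<Rightarrow> chain \<Rightarrow> chain" where
  "koszul_d i u = (\<lambda>(S, \<alpha>). if i \<in> S then 0 else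
     koszul_sign i S * (u (insert i S, \<alpha>(i := (\<alpha> i + p - 1) mod p)) - u (insert i S, \<alpha>)))"

text \<open>The homotopy \<open>g\<^sub>i^v \<mapsto> (1 + g\<^sub>i + \<dots> + g\<^sub>i^(v-1)) e\<^sub>i\<close>; it divides \<open>g\<^sub>i^v - 1\<close> by \<open>g\<^sub>i - 1\<close>.\<close>
definition koszul_h :: "nat \<Rightarrow> chain \<Rightarrow> chain" where
  "koszul_h i u = (\<lambda>(S, \<alpha>). if i \<in> S then
     koszul_sign i (S - {i}) * (\<Sum>v\<in>{\<alpha> i<..<p}. u (S - {i}, \<alpha>(i := v))) else 0)"

text \<open>In the \<open>i\<close>-th tensor factor this is the projection to the span of \<open>1\<close> and \<open>N\<^sub>i e\<^sub>i\<close> that sends every \<open>g\<^sub>i^v\<close>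
to \<open>1\<close>, and \<open>g\<^sub>i^v e\<^sub>i\<close> to \<open>N\<^sub>i e\<^sub>i\<close> if \<open>v = p - 1\<close> and to \<open>0\<close> otherwise.\<close>
definition koszul_pi :: "nat \<Rightarrow> chain \<Rightarrow> chain" where
  "koszul_pi i u = (\<lambda>(S, \<alpha>). if i \<in> S then u (S, \<alpha>(i := p - 1))
     else if \<alpha> i = 0 then (\<Sum>v<p. u (S, \<alpha>(i := v))) else 0)"

text \<open>Multiplication by \<open>z\<^sub>{2j} z\<^sub>{2j+1}\<close>, from the source copy to the target copy. The two indices are adjacent, so
the signs that they cause cancel. The norm elements turn into sums over all exponents.\<close>
definition norm_pair :: "nat \<Rightarrow> chain \<Rightarrow> chain" where
  "norm_pair j u = (\<lambda>(S, \<alpha>). if r \<notin> S \<and> {2*j, 2*j+1} \<subseteq> S then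
     (\<Sum>b<p. \<Sum>c<p. u (insert r (S - {2*j, 2*j+1}), \<alpha>(2*j := b, 2*j+1 := c))) else 0)"

definition norm_w :: "chain \<Rightarrow> chain" where
  "norm_w u = (\<lambda>x. \<Sum>j<4. norm_pair j u x)"

definition cone_d :: "chain \<Rightarrow> chain" where
  "cone_d u = (\<lambda>x. (\<Sum>i<r. koszul_d i u x) + norm_w u x)"

definition exps :: "(nat \<Rightarrow> nat) set" where
  "exps = {\<alpha>. (\<forall>i<r. \<alpha> i < p) \<and> (\<forall>i\<ge>r. \<alpha> i = 0)}"

definition idx :: "(nat set \<times> (nat \<Rightarrow> nat)) set" where
  "idx = Pow {..r} \<times> exps"

lemma exps_upd: "\<alpha> \<in> exps \<Longrightarrow> i < r \<Longrightarrow> v < p \<Longrightarrow> \<alpha>(i := v) \<in> exps"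
  by (auto simp: exps_def)

lemma int_linear_koszul_d: "i < r \<Longrightarrow> int_linear idx idx (koszul_d i)"
proof (rule int_linearI, goal_cases)
  case (3 u v y)
  obtain S \<alpha> where y: "y = (S, \<alpha>)" by force
  from 3 y have "(insert i S, \<alpha>(i := (\<alpha> i + p - 1) mod p)) \<in> idx" "(insert i S, \<alpha>) \<in> idx"
    using p_pos by (auto simp: idx_def intro!: exps_upd)
  with 3(2) show ?case by (simp add: koszul_d_def y)
qed (auto simp: koszul_d_def algebra_simps)

lemma int_linear_koszul_h: "i < r \<Longrightarrow> int_linear idx idx (koszul_h i)"
proof (rule int_linearI, goal_cases)
  case (3 u v y)
  obtain S \<alpha> where y: "y = (S, \<alpha>)" by force
  from 3 y have "(S - {i}, \<alpha>(i := a)) \<in> idx" if "a \<in> {\<alpha> i<..<p}" for a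
    using that by (auto simp: idx_def intro!: exps_upd)
  with 3(2) have "(\<Sum>v\<in>{\<alpha> i<..<p}. u (S - {i}, \<alpha>(i := v))) = (\<Sum>a\<in>{\<alpha> i<..<p}. v (S - {i}, \<alpha>(i := a)))"
    by (intro sum.cong) auto
  then show ?case by (simp add: koszul_h_def y)
qed (auto simp: koszul_h_def algebra_simps sum.distrib sum_distrib_left)

lemma int_linear_koszul_pi: "i < r \<Longrightarrow> int_linear idx idx (koszul_pi i)"
proof (rule int_linearI, goal_cases)
  case (3 u v y)
  obtain S \<alpha> where y: "y = (S, \<alpha>)" by force
  from 3 y have *: "(S, \<alpha>(i := a)) \<in> idx" if "a < p" for a
    using that by (auto simp: idx_def intro!: exps_upd)
  with 3(2) have "(\<Sum>v<p. u (S, \<alpha>(i := v))) = (\<Sum>a<p. v (S, \<alpha>(i := a)))"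
    by (intro sum.cong) auto
  moreover from * 3(2) have "u (S, \<alpha>(i := p - 1)) = v (S, \<alpha>(i := p - 1))"
    using p_pos by simp
  ultimately show ?case by (simp add: koszul_pi_def y)
qed (auto simp: koszul_pi_def algebra_simps sum.distrib sum_distrib_left)

lemma int_linear_norm_pair: "j < 4 \<Longrightarrow> int_linear idx idx (norm_pair j)"
proof (rule int_linearI, goal_cases)
  case (3 u v y)
  obtain S \<alpha> where y: "y = (S, \<alpha>)" by force
  from 3 y r_ge have *: "(insert r (S - {2*j, 2*j+1}), \<alpha>(2*j := b, 2*j+1 := c)) \<in> idx" if "b < p" "c < p" for b c
    using that by (auto simp: idx_def intro!: exps_upd)
  with 3(2) have "(\<Sum>b<p. \<Sum>c<p. u (insert r (S - {2*j, 2*j+1}), \<alpha>(2*j := b, 2*j+1 := c)))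
     = (\<Sum>b<p. \<Sum>c<p. v (insert r (S - {2*j, 2*j+1}), \<alpha>(2*j := b, 2*j+1 := c)))"
    by (intro sum.cong refl) blast
  then show ?case by (simp add: norm_pair_def y)
qed (auto simp: norm_pair_def algebra_simps sum.distrib sum_distrib_left)

lemma int_linear_norm_w: "int_linear idx idx norm_w"
  unfolding norm_w_def by (rule int_linear_sum) (auto intro: int_linear_norm_pair)

lemma int_linear_cone_d: "int_linear idx idx cone_d"
  unfolding cone_d_def by (intro int_linear_plus int_linear_sum) (auto intro: int_linear_koszul_d int_linear_norm_w)

lemma koszul_d_anticommute:
  assumes "finite S" "i \<noteq> j"
  shows "koszul_d i (koszul_d j u) (S, \<alpha>) = - koszul_d j (koszul_d i u) (S, \<alpha>)"
  using assms by (auto simp: koszul_d_def koszul_sign_insert insert_commute fun_upd_twist algebra_simps)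

lemma koszul_d_square: "koszul_d i (koszul_d i u) (S, \<alpha>) = 0"
  by (auto simp: koszul_d_def)

lemma koszul_d_koszul_h:
  assumes "finite S" "i \<noteq> j"
  shows "koszul_d j (koszul_h i u) (S, \<alpha>) = - koszul_h i (koszul_d j u) (S, \<alpha>)"
proof (cases "i \<in> S \<and> j \<notin> S")
  case True
  then have e: "insert j S - {i} = insert j (S - {i})" using assms by auto
  have s: "koszul_sign j S * koszul_sign i (insert j (S - {i})) = - (koszul_sign i (S - {i}) * koszul_sign j (S - {i}))"
    using assms True by (auto simp: koszul_sign_insert koszul_sign_remove)
  show ?thesis using True assms
    by (simp add: koszul_d_def koszul_h_def e sum_distrib_left sum_subtractf right_diff_distrib fun_upd_twist[OF assms(2)] s mult.assoc[symmetric] sum_negf)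
qed (use assms in \<open>auto simp: koszul_d_def koszul_h_def\<close>)

text \<open>Both cases are telescoping: in degree 0, \<open>d h (g\<^sub>i^v) = g\<^sub>i^v - 1\<close>; in degree 1, \<open>h d (g\<^sub>i^v e\<^sub>i) = g\<^sub>i^v e\<^sub>i\<close> unless
\<open>v = p - 1\<close>, where the cyclic overflow produces \<open>- N\<^sub>i e\<^sub>i\<close> in addition.\<close>
lemma koszul_homotopy:
  assumes "\<alpha> i < p"
  shows "koszul_d i (koszul_h i u) (S, \<alpha>) + koszul_h i (koszul_d i u) (S, \<alpha>) = u (S, \<alpha>) - koszul_pi i u (S, \<alpha>)"
proof (cases "i \<in> S")
  case True
  have "(\<Sum>v\<in>{a<..<p}. g ((v + p - 1) mod p) - g v) = g a - g (p - 1)" if "a < p" for a and g :: "nat \<Rightarrow> int"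
    using that
  proof (induction "p - 1 - a" arbitrary: a)
    case 0
    then have "a = p - 1" by auto
    moreover have "{p - 1<..<p} = {}" by auto
    ultimately show ?case by simp
  next
    case (Suc n)
    then have "{a<..<p} = insert (Suc a) {Suc a<..<p}" by auto
    moreover have "(Suc a + p - 1) mod p = a" using Suc by simp
    moreover have "(\<Sum>v\<in>{Suc a<..<p}. g ((v + p - 1) mod p) - g v) = g (Suc a) - g (p - 1)"
      by (rule Suc(1)) (use Suc in auto)
    ultimately show ?case by simp
  qed
  from this[OF assms, of "\<lambda>v. u (S, \<alpha>(i := v))"] True show ?thesis
    by (auto simp: koszul_d_def koszul_h_def koszul_pi_def insert_absorb sum_distrib_left)
next
  case False
  let ?g = "\<lambda>v. u (S, \<alpha>(i := v))"
  have "(\<Sum>v\<in>{(\<alpha> i + p - 1) mod p<..<p}. ?g v) - (\<Sum>v\<in>{\<alpha> i<..<p}. ?g v)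
     = ?g (\<alpha> i) - (if \<alpha> i = 0 then \<Sum>v<p. ?g v else 0)"
  proof (cases "\<alpha> i = 0")
    case True
    have "{..<p} = insert 0 {0<..<p}" using p_pos by auto
    moreover have "{p - 1<..<p} = {}" by auto
    ultimately show ?thesis using True p_pos by simp
  next
    case False
    then have "{(\<alpha> i + p - 1) mod p<..<p} = insert (\<alpha> i) {\<alpha> i<..<p}"
      using assms by (auto simp: mod_if)
    with False show ?thesis by simp
  qed
  with False show ?thesis
    by (auto simp: koszul_d_def koszul_h_def koszul_pi_def right_diff_distrib[symmetric])
qed

text \<open>Away from the pair the two operators are independent, and the sign comes from the index \<open>r\<close>. On an
index \<open>i\<close> of the pair both composites vanish because \<open>N\<^sub>i (g\<^sub>i - 1) = 0\<close>.\<close>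
lemma koszul_d_norm_pair:
  assumes "finite S" "i < r" "j < 4"
  shows "koszul_d i (norm_pair j u) (S, \<alpha>) = - norm_pair j (koszul_d i u) (S, \<alpha>)"
proof (cases "r \<notin> S \<and> {2*j, 2*j+1} \<subseteq> insert i S \<and> i \<notin> S")
  case True
  show ?thesis
  proof (cases "i \<in> {2*j, 2*j+1}")
    case False
    define T where "T = S - {2*j, 2*j+1}"
    have T: "finite T" "2*j \<notin> T" "2*j+1 \<notin> T" "i \<notin> T" "r \<notin> T" "S = insert (2*j) (insert (2*j+1) T)"
      using True assms False by (auto simp: T_def)
    have "i < 2*j \<longleftrightarrow> i < 2*j+1" using False by auto
    then have s: "koszul_sign i S = - koszul_sign i (insert r T)"
      using T assms by (auto simp: koszul_sign_insert)
    have e: "insert i S - {2*j, Suc (2*j)} = insert i T" "S - {2*j, Suc (2*j)} = T"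
      using False by (auto simp: T_def)
    have f: "\<alpha>(i := v, 2*j := b, Suc (2*j) := c) = \<alpha>(2*j := b, Suc (2*j) := c, i := v)" for v b c
      using False by (auto simp: fun_eq_iff)
    have g: "insert r (insert i T) = insert i (insert r T)" by auto
    have st: "{2*j, 2*j+1} \<subseteq> S" using T by auto
    show ?thesis using True False assms T(4,5) st
      by (simp add: koszul_d_def norm_pair_def e f g s sum_distrib_left sum_subtractf right_diff_distrib sum_negf)
  next
    case i: True
    have "(\<Sum>b<p. \<Sum>c<p. u (insert r (insert i S - {2*j, 2*j+1}), \<alpha>(i := v, 2*j := b, 2*j+1 := c)))
        = (\<Sum>b<p. \<Sum>c<p. u (insert r (insert i S - {2*j, 2*j+1}), \<alpha>(2*j := b, 2*j+1 := c)))" for v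
    proof -
      have "\<alpha>(i := v, 2*j := b, 2*j+1 := c) = \<alpha>(2*j := b, 2*j+1 := c)" for b c
        using i by (auto simp: fun_eq_iff)
      then show ?thesis by simp
    qed
    moreover have "\<not> {2*j, 2*j+1} \<subseteq> S" using True i by auto
    ultimately show ?thesis using True i
      by (auto simp: koszul_d_def norm_pair_def)
  qed
next
  case False
  show ?thesis
  proof (cases "r \<notin> S \<and> {2*j, 2*j+1} \<subseteq> S")
    case True
    with False have iS: "i \<in> S" by auto
    show ?thesis
    proof (cases "i \<in> {2*j, 2*j+1}")
      case c: True
      define R where "R = insert i (insert r (S - {2*j, 2*j+1}))"
      define G where "G = (\<lambda>b c. u (R, \<alpha>(2*j := b, 2*j+1 := c)))"
      have shift: "(\<Sum>b<p. h ((b + p - 1) mod p)) = (\<Sum>b<p. h b)" for h :: "nat \<Rightarrow> int"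
      proof (rule sum.reindex_bij_witness[of _ "\<lambda>b. (b + 1) mod p" "\<lambda>b. (b + p - 1) mod p"], goal_cases)
        case (1 a)
        then show ?case
          by (cases "a = 0") (auto simp: mod_if)
      next
        case (3 a)
        then show ?case by (cases "a + 1 = p") (auto simp: mod_if)
      qed (use p_pos in auto)
      have ir: "i \<noteq> r" using assms by auto
      have "(\<Sum>b<p. \<Sum>c<p. u (R, \<alpha>(2*j := b, 2*j+1 := c, i := ((\<alpha>(2*j := b, 2*j+1 := c)) i + p - 1) mod p)))
         = (\<Sum>b<p. \<Sum>c<p. u (R, \<alpha>(2*j := b, 2*j+1 := c)))"
      proof (cases "i = 2*j")
        case True
        have "(\<Sum>b<p. \<Sum>c<p. u (R, \<alpha>(2*j := b, 2*j+1 := c, i := ((\<alpha>(2*j := b, 2*j+1 := c)) i + p - 1) mod p)))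
          = (\<Sum>b<p. \<Sum>c<p. G ((b + p - 1) mod p) c)"
          unfolding G_def using True by (intro sum.cong refl arg_cong[of _ _ u]) (auto simp: fun_eq_iff)
        also have "\<dots> = (\<Sum>b<p. \<Sum>c<p. G b c)"
          using shift[of "\<lambda>b. \<Sum>c<p. G b c"] .
        finally show ?thesis by (simp add: G_def)
      next
        case False
        then have i1: "i = 2*j+1" using c by auto
        have "(\<Sum>b<p. \<Sum>c<p. u (R, \<alpha>(2*j := b, 2*j+1 := c, i := ((\<alpha>(2*j := b, 2*j+1 := c)) i + p - 1) mod p)))
          = (\<Sum>b<p. \<Sum>c<p. G b ((c + p - 1) mod p))"
          unfolding G_def i1 by (intro sum.cong refl arg_cong[of _ _ u]) (auto simp: fun_eq_iff)
        also have "\<dots> = (\<Sum>b<p. \<Sum>c<p. G b c)"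
          by (intro sum.cong refl shift)
        finally show ?thesis by (simp add: G_def)
      qed
      moreover have "i \<notin> insert r (S - {2*j, 2*j+1})" using c ir by auto
      moreover from this have "norm_pair j (koszul_d i u) (S, \<alpha>) = (\<Sum>b<p. \<Sum>c<p. koszul_sign i (insert r (S - {2*j, 2*j+1})) *
          (u (R, \<alpha>(2*j := b, 2*j+1 := c, i := ((\<alpha>(2*j := b, 2*j+1 := c)) i + p - 1) mod p))
            - u (R, \<alpha>(2*j := b, 2*j+1 := c))))"
        using True unfolding R_def by (simp only: koszul_d_def norm_pair_def split if_True if_False simp_thms)
      ultimately have "norm_pair j (koszul_d i u) (S, \<alpha>) = 0"
        by (simp only: sum_distrib_left[symmetric] sum_subtractf) simp
      with iS show ?thesis by (simp add: koszul_d_def)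
    next
      case False
      with iS True show ?thesis by (simp add: koszul_d_def norm_pair_def)
    qed
  next
    case F: False
    with False assms show ?thesis by (auto simp: koszul_d_def norm_pair_def)
  qed
qed

text \<open>On an index of the pair both composites vanish, since each of the two operators multiplies by \<open>e\<^sub>i\<close>.\<close>
lemma koszul_h_norm_pair:
  assumes "finite S" "i < r" "j < 4"
  shows "norm_pair j (koszul_h i u) (S, \<alpha>) = - koszul_h i (norm_pair j u) (S, \<alpha>)"
proof (cases "r \<notin> S \<and> {2*j, 2*j+1} \<subseteq> S \<and> i \<in> S")
  case True
  show ?thesis
  proof (cases "i \<in> {2*j, 2*j+1}")
    case i: True
    with True assms show ?thesis by (auto simp: koszul_h_def norm_pair_def)
  next
    case False
    define T where "T = S - {i, 2*j, 2*j+1}"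
    have T: "finite T" "2*j \<notin> T" "2*j+1 \<notin> T" "i \<notin> T" "r \<notin> T"
      "S - {i} = insert (2*j) (insert (2*j+1) T)" "S - {2*j, 2*j+1} = insert i T"
      using True assms False by (auto simp: T_def)
    have "i < 2*j \<longleftrightarrow> i < 2*j+1" using False by auto
    then have s: "koszul_sign i (insert r T) = - koszul_sign i (S - {i})"
      using T assms by (auto simp: koszul_sign_insert)
    have e: "insert r (S - {2*j, 2*j+1}) - {i} = insert r T"
      "S - {i} - {2*j, 2*j+1} = T" "i \<in> insert r (S - {2*j, 2*j+1})" "{2*j, 2*j+1} \<subseteq> S - {i}" "r \<notin> S - {i}"
      using T assms True False by auto
    have f: "\<alpha>(i := v, 2*j := b, 2*j+1 := c) = \<alpha>(2*j := b, 2*j+1 := c, i := v)" for v b c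
      using False by (auto simp: fun_eq_iff)
    have a: "(\<alpha>(2*j := b, 2*j+1 := c)) i = \<alpha> i" for b c using False by auto
    have "norm_pair j (koszul_h i u) (S, \<alpha>) = (\<Sum>b<p. \<Sum>c<p. koszul_sign i (insert r T) *
        (\<Sum>v\<in>{\<alpha> i<..<p}. u (insert r T, \<alpha>(2*j := b, 2*j+1 := c, i := v))))"
      using True e(3) by (simp only: norm_pair_def koszul_h_def split e a if_True simp_thms)
    also have "\<dots> = koszul_sign i (insert r T) * (\<Sum>b<p. \<Sum>c<p. \<Sum>v\<in>{\<alpha> i<..<p}. u (insert r T, \<alpha>(2*j := b, 2*j+1 := c, i := v)))"
      by (simp add: sum_distrib_left)
    also have "(\<Sum>b<p. \<Sum>c<p. \<Sum>v\<in>{\<alpha> i<..<p}. u (insert r T, \<alpha>(2*j := b, 2*j+1 := c, i := v)))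
       = (\<Sum>b<p. \<Sum>v\<in>{\<alpha> i<..<p}. \<Sum>c<p. u (insert r T, \<alpha>(2*j := b, 2*j+1 := c, i := v)))"
      by (intro sum.cong refl sum.swap)
    also have "\<dots> = (\<Sum>v\<in>{\<alpha> i<..<p}. \<Sum>b<p. \<Sum>c<p. u (insert r T, \<alpha>(2*j := b, 2*j+1 := c, i := v)))"
      by (rule sum.swap)
    also have "koszul_sign i (insert r T) * \<dots> = - koszul_h i (norm_pair j u) (S, \<alpha>)"
      using True e(3-5) by (simp only: norm_pair_def koszul_h_def split e f if_True simp_thms s)
    finally show ?thesis .
  qed
next
  case False
  then show ?thesis using assms by (auto simp: koszul_h_def norm_pair_def)
qed

lemma norm_pair_square: "norm_pair j (norm_pair j' u) (S, \<alpha>) = 0"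
  by (auto simp: norm_pair_def)

lemma cone_d_square:
  assumes "x \<in> idx"
  shows "cone_d (cone_d u) x = 0"
proof -
  obtain S \<alpha> where x: "x = (S, \<alpha>)" by force
  with assms have S: "finite S" by (auto simp: idx_def intro: finite_subset)
  have "koszul_d i (cone_d u) x = (\<Sum>j<r. koszul_d i (koszul_d j u) x) + (\<Sum>j<4. koszul_d i (norm_pair j u) x)" if "i < r" for i
    unfolding cone_d_def norm_w_def
    by (simp add: int_linear_add[OF int_linear_koszul_d[OF that] assms] int_linear_sum_apply[OF int_linear_koszul_d[OF that] assms])
  moreover have "norm_pair j (cone_d u) x = (\<Sum>i<r. norm_pair j (koszul_d i u) x) + (\<Sum>j'<4. norm_pair j (norm_pair j' u) x)" if "j < 4" for j
    unfolding cone_d_def norm_w_def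
    by (simp add: int_linear_add[OF int_linear_norm_pair[OF that] assms] int_linear_sum_apply[OF int_linear_norm_pair[OF that] assms])
  ultimately have "cone_d (cone_d u) x = (\<Sum>i<r. \<Sum>j<r. koszul_d i (koszul_d j u) x) + (\<Sum>i<r. \<Sum>j<4. koszul_d i (norm_pair j u) x)
     + (\<Sum>j<4. \<Sum>i<r. norm_pair j (koszul_d i u) x)"
    unfolding cone_d_def[of "cone_d u"] norm_w_def[of "cone_d u"] x
    by (simp add: sum.distrib norm_pair_square)
  also have "(\<Sum>i<r. \<Sum>j<4. koszul_d i (norm_pair j u) x) = - (\<Sum>j<4. \<Sum>i<r. norm_pair j (koszul_d i u) x)"
    unfolding x by (subst sum.swap) (simp add: koszul_d_norm_pair[OF S] sum_negf)
  also have "(\<Sum>i<r. \<Sum>j<r. koszul_d i (koszul_d j u) x) = 0"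
  proof -
    have "(\<Sum>i<r. \<Sum>j<r. koszul_d i (koszul_d j u) x) = (\<Sum>i<r. \<Sum>j<r. - koszul_d j (koszul_d i u) x)"
      unfolding x by (intro sum.cong refl) (metis koszul_d_anticommute[OF S] koszul_d_square minus_zero)
    also have "\<dots> = - (\<Sum>i<r. \<Sum>j<r. koszul_d i (koszul_d j u) x)"
      by (subst sum.swap) (simp add: sum_negf)
    finally show ?thesis by simp
  qed
  finally show ?thesis by simp
qed

text \<open>Only the terms of the \<open>i\<close>-th tensor factor survive, because \<open>koszul_h i\<close> anticommutes with everything else
in the differential of the cone, including multiplication by \<open>w\<close>.\<close>
lemma cone_d_koszul_h:
  assumes "x \<in> idx" "i < r"
  shows "cone_d (koszul_h i u) x + koszul_h i (cone_d u) x = u x - koszul_pi i u x"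
proof -
  obtain S \<alpha> where x: "x = (S, \<alpha>)" by force
  with assms have S: "finite S" and \<alpha>: "\<alpha> i < p" by (auto simp: idx_def exps_def intro: finite_subset)
  have "koszul_h i (cone_d u) x = (\<Sum>j<r. koszul_h i (koszul_d j u) x) + (\<Sum>j<4. koszul_h i (norm_pair j u) x)"
    unfolding cone_d_def norm_w_def using assms
    by (simp add: int_linear_add[OF int_linear_koszul_h] int_linear_sum_apply[OF int_linear_koszul_h])
  moreover have "cone_d (koszul_h i u) x = (\<Sum>j<r. koszul_d j (koszul_h i u) x) + (\<Sum>j<4. norm_pair j (koszul_h i u) x)"
    by (simp add: cone_d_def norm_w_def)
  ultimately have "cone_d (koszul_h i u) x + koszul_h i (cone_d u) x
     = (\<Sum>j<r. koszul_d j (koszul_h i u) x + koszul_h i (koszul_d j u) x) + (\<Sum>j<4. norm_pair j (koszul_h i u) x + koszul_h i (norm_pair j u) x)"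
    by (simp add: sum.distrib)
  also have "(\<Sum>j<4. norm_pair j (koszul_h i u) x + koszul_h i (norm_pair j u) x) = 0"
    unfolding x using koszul_h_norm_pair[OF S assms(2)] by simp
  also have "(\<Sum>j<r. koszul_d j (koszul_h i u) x + koszul_h i (koszul_d j u) x)
    = (\<Sum>j<r. if j = i then koszul_d i (koszul_h i u) x + koszul_h i (koszul_d i u) x else 0)"
    unfolding x by (intro sum.cong refl) (auto simp: koszul_d_koszul_h[OF S])
  also have "\<dots> = u x - koszul_pi i u x"
    using assms(2) koszul_homotopy[where \<alpha> = \<alpha> and i = i, OF \<alpha>] by (simp add: x)
  finally show ?thesis by simp
qed

text \<open>The homotopies of the single tensor factors are combined in the usual way for a composite of
projections each of which is homotopic to the identity.\<close>
fun proj :: "nat \<Rightarrow> chain \<Rightarrow> chain" where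
  "proj 0 u = u"
| "proj (Suc n) u = koszul_pi n (proj n u)"

fun homotopy :: "nat \<Rightarrow> chain \<Rightarrow> chain" where
  "homotopy 0 u = (\<lambda>x. 0)"
| "homotopy (Suc n) u = (\<lambda>x. homotopy n u x + koszul_h n (proj n u) x)"

lemma int_linear_proj: "n \<le> r \<Longrightarrow> int_linear idx idx (proj n)"
proof (induction n)
  case 0
  show ?case by (rule int_linearI) auto
next
  case (Suc n)
  then show ?case using int_linear_comp[of idx idx "proj n" idx "koszul_pi n"] int_linear_koszul_pi[of n] by simp
qed

lemma int_linear_homotopy: "n \<le> r \<Longrightarrow> int_linear idx idx (homotopy n)"
proof (induction n)
  case 0
  show ?case by (rule int_linearI) auto
next
  case (Suc n)
  then have "int_linear idx idx (\<lambda>u x. homotopy n u x + koszul_h n (proj n u) x)"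
    using int_linear_comp[OF int_linear_proj int_linear_koszul_h, of n n] by (intro int_linear_plus) auto
  then show ?case by simp
qed

text \<open>By induction: \<open>1 - \<pi>\<^sub>n P = (1 - P) + (1 - \<pi>\<^sub>n) P\<close> where \<open>P\<close> is the projection already obtained, and \<open>P\<close>
commutes with the differential as it is homotopic to the identity.\<close>
lemma cone_d_homotopy:
  assumes "n \<le> r" "x \<in> idx"
  shows "cone_d (homotopy n u) x + homotopy n (cone_d u) x = u x - proj n u x"
  using assms
proof (induction n arbitrary: u x)
  case 0
  have "cone_d (\<lambda>x. 0) x = 0" by (rule int_linear_zero[OF int_linear_cone_d]) (use 0 in auto)
  then show ?case by simp
next
  case (Suc n)
  have n: "n < r" using Suc by simp
  have IH: "proj n v y = v y - cone_d (homotopy n v) y - homotopy n (cone_d v) y" if "y \<in> idx" for v y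
    using Suc.IH[OF _ that, of v] n by simp
  have comm: "proj n (cone_d u) y = cone_d (proj n u) y" if y: "y \<in> idx" for y
  proof -
    have "homotopy n (cone_d (cone_d u)) y = 0"
      by (rule int_linear_zero[OF int_linear_homotopy]) (use n y in \<open>auto simp: cone_d_square\<close>)
    then have "proj n (cone_d u) y = cone_d u y - cone_d (homotopy n (cone_d u)) y"
      using IH[OF y, of "cone_d u"] by simp
    moreover have "cone_d (proj n u) y = cone_d (\<lambda>z. u z - (cone_d (homotopy n u) z + homotopy n (cone_d u) z)) y"
      by (rule int_linear_cong[OF int_linear_cone_d _ y]) (simp add: IH)
    moreover have "\<dots> = cone_d u y - (cone_d (cone_d (homotopy n u)) y + cone_d (homotopy n (cone_d u)) y)"
      by (simp add: int_linear_diff[OF int_linear_cone_d y] int_linear_add[OF int_linear_cone_d y])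
    ultimately show ?thesis by (simp add: cone_d_square[OF y])
  qed
  have "koszul_h n (cone_d (proj n u)) x = koszul_h n (proj n (cone_d u)) x"
    by (rule int_linear_cong[OF int_linear_koszul_h[OF n] _ Suc.prems(2)]) (simp add: comm)
  moreover have "cone_d (homotopy (Suc n) u) x = cone_d (homotopy n u) x + cone_d (koszul_h n (proj n u)) x"
    by (simp add: int_linear_add[OF int_linear_cone_d Suc.prems(2)])
  ultimately have "cone_d (homotopy (Suc n) u) x + homotopy (Suc n) (cone_d u) x
    = (cone_d (homotopy n u) x + homotopy n (cone_d u) x) + (cone_d (koszul_h n (proj n u)) x + koszul_h n (cone_d (proj n u)) x)"
    by simp
  also have "\<dots> = u x - koszul_pi n (proj n u) x"
    using IH[OF Suc.prems(2), of u] cone_d_koszul_h[OF Suc.prems(2) n, of "proj n u"] by simp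
  finally show ?case by simp
qed

lemma koszul_pi_apply: "koszul_pi i u (S, \<alpha>) = (if i \<in> S then u (S, \<alpha>(i := p - 1))
     else if \<alpha> i = 0 then (\<Sum>v<p. u (S, \<alpha>(i := v))) else 0)"
  by (simp add: koszul_pi_def)

text \<open>The image of all projections is described one tensor factor at a time: the coefficients vanish
off \<open>1\<close> for \<open>i \<notin> S\<close>, and are constant along the norm for \<open>i \<in> S\<close>. Later projections respect this.\<close>
lemma proj_normal:
  assumes "i < n"
  shows "i \<notin> S \<Longrightarrow> \<alpha> i \<noteq> 0 \<Longrightarrow> proj n u (S, \<alpha>) = 0"
    and "i \<in> S \<Longrightarrow> proj n u (S, \<alpha>(i := v)) = proj n u (S, \<alpha>)"
  using assms
proof (induction n arbitrary: \<alpha>)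
  case (Suc n)
  {
    case 1
    with Suc.IH(1) show ?case by (cases "i = n") (auto simp: koszul_pi_def)
  next
    case 2
    have "proj n u (S, \<alpha>(n := w)) = proj n u (S, \<alpha>(n := w, i := v))" if "i \<noteq> n" for w
      by (rule Suc.IH(2)[symmetric]) (use 2 that in auto)
    moreover define \<beta> where "\<beta> = \<alpha>(i := v)"
    moreover have "\<beta>(n := w) = (if i = n then \<alpha>(n := w) else \<alpha>(n := w, i := v))" for w
      by (auto simp: \<beta>_def fun_upd_twist)
    moreover have "i \<noteq> n \<Longrightarrow> \<beta> n = \<alpha> n" by (simp add: \<beta>_def)
    ultimately have "proj (Suc n) u (S, \<beta>) = proj (Suc n) u (S, \<alpha>)"
      using 2 by (cases "i = n") (simp_all add: koszul_pi_apply)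
    then show ?case by (simp only: \<beta>_def)
  }
qed auto

text \<open>The embedding of two copies of the exterior algebra \<open>\<Lambda>\<close> into the cone as the cycles
\<open>\<Prod>\<^sub>{i \<in> S} N\<^sub>i e\<^sub>i\<close>, and the corresponding retraction; on \<open>\<Lambda>\<close>, the differential becomes multiplication by \<open>w\<close> from the
source copy to the target copy, which is \<open>lefschetz\<close>.\<close>
definition emb :: "(nat set \<Rightarrow> int) \<Rightarrow> chain" where
  "emb c = (\<lambda>(S, \<alpha>). if \<forall>i<r. i \<notin> S \<longrightarrow> \<alpha> i = 0 then c S else 0)"

definition retr :: "chain \<Rightarrow> nat set \<Rightarrow> int" where
  "retr u S = proj r u (S, \<lambda>_. 0)"

definition lefschetz :: "(nat set \<Rightarrow> int) \<Rightarrow> nat set \<Rightarrow> int" where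
  "lefschetz c S = (if r \<in> S then 0 else
     \<Sum>j<4. if {2*j, 2*j+1} \<subseteq> S then c (insert r (S - {2*j, 2*j+1})) else 0)"

lemma zero_exps: "(\<lambda>_. 0) \<in> exps"
  using p_pos by (simp add: exps_def)

lemma int_linear_emb: "int_linear (Pow {..r}) idx emb"
  by (rule int_linearI) (auto simp: emb_def idx_def)

lemma int_linear_lefschetz: "int_linear (Pow {..r}) (Pow {..r}) lefschetz"
proof (rule int_linearI, goal_cases)
  case (3 u v y)
  then have "u (insert r (y - {2*j, 2*j+1})) = v (insert r (y - {2*j, 2*j+1}))" for j
    by (intro 3(1)) auto
  then show ?case by (simp add: lefschetz_def cong: if_cong)
qed (auto simp: lefschetz_def sum.distrib[symmetric] sum_distrib_left intro!: sum.cong)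

text \<open>This says that \<open>emb\<close> and \<open>retr\<close> identify the cone up to homotopy with \<open>\<Lambda> \<oplus> \<Lambda>\<close>. A function in the image of all
projections is determined by its values at the exponent \<open>0\<close>, as \<open>proj_normal\<close> allows to change the
exponents to \<open>0\<close> one after the other.\<close>
lemma emb_retr:
  assumes "x \<in> idx"
  shows "emb (retr u) x = u x - cone_d (homotopy r u) x - homotopy r (cone_d u) x"
proof -
  obtain S \<alpha> where x: "x = (S, \<alpha>)" by force
  have "emb (retr u) x = proj r u x"
  proof (cases "\<forall>i<r. i \<notin> S \<longrightarrow> \<alpha> i = 0")
    case True
    have "proj r u (S, \<lambda>i. if i < n then 0 else \<alpha> i) = proj r u (S, \<alpha>)" if "n \<le> r" for n
      using that
    proof (induction n)
      case (Suc n)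
      let ?b = "\<lambda>i. if i < n then 0 else \<alpha> i"
      have eq: "(\<lambda>i. if i < Suc n then 0 else \<alpha> i) = ?b(n := 0)"
        by (auto simp: fun_eq_iff)
      show ?case
      proof (cases "n \<in> S")
        case T: True
        then show ?thesis using proj_normal(2)[of n r S u ?b 0] Suc by (simp add: eq)
      next
        case False
        with True Suc have "?b(n := 0) = ?b" by (auto simp: fun_eq_iff)
        then show ?thesis using Suc by (simp add: eq)
      qed
    qed simp
    from this[of r] have "proj r u (S, \<lambda>i. if i < r then 0 else \<alpha> i) = proj r u (S, \<alpha>)" by simp
    moreover have "(\<lambda>i. if i < r then 0 else \<alpha> i) = (\<lambda>_. 0)"
      using assms by (auto simp: fun_eq_iff x idx_def exps_def)
    ultimately show ?thesis using True by (simp add: emb_def retr_def x)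
  next
    case False
    then obtain i where "i < r" "i \<notin> S" "\<alpha> i \<noteq> 0" by auto
    with False show ?thesis using proj_normal(1)[of i r S \<alpha> u] by (auto simp: emb_def x)
  qed
  with cone_d_homotopy[OF _ assms, of r u] show ?thesis by simp
qed

lemma cone_d_emb:
  assumes "x \<in> idx"
  shows "cone_d (emb c) x = emb (lefschetz c) x"
proof -
  obtain S \<alpha> where x: "x = (S, \<alpha>)" by force
  define C where "C \<longleftrightarrow> (\<forall>i<r. i \<notin> S \<longrightarrow> \<alpha> i = 0)"
  have "koszul_d i (emb c) x = 0" for i
    by (auto simp: koszul_d_def emb_def x)
  moreover have "norm_pair j (emb c) x = (if r \<notin> S \<and> {2*j, 2*j+1} \<subseteq> S \<and> C
      then c (insert r (S - {2*j, 2*j+1})) else 0)" if j: "j < 4" for j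
  proof (cases "r \<notin> S \<and> {2*j, 2*j+1} \<subseteq> S")
    case True
    have "emb c (insert r (S - {2*j, 2*j+1}), \<alpha>(2*j := b, 2*j+1 := d))
      = (if d = 0 then if b = 0 then if C then c (insert r (S - {2*j, 2*j+1})) else 0 else 0 else 0)" for b d
    proof -
      let ?a = "\<alpha>(2*j := b, 2*j+1 := d)"
      have "(\<forall>i<r. i \<notin> insert r (S - {2*j, 2*j+1}) \<longrightarrow> ?a i = 0) \<longleftrightarrow> b = 0 \<and> d = 0 \<and> (\<forall>i<r. i \<notin> S \<longrightarrow> \<alpha> i = 0)"
        (is "?l \<longleftrightarrow> ?r")
      proof
        assume l: ?l
        have "\<alpha> i = 0" if "i < r" "i \<notin> S" for i
        proof -
          have "i \<noteq> 2*j" "i \<noteq> 2*j+1" using True that by auto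
          then show ?thesis using l that by auto
        qed
        moreover have "b = 0" using l[rule_format, of "2*j"] j r_ge by simp
        moreover have "d = 0" using l[rule_format, of "2*j+1"] j r_ge by simp
        ultimately show ?r by simp
      qed auto
      then show ?thesis unfolding emb_def split C_def[symmetric] by simp
    qed
    then show ?thesis using True p_pos unfolding norm_pair_def x split C_def[symmetric] by simp
  qed (auto simp: norm_pair_def x)
  moreover have "emb (lefschetz c) x = (if C then lefschetz c S else 0)"
    unfolding emb_def x split C_def ..
  ultimately show ?thesis
    by (cases C; cases "r \<in> S") (simp_all add: cone_d_def norm_w_def lefschetz_def)
qed

text \<open>Multiplication by \<open>w\<close> has degree 2, and the source of a mapping cone is shifted by one more: a source
monomial \<open>e\<^sub>T\<close> sits in degree \<open>card T + 3\<close>, which is \<open>card S + 2\<close> for \<open>S = T \<union> {r}\<close>.\<close>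
definition deg :: "nat set \<Rightarrow> int" where
  "deg S = int (card S) + (if r \<in> S then 2 else 0)"

lemma cone_d_degree:
  assumes "\<And>S \<alpha>. (S, \<alpha>) \<in> idx \<Longrightarrow> deg S \<noteq> n \<Longrightarrow> u (S, \<alpha>) = 0"
    and x: "(S, \<alpha>) \<in> idx" "deg S \<noteq> n - 1"
  shows "cone_d u (S, \<alpha>) = 0"
proof -
  have S: "finite S" "S \<subseteq> {..r}" using x by (auto simp: idx_def intro: finite_subset)
  have "koszul_d i u (S, \<alpha>) = 0" if i: "i < r" for i
  proof (cases "i \<in> S")
    case False
    have "deg (insert i S) \<noteq> n"
      using x(2) S False i by (auto simp: deg_def)
    moreover have "(insert i S, \<alpha>(i := (\<alpha> i + p - 1) mod p)) \<in> idx" "(insert i S, \<alpha>) \<in> idx"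
      using x(1) i p_pos by (auto simp: idx_def intro!: exps_upd)
    ultimately show ?thesis using assms(1) by (simp add: koszul_d_def)
  qed (simp add: koszul_d_def)
  moreover have "norm_pair j u (S, \<alpha>) = 0" if j: "j < 4" for j
  proof (cases "r \<notin> S \<and> {2*j, 2*j+1} \<subseteq> S")
    case True
    have "card {2*j, 2*j+1} \<le> card S" using True S by (intro card_mono) auto
    then have "card (insert r (S - {2*j, 2*j+1})) + 1 = card S"
      using True S by (simp add: card_Diff_subset)
    then have "deg (insert r (S - {2*j, 2*j+1})) \<noteq> n"
      using x(2) True by (auto simp: deg_def)
    moreover have "(insert r (S - {2*j, 2*j+1}), \<alpha>(2*j := b, 2*j+1 := c)) \<in> idx" if "b < p" "c < p" for b c
      using that x(1) j r_ge by (auto simp: idx_def intro!: exps_upd)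
    ultimately have "u (insert r (S - {2*j, 2*j+1}), \<alpha>(2*j := b, 2*j+1 := c)) = 0" if "b < p" "c < p" for b c
      using that assms(1) by blast
    then show ?thesis by (simp add: norm_pair_def)
  qed (auto simp: norm_pair_def)
  ultimately show ?thesis by (simp add: cone_d_def norm_w_def)
qed

definition translate :: "(nat \<Rightarrow> nat) \<Rightarrow> (nat \<Rightarrow> nat) \<Rightarrow> nat \<Rightarrow> nat" where
  "translate \<gamma> \<alpha> = (\<lambda>i. (\<gamma> i + \<alpha> i) mod p)"

lemma sum_shift_mod: "(\<Sum>b<p. h ((a + b) mod p)) = (\<Sum>b<p. h b)" for h :: "nat \<Rightarrow> int"
proof -
  have "inj_on (\<lambda>b. (a + b) mod p) {..<p}"
  proof (rule inj_onI)
    fix b c assume bc: "b \<in> {..<p}" "c \<in> {..<p}" "(a + b) mod p = (a + c) mod p"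
    then have "b mod p = c mod p"
    proof -
      have "(int a + int b) mod int p = (int a + int c) mod int p"
        using bc(3) by (metis of_nat_add of_nat_mod)
      from mod_diff_cong[OF this refl, of "int a"] show ?thesis
        by (simp flip: of_nat_mod)
    qed
    with bc show "b = c" by simp
  qed
  moreover from this have "(\<lambda>b. (a + b) mod p) ` {..<p} = {..<p}"
    using p_pos by (intro card_subset_eq) (auto simp: card_image)
  ultimately show ?thesis
    using sum.reindex[of "\<lambda>b. (a + b) mod p" "{..<p}" h] by simp
qed

text \<open>Translation by a group element permutes the exponents cyclically, so it commutes with
multiplication by \<open>g\<^sub>i\<close> and with summation over all exponents.\<close>
lemma cone_d_translate: "cone_d (\<lambda>(S, \<alpha>). u (S, translate \<gamma> \<alpha>)) (S, \<alpha>) = cone_d u (S, translate \<gamma> \<alpha>)"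
proof -
  have tu: "translate \<gamma> (\<alpha>(i := v)) = (translate \<gamma> \<alpha>)(i := (\<gamma> i + v) mod p)" for \<alpha> i v
    by (auto simp: translate_def fun_eq_iff)
  have sh: "(\<gamma> i + (\<alpha> i + p - 1) mod p) mod p = (translate \<gamma> \<alpha> i + p - 1) mod p" for i
  proof -
    have "\<alpha> i + p - 1 = \<alpha> i + (p - 1)" "translate \<gamma> \<alpha> i + p - 1 = translate \<gamma> \<alpha> i + (p - 1)"
      using p_pos by auto
    then show ?thesis by (simp only: translate_def mod_add_left_eq mod_add_right_eq add.assoc)
  qed
  have "koszul_d i (\<lambda>(S, \<alpha>). u (S, translate \<gamma> \<alpha>)) (S, \<alpha>) = koszul_d i u (S, translate \<gamma> \<alpha>)" for i
    by (simp only: koszul_d_def split tu sh)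
  moreover have "norm_pair j (\<lambda>(S, \<alpha>). u (S, translate \<gamma> \<alpha>)) (S, \<alpha>) = norm_pair j u (S, translate \<gamma> \<alpha>)" for j
  proof -
    let ?h = "\<lambda>b c. u (insert r (S - {2*j, 2*j+1}), (translate \<gamma> \<alpha>)(2*j := b, 2*j+1 := c))"
    have "(\<Sum>b<p. \<Sum>c<p. ?h ((\<gamma> (2*j) + b) mod p) ((\<gamma> (2*j+1) + c) mod p)) = (\<Sum>b<p. \<Sum>c<p. ?h b c)"
      by (simp only: sum_shift_mod[of "\<lambda>c. ?h _ c"] sum_shift_mod[of "\<lambda>b. \<Sum>c<p. ?h b c"])
    then show ?thesis by (simp only: norm_pair_def split tu)
  qed
  ultimately show ?thesis by (simp add: cone_d_def norm_w_def)
qed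

lemma finite_exps: "finite exps"
proof -
  have "finite {\<alpha>. \<forall>i. (i \<in> {..<r} \<longrightarrow> \<alpha> i \<in> {..<p}) \<and> (i \<notin> {..<r} \<longrightarrow> \<alpha> i = 0)}"
    by (rule finite_set_of_finite_funs) auto
  then show ?thesis by (rule rev_finite_subset) (auto simp: exps_def)
qed

lemma finite_idx: "finite idx"
  by (simp add: idx_def finite_exps)

text \<open>In degree 0 the differential is a sum of multiples of the \<open>g\<^sub>i - 1\<close>.\<close>
lemma cone_d_augmentation: "(\<Sum>\<alpha>\<in>exps. cone_d u ({}, \<alpha>)) = 0"
proof -
  have "(\<Sum>\<alpha>\<in>exps. koszul_d i u ({}, \<alpha>)) = 0" if i: "i < r" for i
  proof -
    let ?s = "\<lambda>\<alpha> :: nat \<Rightarrow> nat. \<alpha>(i := (\<alpha> i + p - 1) mod p)"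
    have inj: "inj_on ?s exps"
    proof (rule inj_onI)
      fix \<alpha> \<beta> assume ab: "\<alpha> \<in> exps" "\<beta> \<in> exps" "?s \<alpha> = ?s \<beta>"
      then have "(\<alpha> i + p - 1) mod p = (\<beta> i + p - 1) mod p" "\<alpha> i < p" "\<beta> i < p"
        using i by (auto simp: exps_def dest: fun_cong[of _ _ i])
      then have "\<alpha> i = \<beta> i"
        by (cases "\<alpha> i = 0"; cases "\<beta> i = 0") (auto simp: mod_if split: if_splits)
      moreover have "\<alpha> k = \<beta> k" if "k \<noteq> i" for k
        using fun_cong[OF ab(3), of k] that by simp
      ultimately show "\<alpha> = \<beta>" by (metis ext)
    qed
    have "?s ` exps \<subseteq> exps" using i p_pos by (auto intro!: exps_upd)
    from endo_inj_surj[OF finite_exps this inj] have "(\<Sum>\<alpha>\<in>exps. u ({i}, ?s \<alpha>)) = (\<Sum>\<alpha>\<in>exps. u ({i}, \<alpha>))"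
      using sum.reindex[OF inj, of "\<lambda>\<alpha>. u ({i}, \<alpha>)"] by simp
    then show ?thesis by (simp add: koszul_d_def sum_distrib_left[symmetric] sum_subtractf)
  qed
  then have "(\<Sum>i<r. \<Sum>\<alpha>\<in>exps. koszul_d i u ({}, \<alpha>)) = 0" by simp
  then have "(\<Sum>\<alpha>\<in>exps. \<Sum>i<r. koszul_d i u ({}, \<alpha>)) = 0" by (subst sum.swap)
  then show ?thesis by (simp add: cone_d_def norm_w_def norm_pair_def)
qed

end

section \<open>Integer matrices acting on vectors over an abelian group\<close>
definition delta :: "'a \<Rightarrow> 'a \<Rightarrow> int" where
  "delta x = (\<lambda>y. if y = x then 1 else 0)"

text \<open>The matrix of an operator is read off from its values on the \<open>delta x\<close>.\<close>
lemma int_linear_expand: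
  assumes "finite X" "int_linear X Y f" "y \<in> Y"
  shows "f u y = (\<Sum>x\<in>X. f (delta x) y * u x)"
proof -
  have "f u y = f (\<lambda>z. \<Sum>x\<in>X. u x * delta x z) y"
  proof (rule int_linear_cong[OF assms(2) _ assms(3)])
    fix z assume "z \<in> X"
    have "(\<Sum>x\<in>X. u x * delta x z) = (\<Sum>x\<in>X. if z = x then u x else 0)"
      by (intro sum.cong) (auto simp: delta_def)
    with \<open>z \<in> X\<close> show "u z = (\<Sum>x\<in>X. u x * delta x z)"
      by (simp add: assms(1))
  qed
  also have "\<dots> = (\<Sum>x\<in>X. f (\<lambda>z. u x * delta x z) y)"
    by (rule int_linear_sum_apply[OF assms(2,3)])
  also have "\<dots> = (\<Sum>x\<in>X. f (delta x) y * u x)"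
    by (simp add: int_linear_scale[OF assms(2,3)] mult.commute)
  finally show ?thesis .
qed

lemma (in comm_monoid) finprod_commute:
  assumes "finite X" "finite Y" "\<And>x y. x \<in> X \<Longrightarrow> y \<in> Y \<Longrightarrow> f x y \<in> carrier G"
  shows "(\<Otimes>x\<in>X. \<Otimes>y\<in>Y. f x y) = (\<Otimes>y\<in>Y. \<Otimes>x\<in>X. f x y)"
  using assms(2,3)
proof (induction Y rule: finite_induct)
  case (insert y Y)
  have "(\<Otimes>x\<in>X. \<Otimes>y\<in>insert y Y. f x y) = (\<Otimes>x\<in>X. f x y \<otimes> (\<Otimes>y\<in>Y. f x y))"
    using insert by (intro finprod_cong') auto
  also have "\<dots> = (\<Otimes>x\<in>X. f x y) \<otimes> (\<Otimes>x\<in>X. \<Otimes>y\<in>Y. f x y)"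
    using insert by (intro finprod_multf) auto
  finally show ?case using insert by auto
qed simp

context abelian_monoid
begin
lemmas finsum_commute = add.finprod_commute
end

lemma (in abelian_monoid) finsum_bij:
  assumes "bij_betw h A B" "\<And>b. b \<in> B \<Longrightarrow> f b \<in> carrier G"
  shows "(\<Oplus>b\<in>B. f b) = (\<Oplus>a\<in>A. f (h a))"
  using assms finsum_reindex[of f h A] by (auto simp: bij_betw_def)

lemma (in abelian_monoid) finsum_single:
  assumes "finite A" "a \<in> A" "f a \<in> carrier G" "\<And>x. x \<in> A \<Longrightarrow> x \<noteq> a \<Longrightarrow> f x = \<zero>"
  shows "(\<Oplus>x\<in>A. f x) = f a"
proof -
  have "(\<Oplus>x\<in>A. f x) = (\<Oplus>x\<in>A. if a = x then f x else \<zero>)"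
    using assms by (intro finsum_cong') auto
  also have "\<dots> = f a"
  proof (rule finsum_singleton[OF assms(2,1)])
    show "f \<in> A \<rightarrow> carrier G"
    proof
      fix x assume "x \<in> A"
      then show "f x \<in> carrier G" using assms(3) assms(4)[of x] by (cases "x = a") simp_all
    qed
  qed
  finally show ?thesis .
qed

context abelian_group
begin

lemma int_mult_0 [simp]: "[(0 :: int)] \<cdot> a = \<zero>"
  by (simp add: add_pow_def)

lemma int_mult_1 [simp]: "a \<in> carrier G \<Longrightarrow> [(1 :: int)] \<cdot> a = a"
  by (rule add.int_pow_1)

lemma int_mult_sum_left:
  assumes "finite X" "a \<in> carrier G"
  shows "[((\<Sum>x\<in>X. k x) :: int)] \<cdot> a = (\<Oplus>x\<in>X. [k x] \<cdot> a)"
  using assms by (induction X rule: finite_induct) (auto simp: add.int_pow_mult)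

lemma int_mult_sum_right:
  assumes "finite X" "\<And>x. x \<in> X \<Longrightarrow> f x \<in> carrier G"
  shows "[(k :: int)] \<cdot> (\<Oplus>x\<in>X. f x) = (\<Oplus>x\<in>X. [k] \<cdot> f x)"
  using assms by (induction X rule: finite_induct) (auto simp: add.int_pow_distrib)

text \<open>The operator \<open>f\<close> with its integer matrix applied to vectors over \<open>G\<close>. Identities between operators on
integer-valued functions are inherited by their actions through \<open>act_cong\<close>, \<open>act_comp\<close>, \<open>act_plus\<close> and \<open>act_id\<close>.\<close>
definition act :: "'x set \<Rightarrow> 'y set \<Rightarrow> (('x \<Rightarrow> int) \<Rightarrow> 'y \<Rightarrow> int) \<Rightarrow> ('x \<Rightarrow> 'a) \<Rightarrow> 'y \<Rightarrow> 'a" where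
  "act X Y f u = (\<lambda>y\<in>Y. \<Oplus>x\<in>X. [f (delta x) y] \<cdot> u x)"

lemma act_closed: "u \<in> X \<rightarrow>\<^sub>E carrier G \<Longrightarrow> act X Y f u \<in> Y \<rightarrow>\<^sub>E carrier G"
  unfolding act_def by (auto intro!: finsum_closed)

lemma act_cong:
  assumes "\<And>x y. x \<in> X \<Longrightarrow> y \<in> Y \<Longrightarrow> f (delta x) y = g (delta x) y" "u \<in> X \<rightarrow>\<^sub>E carrier G"
  shows "act X Y f u = act X Y g u"
  unfolding act_def using assms by (intro restrict_ext finsum_cong') auto

lemma act_comp:
  assumes fin: "finite X" "finite Y" and g: "int_linear Y Z g" and u: "u \<in> X \<rightarrow>\<^sub>E carrier G"
  shows "act Y Z g (act X Y f u) = act X Z (\<lambda>u. g (f u)) u"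
proof -
  have u': "u x \<in> carrier G" if "x \<in> X" for x using u that by auto
  have product: "(\<Oplus>y\<in>Y. [g (delta y) z] \<cdot> (\<Oplus>x\<in>X. [f (delta x) y] \<cdot> u x)) = (\<Oplus>x\<in>X. [g (f (delta x)) z] \<cdot> u x)"
    if z: "z \<in> Z" for z
  proof -
    have "(\<Oplus>y\<in>Y. [g (delta y) z] \<cdot> (\<Oplus>x\<in>X. [f (delta x) y] \<cdot> u x))
      = (\<Oplus>y\<in>Y. \<Oplus>x\<in>X. [(f (delta x) y * g (delta y) z)] \<cdot> u x)"
      using fin u' by (intro finsum_cong') (auto simp: int_mult_sum_right add.int_pow_pow intro!: finsum_cong' finsum_closed)
    also have "\<dots> = (\<Oplus>x\<in>X. \<Oplus>y\<in>Y. [(f (delta x) y * g (delta y) z)] \<cdot> u x)"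
      using fin u' by (intro finsum_commute) auto
    also have "\<dots> = (\<Oplus>x\<in>X. [g (f (delta x)) z] \<cdot> u x)"
    proof (intro finsum_cong' refl)
      fix x assume x: "x \<in> X"
      have "g (f (delta x)) z = (\<Sum>y\<in>Y. f (delta x) y * g (delta y) z)"
        using int_linear_expand[OF fin(2) g z, of "f (delta x)"] by (simp only: mult.commute)
      then show "(\<Oplus>y\<in>Y. [(f (delta x) y * g (delta y) z)] \<cdot> u x) = [g (f (delta x)) z] \<cdot> u x"
        by (simp only: int_mult_sum_left[OF fin(2) u'[OF x]])
    qed (use u' in auto)
    finally show ?thesis .
  qed
  show ?thesis
    unfolding act_def[of Y] act_def[of X Z]
  proof (intro restrict_ext)
    fix z assume z: "z \<in> Z"
    have "(\<Oplus>y\<in>Y. [g (delta y) z] \<cdot> act X Y f u y)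
      = (\<Oplus>y\<in>Y. [g (delta y) z] \<cdot> (\<Oplus>x\<in>X. [f (delta x) y] \<cdot> u x))"
      using u' by (intro finsum_cong' refl) (auto simp: act_def intro!: finsum_closed)
    then show "(\<Oplus>y\<in>Y. [g (delta y) z] \<cdot> act X Y f u y) = (\<Oplus>x\<in>X. [g (f (delta x)) z] \<cdot> u x)"
      using product[OF z] by simp
  qed
qed

lemma act_plus:
  assumes "u \<in> X \<rightarrow>\<^sub>E carrier G" "y \<in> Y"
  shows "act X Y (\<lambda>u y. f u y + g u y) u y = act X Y f u y \<oplus> act X Y g u y"
proof -
  have u': "u x \<in> carrier G" if "x \<in> X" for x using assms(1) that by auto
  have "(\<Oplus>x\<in>X. [(f (delta x) y + g (delta x) y)] \<cdot> u x) = (\<Oplus>x\<in>X. [f (delta x) y] \<cdot> u x \<oplus> [g (delta x) y] \<cdot> u x)"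
    using u' by (intro finsum_cong') (auto simp: add.int_pow_mult)
  also have "\<dots> = (\<Oplus>x\<in>X. [f (delta x) y] \<cdot> u x) \<oplus> (\<Oplus>x\<in>X. [g (delta x) y] \<cdot> u x)"
    using u' by (intro finsum_addf) auto
  finally show ?thesis using assms(2) by (simp add: act_def)
qed

lemma act_id:
  assumes "finite X" "u \<in> X \<rightarrow>\<^sub>E carrier G"
  shows "act X X (\<lambda>u. u) u = u"
proof
  fix y
  show "act X X (\<lambda>u. u) u y = u y"
  proof (cases "y \<in> X")
    case True
    have "(\<Oplus>x\<in>X. [delta x y] \<cdot> u x) = [delta y y] \<cdot> u y"
      using True assms by (intro finsum_single) (auto simp: delta_def)
    moreover have "u y \<in> carrier G" using True assms by auto
    ultimately show ?thesis using True by (simp add: act_def) (simp add: delta_def)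
  next
    case False
    with assms(2) show ?thesis by (auto simp: act_def)
  qed
qed

lemma act_add:
  assumes "u \<in> X \<rightarrow>\<^sub>E carrier G" "v \<in> X \<rightarrow>\<^sub>E carrier G" "y \<in> Y"
  shows "act X Y f (\<lambda>x\<in>X. u x \<oplus> v x) y = act X Y f u y \<oplus> act X Y f v y"
proof -
  have u': "u x \<in> carrier G" "v x \<in> carrier G" if "x \<in> X" for x using assms(1,2) that by auto
  have "(\<Oplus>x\<in>X. [f (delta x) y] \<cdot> (\<lambda>x\<in>X. u x \<oplus> v x) x) = (\<Oplus>x\<in>X. [f (delta x) y] \<cdot> u x \<oplus> [f (delta x) y] \<cdot> v x)"
    using u' by (intro finsum_cong') (auto simp: add.int_pow_distrib)
  also have "\<dots> = (\<Oplus>x\<in>X. [f (delta x) y] \<cdot> u x) \<oplus> (\<Oplus>x\<in>X. [f (delta x) y] \<cdot> v x)"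
    using u' by (intro finsum_addf) auto
  finally show ?thesis using assms(3) by (simp add: act_def)
qed

end

lemma (in ring) act_smult:
  assumes "c \<in> carrier R" "u \<in> X \<rightarrow>\<^sub>E carrier R" "y \<in> Y" "finite X"
  shows "act X Y f (\<lambda>x\<in>X. c \<otimes> u x) y = c \<otimes> act X Y f u y"
proof -
  have u': "u x \<in> carrier R" if "x \<in> X" for x using assms(2) that by auto
  have "(\<Oplus>x\<in>X. [f (delta x) y] \<cdot> (\<lambda>x\<in>X. c \<otimes> u x) x) = (\<Oplus>x\<in>X. c \<otimes> ([f (delta x) y] \<cdot> u x))"
    using u' assms by (intro finsum_cong') (auto simp: add_pow_rdistr_int)
  also have "\<dots> = c \<otimes> (\<Oplus>x\<in>X. [f (delta x) y] \<cdot> u x)"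
    using u' assms by (intro finsum_rdistr[symmetric]) auto
  finally show ?thesis using assms(3) by (simp add: act_def)
qed

context cring
begin

section \<open>Function modules and their bases\<close>
lemma func_space_simps:
  "carrier (func_space X) = X \<rightarrow>\<^sub>E carrier R"
  "u \<oplus>\<^bsub>func_space X\<^esub> v = (\<lambda>x\<in>X. u x \<oplus> v x)"
  "c \<odot>\<^bsub>func_space X\<^esub> u = (\<lambda>x\<in>X. c \<otimes> u x)"
  "\<zero>\<^bsub>func_space X\<^esub> = (\<lambda>x\<in>X. \<zero>)"
  by (simp_all add: func_space_def)

lemma act_mod_hom:
  assumes "finite X"
  shows "mod_hom R (func_space X) (func_space Y) (act X Y f)"
proof -
  interpret X: Module.module R "func_space X" by (rule func_space_is_module)
  interpret Y: Module.module R "func_space Y" by (rule func_space_is_module)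
  have "act X Y f \<in> LinearCombinations.module_hom R (func_space X) (func_space Y)"
    unfolding LinearCombinations.module_hom_def
  proof (rule CollectI, intro conjI allI impI)
    show "act X Y f \<in> carrier (func_space X) \<rightarrow> carrier (func_space Y)"
      by (rule Pi_I) (simp only: func_space_simps act_closed)
  next
    fix u v assume uv: "u \<in> carrier (func_space X) \<and> v \<in> carrier (func_space X)"
    then have "u \<oplus>\<^bsub>func_space X\<^esub> v \<in> X \<rightarrow>\<^sub>E carrier R"
      using X.M.a_closed[of u v] by (simp only: func_space_simps)
    then have *: "act X Y f (\<lambda>x\<in>X. u x \<oplus> v x) \<in> Y \<rightarrow>\<^sub>E carrier R"
      unfolding func_space_simps by (rule act_closed)
    show "act X Y f (u \<oplus>\<^bsub>func_space X\<^esub> v) = act X Y f u \<oplus>\<^bsub>func_space Y\<^esub> act X Y f v"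
      unfolding func_space_simps
    proof
      fix y
      show "act X Y f (\<lambda>x\<in>X. u x \<oplus> v x) y = (\<lambda>y\<in>Y. act X Y f u y \<oplus> act X Y f v y) y"
        using act_add[of u X v y Y f] uv PiE_arb[OF *] by (cases "y \<in> Y") (simp_all add: func_space_simps)
    qed
  next
    fix c u assume cu: "c \<in> carrier R \<and> u \<in> carrier (func_space X)"
    then have "c \<odot>\<^bsub>func_space X\<^esub> u \<in> X \<rightarrow>\<^sub>E carrier R"
      using X.smult_closed[of c u] by (simp only: func_space_simps)
    then have *: "act X Y f (\<lambda>x\<in>X. c \<otimes> u x) \<in> Y \<rightarrow>\<^sub>E carrier R"
      unfolding func_space_simps by (rule act_closed)
    show "act X Y f (c \<odot>\<^bsub>func_space X\<^esub> u) = c \<odot>\<^bsub>func_space Y\<^esub> act X Y f u"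
      unfolding func_space_simps
    proof
      fix y
      show "act X Y f (\<lambda>x\<in>X. c \<otimes> u x) y = (\<lambda>y\<in>Y. c \<otimes> act X Y f u y) y"
        using act_smult[of c u X y Y f] cu PiE_arb[OF *] assms by (cases "y \<in> Y") (simp_all add: func_space_simps)
    qed
  qed
  then show ?thesis
    by (simp add: mod_hom_def mod_hom_axioms_def func_space_is_module)
qed

lemma func_space_finsum_apply:
  assumes "finite I" "\<And>i. i \<in> I \<Longrightarrow> f i \<in> X \<rightarrow>\<^sub>E carrier R" "x \<in> X"
  shows "(\<Oplus>\<^bsub>func_space X\<^esub>i\<in>I. f i) x = (\<Oplus>i\<in>I. f i x)"
proof -
  interpret X: Module.module R "func_space X" by (rule func_space_is_module)
  show ?thesis
    using assms(1,2)
  proof (induction I rule: finite_induct)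
    case (insert i I)
    then have "(\<Oplus>\<^bsub>func_space X\<^esub>i\<in>insert i I. f i) = f i \<oplus>\<^bsub>func_space X\<^esub> (\<Oplus>\<^bsub>func_space X\<^esub>i\<in>I. f i)"
      by (intro X.M.finsum_insert) (auto simp: func_space_simps)
    moreover have "(\<Oplus>i\<in>insert i I. f i x) = f i x \<oplus> (\<Oplus>i\<in>I. f i x)"
      using insert assms(3) by (intro finsum_insert) auto
    ultimately show ?case using insert assms(3) by (simp add: func_space_simps)
  qed (simp add: func_space_simps assms)
qed

definition unit_fun :: "'x set \<Rightarrow> 'x \<Rightarrow> 'x \<Rightarrow> 'a" where
  "unit_fun X x = (\<lambda>y\<in>X. if y = x then \<one> else \<zero>)"

lemma unit_fun_closed: "unit_fun X x \<in> X \<rightarrow>\<^sub>E carrier R"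
  by (auto simp: unit_fun_def)

lemma inj_unit_fun:
  assumes "\<one> \<noteq> \<zero>"
  shows "inj_on (unit_fun X) X"
proof (rule inj_onI)
  fix x y assume "x \<in> X" "y \<in> X" "unit_fun X x = unit_fun X y"
  then have "unit_fun X x x = unit_fun X y x" "x \<in> X" by simp_all
  then show "x = y" using assms by (simp add: unit_fun_def split: if_splits)
qed

lemma finite_basis_func_space:
  assumes "finite X" "\<one> \<noteq> \<zero>"
  shows "finite_basis R (func_space X) (unit_fun X ` X)"
  unfolding finite_basis_def
proof (intro conjI ballI)
  let ?B = "unit_fun X ` X"
  show "finite ?B" using assms by simp
  show "?B \<subseteq> carrier (func_space X)" by (rule image_subsetI) (simp add: func_space_simps unit_fun_closed)
  interpret X: Module.module R "func_space X" by (rule func_space_is_module)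
  fix u assume u: "u \<in> carrier (func_space X)"
  have summand: "a b \<odot>\<^bsub>func_space X\<^esub> b \<in> carrier (func_space X)"
    if a: "a \<in> ?B \<rightarrow>\<^sub>E carrier R" and b: "b \<in> ?B" for a b
  proof -
    obtain x where "b = unit_fun X x" using b by auto
    then have "b \<in> carrier (func_space X)" by (simp only: func_space_simps unit_fun_closed)
    moreover have "a b \<in> carrier R" using a b by (rule PiE_mem)
    ultimately show ?thesis by simp
  qed
  have coord: "(\<Oplus>\<^bsub>func_space X\<^esub>b\<in>?B. a b \<odot>\<^bsub>func_space X\<^esub> b) x = a (unit_fun X x)"
    if a: "a \<in> ?B \<rightarrow>\<^sub>E carrier R" and x: "x \<in> X" for a x
  proof -
    have *: "a (unit_fun X y) \<in> carrier R" if "y \<in> X" for y using a that by auto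
    have "(\<Oplus>\<^bsub>func_space X\<^esub>b\<in>?B. a b \<odot>\<^bsub>func_space X\<^esub> b) x = (\<Oplus>b\<in>?B. (a b \<odot>\<^bsub>func_space X\<^esub> b) x)"
      using summand[OF a] x assms by (intro func_space_finsum_apply) (simp_all only: func_space_simps finite_imageI)
    also have "\<dots> = (\<Oplus>y\<in>X. (a (unit_fun X y) \<odot>\<^bsub>func_space X\<^esub> unit_fun X y) x)"
      using a x * by (intro finsum_reindex inj_unit_fun assms) (auto simp: func_space_simps unit_fun_def)
    also have "\<dots> = (a (unit_fun X x) \<odot>\<^bsub>func_space X\<^esub> unit_fun X x) x"
      using a x * assms by (intro finsum_single) (auto simp: func_space_simps unit_fun_def)
    also have "\<dots> = a (unit_fun X x)" using x * by (simp add: func_space_simps unit_fun_def)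
    finally show ?thesis .
  qed
  have sum_closed: "(\<Oplus>\<^bsub>func_space X\<^esub>b\<in>?B. a b \<odot>\<^bsub>func_space X\<^esub> b) \<in> X \<rightarrow>\<^sub>E carrier R"
    if "a \<in> ?B \<rightarrow>\<^sub>E carrier R" for a
  proof -
    have "(\<Oplus>\<^bsub>func_space X\<^esub>b\<in>?B. a b \<odot>\<^bsub>func_space X\<^esub> b) \<in> carrier (func_space X)"
      using summand[OF that] by (intro X.M.finsum_closed) blast
    then show ?thesis by (simp add: func_space_simps)
  qed
  let ?a = "\<lambda>b\<in>?B. u (the_inv_into X (unit_fun X) b)"
  have inv: "the_inv_into X (unit_fun X) (unit_fun X x) = x" if "x \<in> X" for x
    using that by (rule the_inv_into_f_f[OF inj_unit_fun[OF assms(2)]])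
  show "\<exists>!a. a \<in> ?B \<rightarrow>\<^sub>E carrier R \<and> u = (\<Oplus>\<^bsub>func_space X\<^esub>b\<in>?B. a b \<odot>\<^bsub>func_space X\<^esub> b)"
  proof (rule ex1I[of _ ?a])
    have a: "?a \<in> ?B \<rightarrow>\<^sub>E carrier R" using u by (auto simp: func_space_simps inv)
    moreover have "u = (\<Oplus>\<^bsub>func_space X\<^esub>b\<in>?B. ?a b \<odot>\<^bsub>func_space X\<^esub> b)"
    proof (rule PiE_ext[OF _ sum_closed[OF a]])
      show "u \<in> X \<rightarrow>\<^sub>E carrier R" using u by (simp only: func_space_simps)
      fix x assume x: "x \<in> X"
      show "u x = (\<Oplus>\<^bsub>func_space X\<^esub>b\<in>?B. ?a b \<odot>\<^bsub>func_space X\<^esub> b) x"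
        unfolding coord[OF a x] using x by (simp add: inv)
    qed
    ultimately show "?a \<in> ?B \<rightarrow>\<^sub>E carrier R \<and> u = (\<Oplus>\<^bsub>func_space X\<^esub>b\<in>?B. ?a b \<odot>\<^bsub>func_space X\<^esub> b)" by simp
  next
    fix a assume a: "a \<in> ?B \<rightarrow>\<^sub>E carrier R \<and> u = (\<Oplus>\<^bsub>func_space X\<^esub>b\<in>?B. a b \<odot>\<^bsub>func_space X\<^esub> b)"
    then have ab: "a \<in> ?B \<rightarrow>\<^sub>E carrier R" by simp
    have "u x = a (unit_fun X x)" if "x \<in> X" for x
      using a coord[OF ab that] by simp
    then show "a = ?a" using ab
      by (intro PiE_ext[OF ab]) (auto simp: inv)
  qed
qed

end

lemma (in vectorspace) basis_iff_finite_basis: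
  "finite_basis K V B \<longleftrightarrow> finite B \<and> basis B"
proof -
  have "finite_basis K V B \<longleftrightarrow> finite B \<and> B \<subseteq> carrier V \<and>
      (\<forall>v. v \<in> carrier V \<longrightarrow> (\<exists>!a. a \<in> B \<rightarrow>\<^sub>E carrier K \<and> lincomb a B = v))"
  proof -
    have eq: "(\<exists>!a. P a \<and> x = f a) \<longleftrightarrow> (\<exists>!a. P a \<and> f a = x)" for P x and f :: "_ \<Rightarrow> 'c"
      by metis
    show ?thesis by (simp only: finite_basis_def lincomb_def eq Ball_def)
  qed
  also have "\<dots> \<longleftrightarrow> finite B \<and> basis B"
  proof (cases "finite B \<and> B \<subseteq> carrier V")
    case True
    with basis_criterion[of B] show ?thesis by simp
  next
    case False
    then show ?thesis by (auto simp: basis_def)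
  qed
  finally show ?thesis .
qed

text \<open>All finite bases have \<open>dim\<close> elements, so the infimum in \<open>rank_over\<close> is attained.\<close>
lemma (in vectorspace) rank_over_eq_dim:
  assumes "fin_dim"
  shows "rank_over K V = enat dim"
proof -
  obtain B where B: "finite B" "basis B" using finite_basis_exists[OF assms] by auto
  have "enat (card B') = enat dim" if "finite_basis K V B'" for B'
    using that dim_basis[of B'] by (simp add: basis_iff_finite_basis)
  moreover have "finite_basis K V B" using B by (simp add: basis_iff_finite_basis)
  ultimately show ?thesis unfolding rank_over_def
    by (intro antisym INF_lower2[of B] INF_greatest) auto
qed

section \<open>Module structures on images and quotients\<close>

text \<open>The axioms of a module pass to the image of a map that respects the operations. For the homology,
this replaces a separate verification for the quotients, their direct sum and the restriction of
scalars.\<close>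
lemma module_of_surjection:
  assumes "Module.module R V" and im: "\<Phi> ` carrier V = carrier H"
    and add: "\<And>x y. x \<in> carrier V \<Longrightarrow> y \<in> carrier V \<Longrightarrow> \<Phi> (x \<oplus>\<^bsub>V\<^esub> y) = \<Phi> x \<oplus>\<^bsub>H\<^esub> \<Phi> y"
    and smult: "\<And>c x. c \<in> carrier R \<Longrightarrow> x \<in> carrier V \<Longrightarrow> \<Phi> (c \<odot>\<^bsub>V\<^esub> x) = c \<odot>\<^bsub>H\<^esub> \<Phi> x"
    and zero: "\<Phi> \<zero>\<^bsub>V\<^esub> = \<zero>\<^bsub>H\<^esub>"
  shows "Module.module R H"
proof -
  interpret V: Module.module R V by fact
  have rep: "\<exists>y\<in>carrier V. x = \<Phi> y" if "x \<in> carrier H" for x using that im by auto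
  have closed: "\<Phi> x \<in> carrier H" if "x \<in> carrier V" for x using that im by auto
  show ?thesis
  proof (rule module_criteria)
    show "cring R" by (rule V.R.is_cring)
    show "\<zero>\<^bsub>H\<^esub> \<in> carrier H" using closed[OF V.M.zero_closed] zero by simp
    show "\<forall>v w. v \<in> carrier H \<and> w \<in> carrier H \<longrightarrow> v \<oplus>\<^bsub>H\<^esub> w \<in> carrier H"
      using rep closed by (metis add V.M.a_closed)
    show "\<forall>v\<in>carrier H. \<exists>n\<in>carrier H. v \<oplus>\<^bsub>H\<^esub> n = \<zero>\<^bsub>H\<^esub>"
    proof
      fix v assume "v \<in> carrier H"
      then obtain x where x: "x \<in> carrier V" "v = \<Phi> x" using rep by blast
      then have "v \<oplus>\<^bsub>H\<^esub> \<Phi> (\<ominus>\<^bsub>V\<^esub> x) = \<zero>\<^bsub>H\<^esub>"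
        using add[of x "\<ominus>\<^bsub>V\<^esub> x"] by (simp add: V.M.r_neg zero)
      then show "\<exists>n\<in>carrier H. v \<oplus>\<^bsub>H\<^esub> n = \<zero>\<^bsub>H\<^esub>" using x closed by blast
    qed
    show "\<forall>c v. c \<in> carrier R \<and> v \<in> carrier H \<longrightarrow> c \<odot>\<^bsub>H\<^esub> v \<in> carrier H"
      using rep closed by (metis smult V.smult_closed)
    show "\<forall>v w. v \<in> carrier H \<and> w \<in> carrier H \<longrightarrow> v \<oplus>\<^bsub>H\<^esub> w = w \<oplus>\<^bsub>H\<^esub> v"
      using rep by (metis add V.M.a_comm)
    show "\<forall>v w x. v \<in> carrier H \<and> w \<in> carrier H \<and> x \<in> carrier H \<longrightarrow> v \<oplus>\<^bsub>H\<^esub> w \<oplus>\<^bsub>H\<^esub> x = v \<oplus>\<^bsub>H\<^esub> (w \<oplus>\<^bsub>H\<^esub> x)"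
    proof (intro allI impI)
      fix v w x assume "v \<in> carrier H \<and> w \<in> carrier H \<and> x \<in> carrier H"
      then obtain a b c where "a \<in> carrier V" "b \<in> carrier V" "c \<in> carrier V" "v = \<Phi> a" "w = \<Phi> b" "x = \<Phi> c"
        using rep by meson
      then show "v \<oplus>\<^bsub>H\<^esub> w \<oplus>\<^bsub>H\<^esub> x = v \<oplus>\<^bsub>H\<^esub> (w \<oplus>\<^bsub>H\<^esub> x)"
        by (simp add: add[symmetric] V.M.a_assoc)
    qed
    show "\<forall>v\<in>carrier H. v \<oplus>\<^bsub>H\<^esub> \<zero>\<^bsub>H\<^esub> = v"
      using rep by (metis add zero V.M.r_zero V.M.zero_closed)
    show "\<forall>a b v. a \<in> carrier R \<and> b \<in> carrier R \<and> v \<in> carrier H \<longrightarrow> a \<otimes>\<^bsub>R\<^esub> b \<odot>\<^bsub>H\<^esub> v = a \<odot>\<^bsub>H\<^esub> (b \<odot>\<^bsub>H\<^esub> v)"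
      using rep by (metis smult V.smult_assoc1 V.smult_closed V.R.m_closed)
    show "\<forall>v\<in>carrier H. \<one>\<^bsub>R\<^esub> \<odot>\<^bsub>H\<^esub> v = v"
      using rep by (metis smult V.smult_one V.R.one_closed)
    show "\<forall>a b v. a \<in> carrier R \<and> b \<in> carrier R \<and> v \<in> carrier H \<longrightarrow> (a \<oplus>\<^bsub>R\<^esub> b) \<odot>\<^bsub>H\<^esub> v = a \<odot>\<^bsub>H\<^esub> v \<oplus>\<^bsub>H\<^esub> b \<odot>\<^bsub>H\<^esub> v"
    proof (intro allI impI)
      fix a b v assume h: "a \<in> carrier R \<and> b \<in> carrier R \<and> v \<in> carrier H"
      then obtain x where "x \<in> carrier V" "v = \<Phi> x" using rep by meson
      with h show "(a \<oplus>\<^bsub>R\<^esub> b) \<odot>\<^bsub>H\<^esub> v = a \<odot>\<^bsub>H\<^esub> v \<oplus>\<^bsub>H\<^esub> b \<odot>\<^bsub>H\<^esub> v"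
        by (simp add: add[symmetric] smult[symmetric] V.smult_l_distr)
    qed
    show "\<forall>a v w. a \<in> carrier R \<and> v \<in> carrier H \<and> w \<in> carrier H \<longrightarrow> a \<odot>\<^bsub>H\<^esub> (v \<oplus>\<^bsub>H\<^esub> w) = a \<odot>\<^bsub>H\<^esub> v \<oplus>\<^bsub>H\<^esub> a \<odot>\<^bsub>H\<^esub> w"
    proof (intro allI impI)
      fix a v w assume h: "a \<in> carrier R \<and> v \<in> carrier H \<and> w \<in> carrier H"
      then obtain x y where "x \<in> carrier V" "v = \<Phi> x" "y \<in> carrier V" "w = \<Phi> y" using rep by meson
      with h show "a \<odot>\<^bsub>H\<^esub> (v \<oplus>\<^bsub>H\<^esub> w) = a \<odot>\<^bsub>H\<^esub> v \<oplus>\<^bsub>H\<^esub> a \<odot>\<^bsub>H\<^esub> w"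
        by (simp add: add[symmetric] smult[symmetric] V.smult_r_distr)
    qed
  qed
qed

context
  fixes R :: "('r, 'a) ring_scheme" and M :: "('r, 'm, 'b) module_scheme" and N :: "'m set"
  assumes M: "Module.module R M" and N: "submodule R N M"
begin

interpretation M: Module.module R M by (rule M)
interpretation N: submodule R N M by (rule N)

lemma submodule_abelian_subgroup: "abelian_subgroup N M"
proof (rule abelian_subgroupI3)
  show "additive_subgroup N M"
  proof (intro additive_subgroup.intro subgroup.intro)
    fix x assume x: "x \<in> N"
    then have "\<ominus>\<^bsub>M\<^esub> x = (\<ominus>\<^bsub>R\<^esub> \<one>\<^bsub>R\<^esub>) \<odot>\<^bsub>M\<^esub> x"
      using N.subset M.smult_l_minus[of "\<one>\<^bsub>R\<^esub>" x] by auto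
    then show "inv\<^bsub>add_monoid M\<^esub> x \<in> N"
      using x N.smult_closed[of "\<ominus>\<^bsub>R\<^esub> \<one>\<^bsub>R\<^esub>" x] by (simp add: a_inv_def)
  qed (use N.subset in auto)
  show "abelian_group M" ..
qed

interpretation Q: abelian_subgroup N M by (rule submodule_abelian_subgroup)

lemma quotient_module_carrier: "carrier (quotient_module M N) = (\<lambda>x. N +>\<^bsub>M\<^esub> x) ` carrier M"
  by (auto simp: quotient_module_def A_RCOSETS_def')

lemma quotient_module_add:
  "x \<in> carrier M \<Longrightarrow> y \<in> carrier M \<Longrightarrow>
     (N +>\<^bsub>M\<^esub> x) \<oplus>\<^bsub>quotient_module M N\<^esub> (N +>\<^bsub>M\<^esub> y) = N +>\<^bsub>M\<^esub> (x \<oplus>\<^bsub>M\<^esub> y)"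
  by (simp add: quotient_module_def Q.a_rcos_sum)

lemma quotient_module_zero: "\<zero>\<^bsub>quotient_module M N\<^esub> = N"
  by (simp add: quotient_module_def)

lemma coset_eq_iff: "x \<in> carrier M \<Longrightarrow> N +>\<^bsub>M\<^esub> x = N \<longleftrightarrow> x \<in> N"
  using Q.a_rcos_const[of x] Q.a_rcos_self[of x] by auto

text \<open>The union that defines the scalar multiplication of a quotient runs over cosets that all coincide.\<close>
lemma quotient_module_smult:
  assumes "a \<in> carrier R" "x \<in> carrier M"
  shows "a \<odot>\<^bsub>quotient_module M N\<^esub> (N +>\<^bsub>M\<^esub> x) = N +>\<^bsub>M\<^esub> (a \<odot>\<^bsub>M\<^esub> x)"
proof -
  have "N +>\<^bsub>M\<^esub> (a \<odot>\<^bsub>M\<^esub> x') = N +>\<^bsub>M\<^esub> (a \<odot>\<^bsub>M\<^esub> x)" if x': "x' \<in> N +>\<^bsub>M\<^esub> x" for x'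
  proof -
    obtain n where n: "n \<in> N" "x' = n \<oplus>\<^bsub>M\<^esub> x" using x' by (auto simp: a_r_coset_def')
    then have "n \<in> carrier M" using N.subset by auto
    then have "a \<odot>\<^bsub>M\<^esub> x' = a \<odot>\<^bsub>M\<^esub> n \<oplus>\<^bsub>M\<^esub> a \<odot>\<^bsub>M\<^esub> x"
      using assms n by (simp add: M.smult_r_distr)
    then have "a \<odot>\<^bsub>M\<^esub> x' \<in> N +>\<^bsub>M\<^esub> (a \<odot>\<^bsub>M\<^esub> x)"
      using n assms by (auto simp: a_r_coset_def')
    then show ?thesis using Q.a_repr_independence'[of "a \<odot>\<^bsub>M\<^esub> x'" "a \<odot>\<^bsub>M\<^esub> x"] assms by auto
  qed
  then have "(\<Union>x'\<in>N +>\<^bsub>M\<^esub> x. N +>\<^bsub>M\<^esub> (a \<odot>\<^bsub>M\<^esub> x')) = (\<Union>x'\<in>N +>\<^bsub>M\<^esub> x. N +>\<^bsub>M\<^esub> (a \<odot>\<^bsub>M\<^esub> x))"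
    by (intro SUP_cong refl)
  moreover have "N +>\<^bsub>M\<^esub> x \<noteq> {}" using Q.a_rcos_self[OF assms(2)] by blast
  ultimately show ?thesis by (simp add: quotient_module_def)
qed

end

section \<open>The group algebra of a finite abelian group\<close>
locale finite_group_algebra = K: field K + E: comm_group E
  for K :: "('k, 'a) ring_scheme" (structure) and E :: "('e, 'b) monoid_scheme" +
  assumes finite_E: "finite (carrier E)"
begin

abbreviation A where "A \<equiv> group_algebra K E"

lemma A_simps:
  "carrier A = carrier E \<rightarrow>\<^sub>E carrier K"
  "f \<otimes>\<^bsub>A\<^esub> g = (\<lambda>x\<in>carrier E. \<Oplus>y\<in>carrier E. f y \<otimes> g (inv\<^bsub>E\<^esub> y \<otimes>\<^bsub>E\<^esub> x))"
  "f \<oplus>\<^bsub>A\<^esub> g = (\<lambda>x\<in>carrier E. f x \<oplus> g x)"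
  "\<zero>\<^bsub>A\<^esub> = (\<lambda>x\<in>carrier E. \<zero>)"
  "\<one>\<^bsub>A\<^esub> = (\<lambda>x\<in>carrier E. if x = \<one>\<^bsub>E\<^esub> then \<one> else \<zero>)"
  by (simp_all add: group_algebra_def)

lemma A_val: "f \<in> carrier A \<Longrightarrow> x \<in> carrier E \<Longrightarrow> f x \<in> carrier K"
  by (auto simp: A_simps)

lemma A_mult_closed: "f \<in> carrier A \<Longrightarrow> g \<in> carrier A \<Longrightarrow> f \<otimes>\<^bsub>A\<^esub> g \<in> carrier A"
  by (simp add: A_simps(1,2) restrict_PiE_iff) (auto intro!: K.finsum_closed K.m_closed)

lemma scalar_mult:
  assumes "c \<in> carrier K" "f \<in> carrier A"
  shows "group_algebra_scalar K E c \<otimes>\<^bsub>A\<^esub> f = (\<lambda>x\<in>carrier E. c \<otimes> f x)"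
  unfolding A_simps(2)
proof (rule restrict_ext)
  fix x assume x: "x \<in> carrier E"
  have "(\<Oplus>y\<in>carrier E. group_algebra_scalar K E c y \<otimes> f (inv\<^bsub>E\<^esub> y \<otimes>\<^bsub>E\<^esub> x))
     = group_algebra_scalar K E c \<one>\<^bsub>E\<^esub> \<otimes> f (inv\<^bsub>E\<^esub> \<one>\<^bsub>E\<^esub> \<otimes>\<^bsub>E\<^esub> x)"
    using x assms by (intro K.finsum_single finite_E) (auto simp: group_algebra_scalar_def A_val)
  then show "(\<Oplus>y\<in>carrier E. group_algebra_scalar K E c y \<otimes> f (inv\<^bsub>E\<^esub> y \<otimes>\<^bsub>E\<^esub> x)) = c \<otimes> f x"
    using x by (simp add: group_algebra_scalar_def)
qed

lemma scalar_closed: "c \<in> carrier K \<Longrightarrow> group_algebra_scalar K E c \<in> carrier A"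
  by (auto simp: group_algebra_scalar_def A_simps)

lemma sum_translate:
  assumes "z \<in> carrier E" "\<And>y. y \<in> carrier E \<Longrightarrow> h y \<in> carrier K"
  shows "(\<Oplus>y\<in>carrier E. h y) = (\<Oplus>y\<in>carrier E. h (z \<otimes>\<^bsub>E\<^esub> y))"
proof (rule K.finsum_bij)
  show "bij_betw (\<lambda>y. z \<otimes>\<^bsub>E\<^esub> y) (carrier E) (carrier E)"
    by (rule bij_betw_byWitness[of _ "\<lambda>y. inv\<^bsub>E\<^esub> z \<otimes>\<^bsub>E\<^esub> y"])
       (use assms in \<open>auto simp flip: E.m_assoc\<close>)
qed (rule assms)

lemma A_mult_comm:
  assumes f: "f \<in> carrier A" and g: "g \<in> carrier A"
  shows "f \<otimes>\<^bsub>A\<^esub> g = g \<otimes>\<^bsub>A\<^esub> f"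
  unfolding A_simps(2)
proof (rule restrict_ext)
  fix x assume x: "x \<in> carrier E"
  have invol: "inv\<^bsub>E\<^esub> (inv\<^bsub>E\<^esub> y \<otimes>\<^bsub>E\<^esub> x) \<otimes>\<^bsub>E\<^esub> x = y" if "y \<in> carrier E" for y
    using x that by (simp add: E.inv_mult E.m_assoc)
  have "bij_betw (\<lambda>y. inv\<^bsub>E\<^esub> y \<otimes>\<^bsub>E\<^esub> x) (carrier E) (carrier E)"
    by (rule bij_betw_byWitness[of _ "\<lambda>y. inv\<^bsub>E\<^esub> y \<otimes>\<^bsub>E\<^esub> x"]) (use x invol in auto)
  then have "(\<Oplus>y\<in>carrier E. f y \<otimes> g (inv\<^bsub>E\<^esub> y \<otimes>\<^bsub>E\<^esub> x))
     = (\<Oplus>y\<in>carrier E. f (inv\<^bsub>E\<^esub> y \<otimes>\<^bsub>E\<^esub> x) \<otimes> g (inv\<^bsub>E\<^esub> (inv\<^bsub>E\<^esub> y \<otimes>\<^bsub>E\<^esub> x) \<otimes>\<^bsub>E\<^esub> x))"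
    by (rule K.finsum_bij) (use x f g in \<open>auto simp: A_val\<close>)
  also have "\<dots> = (\<Oplus>y\<in>carrier E. g y \<otimes> f (inv\<^bsub>E\<^esub> y \<otimes>\<^bsub>E\<^esub> x))"
  proof (intro K.finsum_cong' refl)
    fix y assume y: "y \<in> carrier E"
    show "f (inv\<^bsub>E\<^esub> y \<otimes>\<^bsub>E\<^esub> x) \<otimes> g (inv\<^bsub>E\<^esub> (inv\<^bsub>E\<^esub> y \<otimes>\<^bsub>E\<^esub> x) \<otimes>\<^bsub>E\<^esub> x) = g y \<otimes> f (inv\<^bsub>E\<^esub> y \<otimes>\<^bsub>E\<^esub> x)"
      using x y f g by (simp add: invol A_val K.m_comm)
  qed (use x f g in \<open>auto simp: A_val\<close>)
  finally show "(\<Oplus>y\<in>carrier E. f y \<otimes> g (inv\<^bsub>E\<^esub> y \<otimes>\<^bsub>E\<^esub> x))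
     = (\<Oplus>y\<in>carrier E. g y \<otimes> f (inv\<^bsub>E\<^esub> y \<otimes>\<^bsub>E\<^esub> x))" .
qed

lemma A_mult_assoc:
  assumes f: "f \<in> carrier A" and g: "g \<in> carrier A" and h: "h \<in> carrier A"
  shows "f \<otimes>\<^bsub>A\<^esub> g \<otimes>\<^bsub>A\<^esub> h = f \<otimes>\<^bsub>A\<^esub> (g \<otimes>\<^bsub>A\<^esub> h)"
  unfolding A_simps(2)[of "f \<otimes>\<^bsub>A\<^esub> g" h] A_simps(2)[of f "g \<otimes>\<^bsub>A\<^esub> h"]
proof (rule restrict_ext)
  fix x assume x: "x \<in> carrier E"
  have "(\<Oplus>y\<in>carrier E. (f \<otimes>\<^bsub>A\<^esub> g) y \<otimes> h (inv\<^bsub>E\<^esub> y \<otimes>\<^bsub>E\<^esub> x))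
     = (\<Oplus>y\<in>carrier E. \<Oplus>z\<in>carrier E. f z \<otimes> g (inv\<^bsub>E\<^esub> z \<otimes>\<^bsub>E\<^esub> y) \<otimes> h (inv\<^bsub>E\<^esub> y \<otimes>\<^bsub>E\<^esub> x))"
    using x f g h
    by (intro K.finsum_cong' refl) (auto simp: A_simps(2) A_val finite_E K.finsum_ldistr intro!: K.finsum_closed)
  also have "\<dots> = (\<Oplus>z\<in>carrier E. \<Oplus>y\<in>carrier E. f z \<otimes> g (inv\<^bsub>E\<^esub> z \<otimes>\<^bsub>E\<^esub> y) \<otimes> h (inv\<^bsub>E\<^esub> y \<otimes>\<^bsub>E\<^esub> x))"
    using x f g h by (intro K.finsum_commute finite_E) (auto simp: A_val)
  also have "\<dots> = (\<Oplus>z\<in>carrier E. f z \<otimes> (g \<otimes>\<^bsub>A\<^esub> h) (inv\<^bsub>E\<^esub> z \<otimes>\<^bsub>E\<^esub> x))"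
  proof (intro K.finsum_cong' refl)
    fix z assume z: "z \<in> carrier E"
    have "(\<Oplus>y\<in>carrier E. f z \<otimes> g (inv\<^bsub>E\<^esub> z \<otimes>\<^bsub>E\<^esub> y) \<otimes> h (inv\<^bsub>E\<^esub> y \<otimes>\<^bsub>E\<^esub> x))
      = (\<Oplus>y\<in>carrier E. f z \<otimes> g (inv\<^bsub>E\<^esub> z \<otimes>\<^bsub>E\<^esub> (z \<otimes>\<^bsub>E\<^esub> y)) \<otimes> h (inv\<^bsub>E\<^esub> (z \<otimes>\<^bsub>E\<^esub> y) \<otimes>\<^bsub>E\<^esub> x))"
      using x z f g h by (intro sum_translate) (auto simp: A_val)
    also have "\<dots> = (\<Oplus>y\<in>carrier E. f z \<otimes> (g y \<otimes> h (inv\<^bsub>E\<^esub> y \<otimes>\<^bsub>E\<^esub> (inv\<^bsub>E\<^esub> z \<otimes>\<^bsub>E\<^esub> x))))"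
    proof (intro K.finsum_cong' refl)
      fix y assume y: "y \<in> carrier E"
      have "inv\<^bsub>E\<^esub> z \<otimes>\<^bsub>E\<^esub> (z \<otimes>\<^bsub>E\<^esub> y) = y" using y z by (simp flip: E.m_assoc)
      moreover have "inv\<^bsub>E\<^esub> (z \<otimes>\<^bsub>E\<^esub> y) \<otimes>\<^bsub>E\<^esub> x = inv\<^bsub>E\<^esub> y \<otimes>\<^bsub>E\<^esub> (inv\<^bsub>E\<^esub> z \<otimes>\<^bsub>E\<^esub> x)"
        using x y z by (simp add: E.inv_mult_group E.m_assoc)
      ultimately show "f z \<otimes> g (inv\<^bsub>E\<^esub> z \<otimes>\<^bsub>E\<^esub> (z \<otimes>\<^bsub>E\<^esub> y)) \<otimes> h (inv\<^bsub>E\<^esub> (z \<otimes>\<^bsub>E\<^esub> y) \<otimes>\<^bsub>E\<^esub> x)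
          = f z \<otimes> (g y \<otimes> h (inv\<^bsub>E\<^esub> y \<otimes>\<^bsub>E\<^esub> (inv\<^bsub>E\<^esub> z \<otimes>\<^bsub>E\<^esub> x)))"
        using x y z f g h by (simp add: A_val K.m_assoc)
    qed (use x z f g h in \<open>auto simp: A_val\<close>)
    also have "\<dots> = f z \<otimes> (\<Oplus>y\<in>carrier E. g y \<otimes> h (inv\<^bsub>E\<^esub> y \<otimes>\<^bsub>E\<^esub> (inv\<^bsub>E\<^esub> z \<otimes>\<^bsub>E\<^esub> x)))"
      using x z f g h by (intro K.finsum_rdistr[symmetric] finite_E) (auto simp: A_val)
    finally show "(\<Oplus>y\<in>carrier E. f z \<otimes> g (inv\<^bsub>E\<^esub> z \<otimes>\<^bsub>E\<^esub> y) \<otimes> h (inv\<^bsub>E\<^esub> y \<otimes>\<^bsub>E\<^esub> x))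
      = f z \<otimes> (g \<otimes>\<^bsub>A\<^esub> h) (inv\<^bsub>E\<^esub> z \<otimes>\<^bsub>E\<^esub> x)"
      using x z by (simp add: A_simps(2))
  qed (use x f A_mult_closed[OF g h] in \<open>auto simp: A_val\<close>)
  finally show "(\<Oplus>y\<in>carrier E. (f \<otimes>\<^bsub>A\<^esub> g) y \<otimes> h (inv\<^bsub>E\<^esub> y \<otimes>\<^bsub>E\<^esub> x))
    = (\<Oplus>z\<in>carrier E. f z \<otimes> (g \<otimes>\<^bsub>A\<^esub> h) (inv\<^bsub>E\<^esub> z \<otimes>\<^bsub>E\<^esub> x))" .
qed

lemma A_one: "\<one>\<^bsub>A\<^esub> = group_algebra_scalar K E \<one>"
  by (simp add: A_simps group_algebra_scalar_def)

lemma group_algebra_cring: "cring A"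
proof (rule cringI)
  show "abelian_group A"
  proof (rule abelian_groupI)
    fix f assume f: "f \<in> carrier A"
    show "\<exists>g\<in>carrier A. g \<oplus>\<^bsub>A\<^esub> f = \<zero>\<^bsub>A\<^esub>"
    proof (rule bexI)
      show "(\<lambda>x\<in>carrier E. \<ominus> f x) \<in> carrier A" using f by (auto simp: A_simps)
      show "(\<lambda>x\<in>carrier E. \<ominus> f x) \<oplus>\<^bsub>A\<^esub> f = \<zero>\<^bsub>A\<^esub>"
        unfolding A_simps by (rule restrict_ext) (use A_val[OF f] in \<open>simp add: K.l_neg\<close>)
    qed
    show "\<zero>\<^bsub>A\<^esub> \<oplus>\<^bsub>A\<^esub> f = f"
    proof
      fix x show "(\<zero>\<^bsub>A\<^esub> \<oplus>\<^bsub>A\<^esub> f) x = f x"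
        using A_val[OF f, of x] f by (cases "x \<in> carrier E") (auto simp: A_simps)
    qed
  next
    fix f g h assume fgh: "f \<in> carrier A" "g \<in> carrier A" "h \<in> carrier A"
    show "f \<oplus>\<^bsub>A\<^esub> g \<oplus>\<^bsub>A\<^esub> h = f \<oplus>\<^bsub>A\<^esub> (g \<oplus>\<^bsub>A\<^esub> h)"
      unfolding A_simps by (rule restrict_ext) (use fgh in \<open>simp add: A_val K.a_assoc\<close>)
  next
    fix f g assume fg: "f \<in> carrier A" "g \<in> carrier A"
    show "f \<oplus>\<^bsub>A\<^esub> g = g \<oplus>\<^bsub>A\<^esub> f"
      unfolding A_simps by (rule restrict_ext) (use fg in \<open>simp add: A_val K.a_comm\<close>)
  next
    fix f g assume "f \<in> carrier A" "g \<in> carrier A"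
    then show "f \<oplus>\<^bsub>A\<^esub> g \<in> carrier A" by (auto simp: A_simps)
  next
    show "\<zero>\<^bsub>A\<^esub> \<in> carrier A" by (auto simp: A_simps)
  qed
  show "Group.comm_monoid A"
  proof (rule comm_monoidI)
    show "\<one>\<^bsub>A\<^esub> \<in> carrier A" by (simp add: A_one scalar_closed)
    fix f assume f: "f \<in> carrier A"
    show "\<one>\<^bsub>A\<^esub> \<otimes>\<^bsub>A\<^esub> f = f"
    proof
      fix x show "(\<one>\<^bsub>A\<^esub> \<otimes>\<^bsub>A\<^esub> f) x = f x"
        using A_val[OF f, of x] f by (cases "x \<in> carrier E") (auto simp: A_one scalar_mult A_simps(1))
    qed
  qed (fact A_mult_closed A_mult_assoc A_mult_comm)+
  fix f g h assume fgh: "f \<in> carrier A" "g \<in> carrier A" "h \<in> carrier A"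
  show "(f \<oplus>\<^bsub>A\<^esub> g) \<otimes>\<^bsub>A\<^esub> h = f \<otimes>\<^bsub>A\<^esub> h \<oplus>\<^bsub>A\<^esub> g \<otimes>\<^bsub>A\<^esub> h"
    unfolding A_simps(2,3)
  proof (rule restrict_ext)
    fix x assume x: "x \<in> carrier E"
    have "(\<Oplus>y\<in>carrier E. (\<lambda>x\<in>carrier E. f x \<oplus> g x) y \<otimes> h (inv\<^bsub>E\<^esub> y \<otimes>\<^bsub>E\<^esub> x))
      = (\<Oplus>y\<in>carrier E. f y \<otimes> h (inv\<^bsub>E\<^esub> y \<otimes>\<^bsub>E\<^esub> x) \<oplus> g y \<otimes> h (inv\<^bsub>E\<^esub> y \<otimes>\<^bsub>E\<^esub> x))"
      using x fgh by (intro K.finsum_cong' refl) (auto simp: A_val K.l_distr)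
    also have "\<dots> = (\<Oplus>y\<in>carrier E. f y \<otimes> h (inv\<^bsub>E\<^esub> y \<otimes>\<^bsub>E\<^esub> x)) \<oplus>
        (\<Oplus>y\<in>carrier E. g y \<otimes> h (inv\<^bsub>E\<^esub> y \<otimes>\<^bsub>E\<^esub> x))"
      using x fgh by (intro K.finsum_addf) (auto simp: A_val)
    finally show "(\<Oplus>y\<in>carrier E. (\<lambda>x\<in>carrier E. f x \<oplus> g x) y \<otimes> h (inv\<^bsub>E\<^esub> y \<otimes>\<^bsub>E\<^esub> x))
      = (\<lambda>x\<in>carrier E. \<Oplus>y\<in>carrier E. f y \<otimes> h (inv\<^bsub>E\<^esub> y \<otimes>\<^bsub>E\<^esub> x)) x \<oplus>
        (\<lambda>x\<in>carrier E. \<Oplus>y\<in>carrier E. g y \<otimes> h (inv\<^bsub>E\<^esub> y \<otimes>\<^bsub>E\<^esub> x)) x"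
      using x by simp
  qed
qed

sublocale A: cring "group_algebra K E" by (rule group_algebra_cring)

lemma A_one_neq_zero: "\<one>\<^bsub>A\<^esub> \<noteq> \<zero>\<^bsub>A\<^esub>"
proof
  assume "\<one>\<^bsub>A\<^esub> = \<zero>\<^bsub>A\<^esub>"
  from fun_cong[OF this, of "\<one>\<^bsub>E\<^esub>"] show False by (simp add: A_simps)
qed

end

section \<open>Free complexes given by translation invariant integer matrices\<close>
lemma (in abelian_monoid) finsum_Sigma_const:
  assumes "finite X" "finite Y" "\<And>x y. x \<in> X \<Longrightarrow> y \<in> Y \<Longrightarrow> f x y \<in> carrier G"
  shows "(\<Oplus>z\<in>X \<times> Y. f (fst z) (snd z)) = (\<Oplus>x\<in>X. \<Oplus>y\<in>Y. f x y)"
  using assms(1,3)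
proof (induction X rule: finite_induct)
  case (insert x X)
  have "insert x X \<times> Y = (\<lambda>y. (x, y)) ` Y \<union> X \<times> Y" by auto
  moreover have "(\<Oplus>z\<in>(\<lambda>y. (x, y)) ` Y \<union> X \<times> Y. f (fst z) (snd z))
    = (\<Oplus>z\<in>(\<lambda>y. (x, y)) ` Y. f (fst z) (snd z)) \<oplus> (\<Oplus>z\<in>X \<times> Y. f (fst z) (snd z))"
    using insert assms(2) by (intro finsum_Un_disjoint) auto
  moreover have "(\<Oplus>z\<in>(\<lambda>y. (x, y)) ` Y. f (fst z) (snd z)) = (\<Oplus>y\<in>Y. f x y)"
    using insert by (subst finsum_reindex) (auto simp: inj_on_def)
  ultimately show ?case using insert by (auto intro!: finsum_closed)
qed simp

text \<open>The generators of the complex are the elements of \<open>B\<close>, in the degrees given by \<open>deg\<close>, and \<open>\<kappa>\<close> is a choice of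
coordinates for the group elements. The matrix \<open>D\<close> is indexed by the resulting basis over the field. The map \<open>code\<close>
renames the generators to natural numbers, over which the chain modules consist of functions.
Translation invariance of \<open>D\<close> is linearity over the group algebra.\<close>
locale equivariant_complex = finite_group_algebra K E
  for K :: "('k, 'a) ring_scheme" (structure) and E :: "('e, 'b) monoid_scheme" +
  fixes B :: "'i set" and deg :: "'i \<Rightarrow> int" and code :: "'i \<Rightarrow> nat"
    and P :: "'x set" and \<kappa> :: "'e \<Rightarrow> 'x" and D :: "('i \<times> 'x \<Rightarrow> int) \<Rightarrow> 'i \<times> 'x \<Rightarrow> int"
  assumes finite_B: "finite B" and inj_code: "inj_on code B"
    and \<kappa>: "bij_betw \<kappa> (carrier E) P"
    and D_int_linear: "int_linear (B \<times> P) (B \<times> P) D"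
    and D_square: "w \<in> B \<times> P \<Longrightarrow> D (D u) w = 0"
    and D_degree: "b \<in> B \<Longrightarrow> b' \<in> B \<Longrightarrow> \<alpha> \<in> P \<Longrightarrow> \<alpha>' \<in> P \<Longrightarrow> deg b' \<noteq> deg b - 1 \<Longrightarrow>
          D (delta (b, \<alpha>)) (b', \<alpha>') = 0"
    and D_equivariant: "b \<in> B \<Longrightarrow> b' \<in> B \<Longrightarrow> x \<in> carrier E \<Longrightarrow> y \<in> carrier E \<Longrightarrow> z \<in> carrier E \<Longrightarrow>
          D (delta (b, \<kappa> (z \<otimes>\<^bsub>E\<^esub> y))) (b', \<kappa> (z \<otimes>\<^bsub>E\<^esub> x)) = D (delta (b, \<kappa> y)) (b', \<kappa> x)"
begin

abbreviation X where "X \<equiv> B \<times> P"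

definition gens :: "int \<Rightarrow> nat set" where
  "gens i = code ` {b \<in> B. deg b = i}"

definition Fm :: "int \<Rightarrow> ('e \<Rightarrow> 'k, nat \<Rightarrow> 'e \<Rightarrow> 'k) module" where
  "Fm i = A.func_space (gens i)"

text \<open>The direct sum of the chain modules as a vector space over \<open>K\<close>, with \<open>DV\<close> as its differential;
\<open>flat\<close> and \<open>part\<close> are the inclusion of, and the projection to, the component of degree \<open>i\<close>.\<close>
definition V :: "('k, 'i \<times> 'x \<Rightarrow> 'k) module" where
  "V = K.func_space X"

definition flat :: "int \<Rightarrow> (nat \<Rightarrow> 'e \<Rightarrow> 'k) \<Rightarrow> 'i \<times> 'x \<Rightarrow> 'k" where
  "flat i u = (\<lambda>y\<in>X. if deg (fst y) = i then u (code (fst y)) (the_inv_into (carrier E) \<kappa> (snd y)) else \<zero>)"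

definition part :: "int \<Rightarrow> ('i \<times> 'x \<Rightarrow> 'k) \<Rightarrow> nat \<Rightarrow> 'e \<Rightarrow> 'k" where
  "part i z = (\<lambda>n\<in>gens i. \<lambda>x\<in>carrier E. z (the_inv_into B code n, \<kappa> x))"

definition DV :: "('i \<times> 'x \<Rightarrow> 'k) \<Rightarrow> 'i \<times> 'x \<Rightarrow> 'k" where
  "DV = K.act X X D"

definition dd :: "int \<Rightarrow> (nat \<Rightarrow> 'e \<Rightarrow> 'k) \<Rightarrow> nat \<Rightarrow> 'e \<Rightarrow> 'k" where
  "dd i u = part (i - 1) (DV (flat i u))"

lemma finite_P: "finite P"
  using \<kappa> finite_E bij_betw_finite by blast

lemma finite_X: "finite X"
  using finite_B finite_P by simp

lemma code_inv: "b \<in> B \<Longrightarrow> the_inv_into B code (code b) = b"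
  using inj_code by (rule the_inv_into_f_f)

lemma \<kappa>_inv: "x \<in> carrier E \<Longrightarrow> the_inv_into (carrier E) \<kappa> (\<kappa> x) = x"
  using \<kappa> by (simp add: bij_betw_def the_inv_into_f_f)

lemma \<kappa>_in: "x \<in> carrier E \<Longrightarrow> \<kappa> x \<in> P"
  using \<kappa> by (auto simp: bij_betw_def)

lemma \<kappa>_rep: "\<alpha> \<in> P \<Longrightarrow> \<exists>x\<in>carrier E. \<alpha> = \<kappa> x"
  using \<kappa> by (auto simp: bij_betw_def)

lemma V_carrier: "carrier V = X \<rightarrow>\<^sub>E carrier K"
  by (simp add: V_def K.func_space_simps)

lemma Fm_carrier: "carrier (Fm i) = gens i \<rightarrow>\<^sub>E carrier A"
  by (simp add: Fm_def A.func_space_simps)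

lemma V_val: "z \<in> carrier V \<Longrightarrow> b \<in> B \<Longrightarrow> \<alpha> \<in> P \<Longrightarrow> z (b, \<alpha>) \<in> carrier K"
  by (auto simp: V_carrier)

lemma gensI: "b \<in> B \<Longrightarrow> deg b = i \<Longrightarrow> code b \<in> gens i"
  by (auto simp: gens_def)

lemma Fm_val: "u \<in> carrier (Fm i) \<Longrightarrow> b \<in> B \<Longrightarrow> deg b = i \<Longrightarrow> x \<in> carrier E \<Longrightarrow> u (code b) x \<in> carrier K"
  using gensI by (auto simp: Fm_carrier intro!: A_val)

lemma Fm_eqI:
  assumes "u \<in> carrier (Fm i)" "v \<in> carrier (Fm i)"
    and "\<And>b x. b \<in> B \<Longrightarrow> deg b = i \<Longrightarrow> x \<in> carrier E \<Longrightarrow> u (code b) x = v (code b) x"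
  shows "u = v"
proof (rule PiE_ext)
  show "u \<in> gens i \<rightarrow>\<^sub>E carrier A" "v \<in> gens i \<rightarrow>\<^sub>E carrier A" using assms by (simp_all only: Fm_carrier)
  fix n assume n: "n \<in> gens i"
  then obtain b where b: "b \<in> B" "deg b = i" "n = code b" by (auto simp: gens_def)
  show "u n = v n"
  proof (rule PiE_ext)
    show "u n \<in> carrier E \<rightarrow>\<^sub>E carrier K" "v n \<in> carrier E \<rightarrow>\<^sub>E carrier K"
      using assms(1,2) n by (auto simp only: Fm_carrier A_simps(1) dest: PiE_mem)
    show "u n x = v n x" if "x \<in> carrier E" for x using assms(3)[OF b(1,2) that] b by simp
  qed
qed

lemma V_eqI:
  assumes "z \<in> carrier V" "w \<in> carrier V" "\<And>b x. b \<in> B \<Longrightarrow> x \<in> carrier E \<Longrightarrow> z (b, \<kappa> x) = w (b, \<kappa> x)"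
  shows "z = w"
proof (rule PiE_ext)
  show "z \<in> X \<rightarrow>\<^sub>E carrier K" "w \<in> X \<rightarrow>\<^sub>E carrier K" using assms by (simp_all only: V_carrier)
  fix y assume "y \<in> X"
  then obtain b x where "b \<in> B" "x \<in> carrier E" "y = (b, \<kappa> x)" using \<kappa>_rep by fastforce
  then show "z y = w y" using assms(3) by simp
qed

lemma part_apply: "b \<in> B \<Longrightarrow> deg b = i \<Longrightarrow> x \<in> carrier E \<Longrightarrow> part i z (code b) x = z (b, \<kappa> x)"
  by (simp add: part_def gensI code_inv)

lemma flat_apply: "b \<in> B \<Longrightarrow> x \<in> carrier E \<Longrightarrow> flat i u (b, \<kappa> x) = (if deg b = i then u (code b) x else \<zero>)"
  by (simp add: flat_def \<kappa>_in \<kappa>_inv)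

lemma part_closed: "z \<in> carrier V \<Longrightarrow> part i z \<in> carrier (Fm i)"
  unfolding Fm_carrier part_def
  by (rule restrict_PiE_iff[THEN iffD2]) (auto simp: A_simps(1) gens_def code_inv V_val \<kappa>_in)

lemma flat_closed: "u \<in> carrier (Fm i) \<Longrightarrow> flat i u \<in> carrier V"
  unfolding V_carrier flat_def
proof (rule restrict_PiE_iff[THEN iffD2], rule ballI)
  fix y assume u: "u \<in> carrier (Fm i)" and "y \<in> X"
  then obtain b x where "b \<in> B" "x \<in> carrier E" "y = (b, \<kappa> x)" using \<kappa>_rep by fastforce
  then show "(if deg (fst y) = i then u (code (fst y)) (the_inv_into (carrier E) \<kappa> (snd y)) else \<zero>) \<in> carrier K"
    using u by (simp add: \<kappa>_inv Fm_val)
qed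

lemma DV_closed: "z \<in> carrier V \<Longrightarrow> DV z \<in> carrier V"
  unfolding V_carrier DV_def by (rule K.act_closed)

lemma part_flat: "u \<in> carrier (Fm i) \<Longrightarrow> part i (flat i u) = u"
  by (rule Fm_eqI[of _ i]) (simp_all add: part_closed flat_closed part_apply flat_apply)

lemma DV_apply:
  assumes "b' \<in> B" "x \<in> carrier E"
  shows "DV z (b', \<kappa> x) = (\<Oplus>y\<in>X. [D (delta y) (b', \<kappa> x)] \<cdot> z y)"
  using assms by (simp add: DV_def K.act_def \<kappa>_in)

lemma DV_apply_group:
  assumes "b' \<in> B" "x \<in> carrier E" "z \<in> carrier V"
  shows "DV z (b', \<kappa> x) = (\<Oplus>w\<in>B \<times> carrier E. [D (delta (fst w, \<kappa> (snd w))) (b', \<kappa> x)] \<cdot> z (fst w, \<kappa> (snd w)))"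
proof -
  have bij: "bij_betw (map_prod id \<kappa>) (B \<times> carrier E) X"
    by (rule bij_betw_map_prod) (use \<kappa> in auto)
  have "DV z (b', \<kappa> x) = (\<Oplus>w\<in>B \<times> carrier E. [D (delta (map_prod id \<kappa> w)) (b', \<kappa> x)] \<cdot> z (map_prod id \<kappa> w))"
    unfolding DV_apply[OF assms(1,2)] by (rule K.finsum_bij[OF bij]) (use assms in \<open>auto simp: V_val\<close>)
  then show ?thesis by (simp add: case_prod_beta map_prod_def)
qed

lemma DV_degree_cong:
  assumes b': "b' \<in> B" "x \<in> carrier E" and zw: "z \<in> carrier V" "w \<in> carrier V"
    and eq: "\<And>b y. b \<in> B \<Longrightarrow> y \<in> carrier E \<Longrightarrow> deg b = deg b' + 1 \<Longrightarrow> z (b, \<kappa> y) = w (b, \<kappa> y)"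
  shows "DV z (b', \<kappa> x) = DV w (b', \<kappa> x)"
  unfolding DV_apply[OF b']
proof (intro K.finsum_cong' refl)
  fix y assume "y \<in> X"
  then obtain b e where y: "b \<in> B" "e \<in> carrier E" "y = (b, \<kappa> e)" using \<kappa>_rep by fastforce
  show "[D (delta y) (b', \<kappa> x)] \<cdot> z y = [D (delta y) (b', \<kappa> x)] \<cdot> w y"
  proof (cases "deg b = deg b' + 1")
    case True
    then show ?thesis using eq[OF y(1,2)] y(3) by simp
  next
    case False
    then have "D (delta y) (b', \<kappa> x) = 0"
      unfolding y(3) using y b' \<kappa>_in by (intro D_degree) auto
    then show ?thesis by simp
  qed
qed (use zw in \<open>auto simp: V_val\<close>)

lemma V_module: "Module.module K V"
  unfolding V_def by (rule K.func_space_is_module)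

lemma Fm_module: "Module.module A (Fm i)"
  unfolding Fm_def by (rule A.func_space_is_module)

lemma V_simps:
  "y \<in> X \<Longrightarrow> (u \<oplus>\<^bsub>V\<^esub> v) y = u y \<oplus> v y"
  "y \<in> X \<Longrightarrow> (c \<odot>\<^bsub>V\<^esub> u) y = c \<otimes> u y"
  "y \<in> X \<Longrightarrow> \<zero>\<^bsub>V\<^esub> y = \<zero>"
  by (simp_all add: V_def K.func_space_simps)

lemma Fm_simps:
  assumes "b \<in> B" "deg b = i" "x \<in> carrier E"
  shows "(u \<oplus>\<^bsub>Fm i\<^esub> v) (code b) x = u (code b) x \<oplus> v (code b) x"
    and "(a \<odot>\<^bsub>Fm i\<^esub> u) (code b) x = (\<Oplus>y\<in>carrier E. a y \<otimes> u (code b) (inv\<^bsub>E\<^esub> y \<otimes>\<^bsub>E\<^esub> x))"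
    and "\<zero>\<^bsub>Fm i\<^esub> (code b) x = \<zero>"
  using assms gensI[OF assms(1,2)] by (simp_all add: Fm_def A.func_space_simps A_simps)

interpretation V: Module.module K V by (rule V_module)

lemma DV_mod_hom: "mod_hom K V V DV"
  unfolding V_def DV_def by (rule K.act_mod_hom[OF finite_X])

lemma DV_add: "u \<in> carrier V \<Longrightarrow> v \<in> carrier V \<Longrightarrow> DV (u \<oplus>\<^bsub>V\<^esub> v) = DV u \<oplus>\<^bsub>V\<^esub> DV v"
  and DV_zero: "DV \<zero>\<^bsub>V\<^esub> = \<zero>\<^bsub>V\<^esub>"
proof -
  interpret DV: mod_hom K V V DV by (rule DV_mod_hom)
  show "u \<in> carrier V \<Longrightarrow> v \<in> carrier V \<Longrightarrow> DV (u \<oplus>\<^bsub>V\<^esub> v) = DV u \<oplus>\<^bsub>V\<^esub> DV v"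
    by (rule DV.f_add)
  show "DV \<zero>\<^bsub>V\<^esub> = \<zero>\<^bsub>V\<^esub>" by (rule DV.f0_is_0)
qed

lemma DV_DV: "z \<in> carrier V \<Longrightarrow> DV (DV z) = \<zero>\<^bsub>V\<^esub>"
proof -
  assume z: "z \<in> carrier V"
  then have z': "z \<in> X \<rightarrow>\<^sub>E carrier K" by (simp only: V_carrier)
  have "DV (DV z) = K.act X X (\<lambda>u. D (D u)) z"
    unfolding DV_def by (rule K.act_comp[OF finite_X finite_X D_int_linear z'])
  also have "\<dots> = K.act X X (\<lambda>u y. 0) z"
    by (rule K.act_cong[OF _ z']) (rule D_square)
  also have "\<dots> = \<zero>\<^bsub>V\<^esub>"
    by (simp add: K.act_def V_def K.func_space_simps)
  finally show ?thesis .
qed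

lemma part_add:
  assumes "u \<in> carrier V" "v \<in> carrier V"
  shows "part i (u \<oplus>\<^bsub>V\<^esub> v) = part i u \<oplus>\<^bsub>Fm i\<^esub> part i v"
proof -
  interpret F: Module.module A "Fm i" by (rule Fm_module)
  show ?thesis
    by (rule Fm_eqI[of _ i]) (simp_all add: assms part_closed part_apply Fm_simps V_simps \<kappa>_in)
qed

lemma part_smult:
  assumes "c \<in> carrier K" "u \<in> carrier V"
  shows "part i (c \<odot>\<^bsub>V\<^esub> u) = group_algebra_scalar K E c \<odot>\<^bsub>Fm i\<^esub> part i u"
proof -
  interpret F: Module.module A "Fm i" by (rule Fm_module)
  show ?thesis
  proof (rule Fm_eqI[of _ i])
    fix b x assume b: "b \<in> B" "deg b = i" "x \<in> carrier E"
    have "part i u (code b) \<in> carrier A"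
      using part_closed[OF assms(2), of i] gensI[OF b(1,2)] by (auto simp: Fm_carrier)
    from fun_cong[OF scalar_mult[OF assms(1) this], of x] b
    have "(\<Oplus>y\<in>carrier E. group_algebra_scalar K E c y \<otimes> part i u (code b) (inv\<^bsub>E\<^esub> y \<otimes>\<^bsub>E\<^esub> x))
       = c \<otimes> part i u (code b) x"
      by (simp add: A_simps(2))
    then show "part i (c \<odot>\<^bsub>V\<^esub> u) (code b) x = (group_algebra_scalar K E c \<odot>\<^bsub>Fm i\<^esub> part i u) (code b) x"
      using b by (simp add: Fm_simps part_apply V_simps \<kappa>_in)
  qed (simp_all add: assms part_closed scalar_closed)
qed

lemma part_zero: "part i \<zero>\<^bsub>V\<^esub> = \<zero>\<^bsub>Fm i\<^esub>"
proof -
  interpret F: Module.module A "Fm i" by (rule Fm_module)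
  show ?thesis by (rule Fm_eqI[of _ i]) (simp_all add: part_closed part_apply Fm_simps V_simps \<kappa>_in)
qed

lemma part_DV:
  assumes "z \<in> carrier V"
  shows "part (i - 1) (DV z) = dd i (part i z)"
  unfolding dd_def
proof (rule Fm_eqI[of _ "i - 1"])
  fix b' x assume b': "b' \<in> B" "deg b' = i - 1" "x \<in> carrier E"
  have "DV z (b', \<kappa> x) = DV (flat i (part i z)) (b', \<kappa> x)"
    by (rule DV_degree_cong) (use b' assms in \<open>simp_all add: flat_closed part_closed flat_apply part_apply\<close>)
  then show "part (i - 1) (DV z) (code b') x = part (i - 1) (DV (flat i (part i z))) (code b') x"
    using b' by (simp add: part_apply)
qed (simp_all add: assms part_closed flat_closed DV_closed)

lemma V_eq_parts:
  assumes "z \<in> carrier V" "w \<in> carrier V" "\<And>i. part i z = part i w"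
  shows "z = w"
proof (rule V_eqI[OF assms(1,2)])
  fix b x assume b: "b \<in> B" "x \<in> carrier E"
  show "z (b, \<kappa> x) = w (b, \<kappa> x)"
    using part_apply[OF b(1) refl b(2), of z] part_apply[OF b(1) refl b(2), of w] assms(3)[of "deg b"] by simp
qed

text \<open>Families of chains in all degrees are the same as elements of \<open>V\<close>, because only finitely many degrees
occur.\<close>
lemma assemble:
  assumes "\<And>i. u i \<in> carrier (Fm i)"
  obtains z where "z \<in> carrier V" "\<And>i. part i z = u i"
proof -
  define z where "z = (\<lambda>y\<in>X. u (deg (fst y)) (code (fst y)) (the_inv_into (carrier E) \<kappa> (snd y)))"
  have z: "z (b, \<kappa> x) = u (deg b) (code b) x" if "b \<in> B" "x \<in> carrier E" for b x
    using that by (simp add: z_def \<kappa>_in \<kappa>_inv)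
  have zc: "z \<in> carrier V"
    unfolding V_carrier z_def
  proof (rule restrict_PiE_iff[THEN iffD2], rule ballI)
    fix y assume "y \<in> X"
    then obtain b x where "b \<in> B" "x \<in> carrier E" "y = (b, \<kappa> x)" using \<kappa>_rep by fastforce
    then show "u (deg (fst y)) (code (fst y)) (the_inv_into (carrier E) \<kappa> (snd y)) \<in> carrier K"
      using Fm_val[OF assms] by (simp add: \<kappa>_inv)
  qed
  have "part i z = u i" for i
    by (rule Fm_eqI[of _ i]) (simp_all add: part_closed zc assms part_apply z)
  with zc that show ?thesis by blast
qed

lemma dd_closed: "u \<in> carrier (Fm i) \<Longrightarrow> dd i u \<in> carrier (Fm (i - 1))"
  by (simp add: dd_def part_closed DV_closed flat_closed)

lemma dd_dd:
  assumes "u \<in> carrier (Fm i)"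
  shows "dd (i - 1) (dd i u) = \<zero>\<^bsub>Fm (i - 1 - 1)\<^esub>"
proof -
  have "dd (i - 1) (dd i u) = dd (i - 1) (part (i - 1) (DV (flat i u)))" by (simp add: dd_def)
  also have "\<dots> = part (i - 1 - 1) (DV (DV (flat i u)))"
    by (rule part_DV[symmetric]) (simp add: DV_closed flat_closed assms)
  finally show ?thesis by (simp add: DV_DV flat_closed assms part_zero)
qed

lemma dd_add:
  assumes "u \<in> carrier (Fm i)" "v \<in> carrier (Fm i)"
  shows "dd i (u \<oplus>\<^bsub>Fm i\<^esub> v) = dd i u \<oplus>\<^bsub>Fm (i - 1)\<^esub> dd i v"
proof -
  have "dd i (u \<oplus>\<^bsub>Fm i\<^esub> v) = dd i (part i (flat i u \<oplus>\<^bsub>V\<^esub> flat i v))"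
    by (simp add: part_add assms flat_closed part_flat)
  also have "\<dots> = part (i - 1) (DV (flat i u \<oplus>\<^bsub>V\<^esub> flat i v))"
    by (rule part_DV[symmetric]) (simp add: flat_closed assms)
  also have "\<dots> = dd i u \<oplus>\<^bsub>Fm (i - 1)\<^esub> dd i v"
    by (simp add: DV_add part_add assms flat_closed DV_closed dd_def)
  finally show ?thesis .
qed

lemma dd_apply:
  assumes "b' \<in> B" "deg b' = i - 1" "x \<in> carrier E" "u \<in> carrier (Fm i)"
  shows "dd i u (code b') x = (\<Oplus>b\<in>{b \<in> B. deg b = i}. \<Oplus>y\<in>carrier E.
           [D (delta (b, \<kappa> y)) (b', \<kappa> x)] \<cdot> u (code b) y)"
proof -
  let ?t = "\<lambda>b y. [D (delta (b, \<kappa> y)) (b', \<kappa> x)] \<cdot> flat i u (b, \<kappa> y)"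
  have cl: "?t b y \<in> carrier K" if "b \<in> B" "y \<in> carrier E" for b y
    using that V_val[OF flat_closed[OF assms(4)]] \<kappa>_in by simp
  have "dd i u (code b') x = (\<Oplus>w\<in>B \<times> carrier E. ?t (fst w) (snd w))"
    using assms by (simp add: dd_def part_apply DV_apply_group flat_closed)
  also have "\<dots> = (\<Oplus>b\<in>B. \<Oplus>y\<in>carrier E. ?t b y)"
    by (rule K.finsum_Sigma_const) (use finite_B finite_E cl in auto)
  also have "\<dots> = (\<Oplus>b\<in>{b \<in> B. deg b = i}. \<Oplus>y\<in>carrier E. ?t b y)"
  proof (rule K.add.finprod_mono_neutral_cong_right)
    show "(\<Oplus>y\<in>carrier E. ?t b y) = \<zero>" if "b \<in> B - {b \<in> B. deg b = i}" for b
      using that by (intro K.finsum_all0) (auto simp: flat_apply)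
  qed (use finite_B cl in \<open>auto intro!: K.finsum_closed\<close>)
  also have "\<dots> = (\<Oplus>b\<in>{b \<in> B. deg b = i}. \<Oplus>y\<in>carrier E.
           [D (delta (b, \<kappa> y)) (b', \<kappa> x)] \<cdot> u (code b) y)"
    using assms(4) by (intro K.finsum_cong' refl Pi_I K.finsum_closed) (simp_all add: flat_apply Fm_val)
  finally show ?thesis .
qed

text \<open>The action of the group algebra is convolution. After interchanging the two sums over the group, the
substitution \<open>y \<mapsto> z y\<close> in the inner one moves the translation from the vector to the matrix, where
it is absorbed by equivariance.\<close>
lemma dd_smult:
  assumes a: "a \<in> carrier A" and u: "u \<in> carrier (Fm i)"
  shows "dd i (a \<odot>\<^bsub>Fm i\<^esub> u) = a \<odot>\<^bsub>Fm (i - 1)\<^esub> dd i u"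
proof -
  interpret F: Module.module A "Fm i" by (rule Fm_module)
  interpret F': Module.module A "Fm (i - 1)" by (rule Fm_module)
  show ?thesis
  proof (rule Fm_eqI[of _ "i - 1"])
    fix b' x assume b': "b' \<in> B" "deg b' = i - 1" "x \<in> carrier E"
    let ?B = "{b \<in> B. deg b = i}"
    let ?m = "\<lambda>b y x. D (delta (b, \<kappa> y)) (b', \<kappa> x)"
    let ?s = "\<lambda>b z. \<Oplus>y\<in>carrier E. [?m b y (inv\<^bsub>E\<^esub> z \<otimes>\<^bsub>E\<^esub> x)] \<cdot> u (code b) y"
    let ?t = "\<lambda>b y z. a z \<otimes> ([?m b y x] \<cdot> u (code b) (inv\<^bsub>E\<^esub> z \<otimes>\<^bsub>E\<^esub> y))"
    have au: "a y \<in> carrier K" "u (code b) y \<in> carrier K" if "b \<in> ?B" "y \<in> carrier E" for b y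
      using that Fm_val[OF u] A_val[OF a] by auto
    have ay: "a y \<in> carrier K" if "y \<in> carrier E" for y using A_val[OF a that] .
    have fB: "finite ?B" using finite_B by simp
    have "dd i (a \<odot>\<^bsub>Fm i\<^esub> u) (code b') x = (\<Oplus>b\<in>?B. \<Oplus>y\<in>carrier E.
        [?m b y x] \<cdot> (\<Oplus>z\<in>carrier E. a z \<otimes> u (code b) (inv\<^bsub>E\<^esub> z \<otimes>\<^bsub>E\<^esub> y)))"
      unfolding dd_apply[OF b' F.smult_closed[OF a u]]
      using ay au by (intro K.finsum_cong' refl Pi_I K.finsum_closed) (auto simp: Fm_simps intro!: K.finsum_closed)
    also have "\<dots> = (\<Oplus>b\<in>?B. \<Oplus>z\<in>carrier E. a z \<otimes> ?s b z)"
    proof (rule K.finsum_cong'[OF refl])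
      fix b assume b: "b \<in> ?B"
      have "(\<Oplus>y\<in>carrier E. [?m b y x] \<cdot> (\<Oplus>z\<in>carrier E. a z \<otimes> u (code b) (inv\<^bsub>E\<^esub> z \<otimes>\<^bsub>E\<^esub> y)))
        = (\<Oplus>y\<in>carrier E. \<Oplus>z\<in>carrier E. ?t b y z)"
        using au[OF b] ay
        by (intro K.finsum_cong' refl Pi_I K.finsum_closed)
           (auto simp: K.int_mult_sum_right finite_E K.add_pow_rdistr_int intro!: K.finsum_closed K.finsum_cong')
      also have "\<dots> = (\<Oplus>z\<in>carrier E. \<Oplus>y\<in>carrier E. ?t b y z)"
        using au[OF b] by (intro K.finsum_commute finite_E) auto
      also have "\<dots> = (\<Oplus>z\<in>carrier E. a z \<otimes> ?s b z)"
      proof (intro K.finsum_cong' refl)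
        fix z assume z: "z \<in> carrier E"
        have "(\<Oplus>y\<in>carrier E. ?t b y z)
          = (\<Oplus>y\<in>carrier E. a z \<otimes> ([?m b (z \<otimes>\<^bsub>E\<^esub> y) x] \<cdot> u (code b) (inv\<^bsub>E\<^esub> z \<otimes>\<^bsub>E\<^esub> (z \<otimes>\<^bsub>E\<^esub> y))))"
          by (rule sum_translate[OF z]) (use au[OF b] z in auto)
        also have "\<dots> = (\<Oplus>y\<in>carrier E. a z \<otimes> ([?m b y (inv\<^bsub>E\<^esub> z \<otimes>\<^bsub>E\<^esub> x)] \<cdot> u (code b) y))"
        proof (intro K.finsum_cong' refl)
          fix y assume y: "y \<in> carrier E"
          have "inv\<^bsub>E\<^esub> z \<otimes>\<^bsub>E\<^esub> (z \<otimes>\<^bsub>E\<^esub> y) = y" using y z by (simp flip: E.m_assoc)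
          moreover have "z \<otimes>\<^bsub>E\<^esub> (inv\<^bsub>E\<^esub> z \<otimes>\<^bsub>E\<^esub> x) = x" using b'(3) z by (simp flip: E.m_assoc)
          then have "?m b (z \<otimes>\<^bsub>E\<^esub> y) x = ?m b y (inv\<^bsub>E\<^esub> z \<otimes>\<^bsub>E\<^esub> x)"
            using D_equivariant[of b b' "inv\<^bsub>E\<^esub> z \<otimes>\<^bsub>E\<^esub> x" y z] b b' y z by simp
          ultimately show "a z \<otimes> ([?m b (z \<otimes>\<^bsub>E\<^esub> y) x] \<cdot> u (code b) (inv\<^bsub>E\<^esub> z \<otimes>\<^bsub>E\<^esub> (z \<otimes>\<^bsub>E\<^esub> y)))
            = a z \<otimes> ([?m b y (inv\<^bsub>E\<^esub> z \<otimes>\<^bsub>E\<^esub> x)] \<cdot> u (code b) y)" by simp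
        qed (use au[OF b] z in auto)
        also have "\<dots> = a z \<otimes> ?s b z"
          using au[OF b] z by (intro K.finsum_rdistr[symmetric] finite_E) auto
        finally show "(\<Oplus>y\<in>carrier E. ?t b y z) = a z \<otimes> ?s b z" .
      qed (use au[OF b] in \<open>auto intro!: K.finsum_closed\<close>)
      finally show "(\<Oplus>y\<in>carrier E. [?m b y x] \<cdot> (\<Oplus>z\<in>carrier E. a z \<otimes> u (code b) (inv\<^bsub>E\<^esub> z \<otimes>\<^bsub>E\<^esub> y)))
        = (\<Oplus>z\<in>carrier E. a z \<otimes> ?s b z)" .
    qed (use au in \<open>auto intro!: K.finsum_closed\<close>)
    also have "\<dots> = (\<Oplus>z\<in>carrier E. \<Oplus>b\<in>?B. a z \<otimes> ?s b z)"
      using au by (intro K.finsum_commute finite_E fB) (auto intro!: K.finsum_closed)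
    also have "\<dots> = (\<Oplus>z\<in>carrier E. a z \<otimes> dd i u (code b') (inv\<^bsub>E\<^esub> z \<otimes>\<^bsub>E\<^esub> x))"
    proof (intro K.finsum_cong' refl)
      fix z assume z: "z \<in> carrier E"
      have "dd i u (code b') (inv\<^bsub>E\<^esub> z \<otimes>\<^bsub>E\<^esub> x) = (\<Oplus>b\<in>?B. \<Oplus>y\<in>carrier E. [?m b y (inv\<^bsub>E\<^esub> z \<otimes>\<^bsub>E\<^esub> x)] \<cdot> u (code b) y)"
        by (rule dd_apply) (use b' z u in auto)
      then show "(\<Oplus>b\<in>?B. a z \<otimes> ?s b z)
        = a z \<otimes> dd i u (code b') (inv\<^bsub>E\<^esub> z \<otimes>\<^bsub>E\<^esub> x)"
        using au z ay by (simp add: K.finsum_rdistr[OF fB])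
    qed (use ay b' Fm_val[OF dd_closed[OF u] b'(1,2)] in auto)
    also have "\<dots> = (a \<odot>\<^bsub>Fm (i - 1)\<^esub> dd i u) (code b') x"
      using b' by (simp add: Fm_simps)
    finally show "dd i (a \<odot>\<^bsub>Fm i\<^esub> u) (code b') x = (a \<odot>\<^bsub>Fm (i - 1)\<^esub> dd i u) (code b') x" .
  qed (use a u in \<open>simp_all add: dd_closed\<close>)
qed

lemma chain_complex_Fm: "chain_complex A Fm dd"
proof (rule chain_complex.intro)
  show "Module.module A (Fm i)" for i by (rule Fm_module)
  show "dd i \<in> Defs.module_hom A (Fm i) (Fm (i - 1))" for i
    by (simp add: Defs.module_hom_def dd_closed dd_add dd_smult)
  show "dd (i - 1) (dd i x) = \<zero>\<^bsub>Fm (i - 1 - 1)\<^esub>" if "x \<in> carrier (Fm i)" for i x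
    using that by (rule dd_dd)
qed

lemma Fm_trivial: "i \<notin> deg ` B \<Longrightarrow> carrier (Fm i) = {\<zero>\<^bsub>Fm i\<^esub>}"
proof -
  assume "i \<notin> deg ` B"
  then have "gens i = {}" by (auto simp: gens_def)
  then show ?thesis by (simp add: Fm_def A.func_space_simps restrict_def)
qed

lemma bounded_free_complex_Fm: "bounded_free_complex A Fm dd"
proof (rule bounded_free_complex.intro[OF chain_complex_Fm])
  show "bounded_free_complex_axioms A Fm"
  proof
    show "\<exists>a b. \<forall>i. i < a \<or> b < i \<longrightarrow> carrier (Fm i) = {\<zero>\<^bsub>Fm i\<^esub>}"
    proof (intro exI allI impI)
      fix i assume "i < Min (insert 0 (deg ` B)) \<or> Max (insert 0 (deg ` B)) < i"
      then have "i \<notin> deg ` B" using finite_B by (auto simp: not_less[symmetric])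
      then show "carrier (Fm i) = {\<zero>\<^bsub>Fm i\<^esub>}" by (rule Fm_trivial)
    qed
    show "free_of_finite_rank A (Fm i)" for i
    proof -
      have "finite (gens i)" using finite_B by (simp add: gens_def)
      then show ?thesis
        unfolding free_of_finite_rank_def using Fm_module A.finite_basis_func_space[OF _ A_one_neq_zero]
        by (auto simp: Fm_def)
    qed
  qed
qed

section \<open>The total homology as a quotient of the total cycles\<close>
definition Cyc :: "int \<Rightarrow> ('e \<Rightarrow> 'k, nat \<Rightarrow> 'e \<Rightarrow> 'k) module" where
  "Cyc i = (Fm i)\<lparr>carrier := cycles Fm dd i\<rparr>"

abbreviation Bd where "Bd \<equiv> boundaries Fm dd"

definition ZV :: "('i \<times> 'x \<Rightarrow> 'k) set" where
  "ZV = {z \<in> carrier V. DV z = \<zero>\<^bsub>V\<^esub>}"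

text \<open>The homology class of a cycle of the total space, as an element of the direct sum over all degrees.\<close>
definition hclass :: "('i \<times> 'x \<Rightarrow> 'k) \<Rightarrow> int \<Rightarrow> (nat \<Rightarrow> 'e \<Rightarrow> 'k) set" where
  "hclass z = (\<lambda>i. Bd i +>\<^bsub>Cyc i\<^esub> part i z)"

abbreviation H where
  "H \<equiv> restrict_scalars (group_algebra_scalar K E) (total_homology Fm dd)"

lemma dd_mod_hom: "mod_hom A (Fm i) (Fm (i - 1)) (dd i)"
  by (simp add: mod_hom_def mod_hom_axioms_def Fm_module LinearCombinations.module_hom_def dd_closed dd_add dd_smult)

lemma cycles_submodule: "submodule A (cycles Fm dd i) (Fm i)"
proof -
  interpret h: mod_hom A "Fm i" "Fm (i - 1)" "dd i" by (rule dd_mod_hom)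
  show ?thesis using h.ker_is_submodule by (simp add: h.ker_def cycles_def)
qed

lemma Cyc_module: "Module.module A (Cyc i)"
  unfolding Cyc_def by (rule module.submodule_is_module[OF Fm_module cycles_submodule])

lemma boundaries_subset: "Bd i \<subseteq> cycles Fm dd i"
proof
  fix x assume "x \<in> Bd i"
  then obtain u where u: "u \<in> carrier (Fm (i + 1))" "x = dd (i + 1) u" by (auto simp: boundaries_def)
  then show "x \<in> cycles Fm dd i"
    using dd_dd[OF u(1)] dd_closed[OF u(1)] by (simp add: cycles_def)
qed

lemma boundaries_submodule: "submodule A (Bd i) (Cyc i)"
proof -
  interpret h: mod_hom A "Fm (i + 1)" "Fm i" "dd (i + 1)" using dd_mod_hom[of "i + 1"] by simp
  have "submodule A (Bd i) (Fm i)" using h.im_is_submodule by (simp add: h.im_def boundaries_def)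
  then interpret b: submodule A "Bd i" "Fm i" .
  show ?thesis
    by (rule submodule.intro) (use Cyc_module boundaries_subset in \<open>simp_all add: Cyc_def\<close>)
qed

lemma homology_eq: "homology Fm dd i = quotient_module (Cyc i) (Bd i)"
  by (simp add: homology_def Cyc_def)

lemma part_cycle:
  assumes "z \<in> ZV"
  shows "part i z \<in> carrier (Cyc i)"
proof -
  have "dd i (part i z) = part (i - 1) (DV z)"
    using assms part_DV[of z i] by (simp add: ZV_def)
  also have "\<dots> = \<zero>\<^bsub>Fm (i - 1)\<^esub>"
    using assms by (simp add: ZV_def part_zero)
  finally show ?thesis
    using assms by (simp add: Cyc_def cycles_def part_closed ZV_def)
qed

text \<open>A cycle whose components are all boundaries is the boundary of the chain assembled from preimages of
the components.\<close>
lemma hclass_zero_iff: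
  assumes "z \<in> ZV"
  shows "hclass z = \<zero>\<^bsub>H\<^esub> \<longleftrightarrow> z \<in> DV ` carrier V"
proof -
  have "hclass z = \<zero>\<^bsub>H\<^esub> \<longleftrightarrow> (\<forall>i. Bd i +>\<^bsub>Cyc i\<^esub> part i z = Bd i)"
    by (simp add: restrict_scalars_def total_homology_def direct_sum_module_def homology_eq
        quotient_module_zero[OF Cyc_module boundaries_submodule] hclass_def fun_eq_iff)
  also have "\<dots> \<longleftrightarrow> (\<forall>i. part i z \<in> Bd i)"
    using coset_eq_iff[OF Cyc_module boundaries_submodule part_cycle[OF assms]] by simp
  also have "\<dots> \<longleftrightarrow> z \<in> DV ` carrier V"
  proof
    assume *: "\<forall>i. part i z \<in> Bd i"
    have "\<exists>u. u \<in> carrier (Fm i) \<and> part (i - 1) z = dd i u" for i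
      using *[rule_format, of "i - 1"] by (auto simp: boundaries_def)
    then obtain u where u: "u i \<in> carrier (Fm i)" "part (i - 1) z = dd i (u i)" for i by metis
    obtain w where w: "w \<in> carrier V" "\<And>i. part i w = u i" using assemble[of u] u(1) by blast
    have "part i z = part i (DV w)" for i
      using u(2)[of "i + 1"] part_DV[OF w(1), of "i + 1"] by (simp add: w(2))
    then have "z = DV w"
      using assms w(1) by (intro V_eq_parts) (simp_all add: ZV_def DV_closed)
    then show "z \<in> DV ` carrier V" using w(1) by simp
  next
    assume "z \<in> DV ` carrier V"
    then obtain w where w: "w \<in> carrier V" "z = DV w" by auto
    show "\<forall>i. part i z \<in> Bd i"
    proof
      fix i
      have "part i z = dd (i + 1) (part (i + 1) w)"
        using part_DV[OF w(1), of "i + 1"] w(2) by simp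
      then show "part i z \<in> Bd i" by (simp add: boundaries_def part_closed w(1))
    qed
  qed
  finally show ?thesis .
qed

lemma homology_carrier: "carrier (homology Fm dd i) = (\<lambda>x. Bd i +>\<^bsub>Cyc i\<^esub> x) ` carrier (Cyc i)"
  unfolding homology_eq by (rule quotient_module_carrier[OF Cyc_module boundaries_submodule])

lemma homology_trivial:
  assumes "i \<notin> deg ` B" "h \<in> carrier (homology Fm dd i)"
  shows "h = \<zero>\<^bsub>homology Fm dd i\<^esub>"
proof -
  obtain x where x: "x \<in> carrier (Cyc i)" "h = Bd i +>\<^bsub>Cyc i\<^esub> x"
    using assms(2) by (auto simp: homology_carrier)
  then have "x = \<zero>\<^bsub>Fm i\<^esub>" using Fm_trivial[OF assms(1)] by (auto simp: Cyc_def cycles_def)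
  then have "x \<in> Bd i"
    using submodule.zero_closed[OF boundaries_submodule, of i] by (simp add: Cyc_def)
  then show ?thesis
    using coset_eq_iff[OF Cyc_module boundaries_submodule x(1)] x(2)
    by (simp add: homology_eq quotient_module_def)
qed

lemma H_carrier: "carrier H = {f. \<forall>i. f i \<in> carrier (homology Fm dd i)}"
proof -
  have "finite {i. f i \<noteq> \<zero>\<^bsub>homology Fm dd i\<^esub>}" if "\<forall>i. f i \<in> carrier (homology Fm dd i)" for f
  proof (rule finite_subset)
    show "{i. f i \<noteq> \<zero>\<^bsub>homology Fm dd i\<^esub>} \<subseteq> deg ` B" using homology_trivial that by blast
  qed (use finite_B in simp)
  then show ?thesis
    by (auto simp: restrict_scalars_def total_homology_def direct_sum_module_def)
qed

lemma hclass_onto: "hclass ` ZV = carrier H"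
proof (intro equalityI subsetI)
  fix h assume "h \<in> hclass ` ZV"
  then show "h \<in> carrier H"
    using part_cycle by (auto simp: H_carrier homology_carrier hclass_def)
next
  fix h assume "h \<in> carrier H"
  then have "\<exists>x. x \<in> carrier (Cyc i) \<and> h i = Bd i +>\<^bsub>Cyc i\<^esub> x" for i
    by (auto simp: H_carrier homology_carrier)
  then obtain u where u: "u i \<in> carrier (Cyc i)" "h i = Bd i +>\<^bsub>Cyc i\<^esub> u i" for i by metis
  have u': "u i \<in> carrier (Fm i)" "dd i (u i) = \<zero>\<^bsub>Fm (i - 1)\<^esub>" for i
    using u(1)[of i] by (simp_all add: Cyc_def cycles_def)
  obtain z where z: "z \<in> carrier V" "\<And>i. part i z = u i" using assemble[of u] u'(1) by blast
  have "part i (DV z) = part i \<zero>\<^bsub>V\<^esub>" for i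
    using part_DV[OF z(1), of "i + 1"] u'(2)[of "i + 1"] by (simp add: z(2) part_zero)
  then have "DV z = \<zero>\<^bsub>V\<^esub>" using z(1) by (intro V_eq_parts) (simp_all add: DV_closed)
  then have "z \<in> ZV" using z(1) by (simp add: ZV_def)
  moreover have "h = hclass z" by (simp add: hclass_def fun_eq_iff z(2) u(2))
  ultimately show "h \<in> hclass ` ZV" by simp
qed

lemma hclass_add:
  assumes "z \<in> ZV" "w \<in> ZV"
  shows "hclass (z \<oplus>\<^bsub>V\<^esub> w) = hclass z \<oplus>\<^bsub>H\<^esub> hclass w"
proof
  fix i
  have "(hclass z \<oplus>\<^bsub>H\<^esub> hclass w) i = hclass z i \<oplus>\<^bsub>quotient_module (Cyc i) (Bd i)\<^esub> hclass w i"
    by (simp add: restrict_scalars_def total_homology_def direct_sum_module_def homology_eq)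
  also have "\<dots> = Bd i +>\<^bsub>Cyc i\<^esub> (part i z \<oplus>\<^bsub>Cyc i\<^esub> part i w)"
    unfolding hclass_def using assms
    by (intro quotient_module_add[OF Cyc_module boundaries_submodule] part_cycle)
  also have "part i z \<oplus>\<^bsub>Cyc i\<^esub> part i w = part i (z \<oplus>\<^bsub>V\<^esub> w)"
    using assms by (simp add: Cyc_def part_add ZV_def)
  finally show "hclass (z \<oplus>\<^bsub>V\<^esub> w) i = (hclass z \<oplus>\<^bsub>H\<^esub> hclass w) i" by (simp add: hclass_def)
qed

lemma hclass_smult:
  assumes "c \<in> carrier K" "z \<in> ZV"
  shows "hclass (c \<odot>\<^bsub>V\<^esub> z) = c \<odot>\<^bsub>H\<^esub> hclass z"
proof
  fix i
  have "(c \<odot>\<^bsub>H\<^esub> hclass z) i = group_algebra_scalar K E c \<odot>\<^bsub>quotient_module (Cyc i) (Bd i)\<^esub> hclass z i"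
    by (simp add: restrict_scalars_def total_homology_def direct_sum_module_def homology_eq)
  also have "\<dots> = Bd i +>\<^bsub>Cyc i\<^esub> (group_algebra_scalar K E c \<odot>\<^bsub>Cyc i\<^esub> part i z)"
    unfolding hclass_def using assms
    by (intro quotient_module_smult[OF Cyc_module boundaries_submodule] part_cycle scalar_closed)
  also have "group_algebra_scalar K E c \<odot>\<^bsub>Cyc i\<^esub> part i z = part i (c \<odot>\<^bsub>V\<^esub> z)"
    using assms by (simp add: Cyc_def part_smult ZV_def)
  finally show "hclass (c \<odot>\<^bsub>V\<^esub> z) i = (c \<odot>\<^bsub>H\<^esub> hclass z) i" by (simp add: hclass_def)
qed

lemma ZV_submodule: "submodule K ZV V"
proof -
  interpret h: mod_hom K V V DV by (rule DV_mod_hom)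
  show ?thesis using h.ker_is_submodule by (simp add: h.ker_def ZV_def)
qed

lemma hclass_linear: "linear_map K (V\<lparr>carrier := ZV\<rparr>) H hclass"
proof -
  have Z: "Module.module K (V\<lparr>carrier := ZV\<rparr>)"
    by (rule module.submodule_is_module[OF V_module ZV_submodule])
  have zero: "\<zero>\<^bsub>V\<^esub> \<in> ZV" by (simp add: ZV_def DV_zero)
  have "\<zero>\<^bsub>V\<^esub> \<in> DV ` carrier V" using DV_zero V.M.zero_closed by (metis imageI)
  then have hz: "hclass \<zero>\<^bsub>V\<^esub> = \<zero>\<^bsub>H\<^esub>" using hclass_zero_iff[OF zero] by simp
  have HM: "Module.module K H"
    by (rule module_of_surjection[OF Z, of hclass]) (simp_all add: hclass_onto hclass_add hclass_smult hz)
  show ?thesis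
    using Z HM hclass_onto K.field_axioms
    by (auto simp: linear_map_def vectorspace_def mod_hom_def mod_hom_axioms_def LinearCombinations.module_hom_def
        hclass_add hclass_smult)
qed

end

section \<open>Counting dimensions\<close>

text \<open>A linearly independent subset of the subspace is also independent in \<open>V\<close>, so it has at most \<open>dim\<close>
elements, and a maximal one is a basis.\<close>
lemma (in vectorspace) subspace_fin_dim:
  assumes N: "VectorSpace.subspace K N V" and fd: "fin_dim"
  shows "vectorspace.fin_dim K (vs N)" and "vectorspace.dim K (vs N) \<le> dim"
proof -
  have sub: "submodule K N V" using N by (simp add: VectorSpace.subspace_def)
  have NV: "N \<subseteq> carrier V" using sub by (simp add: submodule_def)
  interpret N: vectorspace K "vs N" by (rule subspace_is_vs[OF N])
  have li: "N.lin_indpt S \<longleftrightarrow> lin_indpt S" if "S \<subseteq> N" for S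
    using span_li_not_depend(2)[OF that sub] by simp
  have "\<exists>S. finite S \<and> maximal S (\<lambda>S. S \<subseteq> carrier (vs N) \<and> N.lin_indpt S)"
  proof (rule maximal_exists)
    show "finite S \<and> card S \<le> dim" if "S \<subseteq> carrier (vs N) \<and> N.lin_indpt S" for S
      using that li[of S] NV li_le_dim[OF fd, of S] by auto
    show "{} \<subseteq> carrier (vs N) \<and> N.lin_indpt {}" by (simp add: N.lin_dep_def)
  qed
  then obtain S where S: "finite S" "N.basis S" using N.max_li_is_basis by blast
  then show "N.fin_dim" by (auto simp: N.fin_dim_def N.basis_def)
  have "N.dim = card S" by (rule N.dim_basis[OF S])
  also have "\<dots> \<le> dim"
    using S li[of S] NV by (intro li_le_dim[OF fd]) (auto simp: N.basis_def)
  finally show "N.dim \<le> dim" .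
qed

lemma (in linear_map) inj_dim_le:
  assumes "V.fin_dim" "W.fin_dim" "inj_on T (carrier V)"
  shows "V.dim \<le> W.dim"
proof -
  have "vectorspace.dim K (W.vs imT) \<le> W.dim"
    by (rule W.subspace_fin_dim(2)[OF imT_is_subspace assms(2)])
  with rank_nullity[OF assms(1)] inj_imp_dim_ker0[OF assms(3)] show ?thesis by simp
qed

lemma linear_map_into_subspace:
  assumes "linear_map K U V f" "VectorSpace.subspace K N V" "\<And>u. u \<in> carrier U \<Longrightarrow> f u \<in> N"
  shows "linear_map K U (V\<lparr>carrier := N\<rparr>) f"
proof -
  interpret f: linear_map K U V f by fact
  have "vectorspace K (V\<lparr>carrier := N\<rparr>)" by (rule f.W.subspace_is_vs[OF assms(2)])
  then show ?thesis
    using f.V.vectorspace_axioms assms(3)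
    by (auto simp: linear_map_def mod_hom_def mod_hom_axioms_def LinearCombinations.module_hom_def vectorspace_def)
qed

text \<open>The space \<open>H\<close> is a quotient of \<open>ker W / im W\<close>, whose dimension is \<open>dim V - 2 rank W\<close>, and \<open>\<psi>\<close> exhibits \<open>dim U\<close> as a
lower bound of the rank.\<close>
lemma dim_subquotient_le:
  assumes W: "linear_map K V V W" and fd: "vectorspace.fin_dim K V"
    and L: "linear_map K (V\<lparr>carrier := {v \<in> carrier V. W v = \<zero>\<^bsub>V\<^esub>}\<rparr>) H L"
    and onto: "L ` {v \<in> carrier V. W v = \<zero>\<^bsub>V\<^esub>} = carrier H"
    and kills: "\<And>v. v \<in> carrier V \<Longrightarrow> W (W v) = \<zero>\<^bsub>V\<^esub>" "\<And>v. v \<in> carrier V \<Longrightarrow> L (W v) = \<zero>\<^bsub>H\<^esub>"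
    and \<psi>: "linear_map K U V \<psi>" and U: "vectorspace.fin_dim K U" and inj: "inj_on \<psi> (carrier U)"
    and im: "\<psi> ` carrier U \<subseteq> W ` carrier V"
  shows "vectorspace.fin_dim K H" and "vectorspace.dim K H + 2 * vectorspace.dim K U \<le> vectorspace.dim K V"
proof -
  interpret W: linear_map K V V W by fact
  interpret L: linear_map K "V\<lparr>carrier := {v \<in> carrier V. W v = \<zero>\<^bsub>V\<^esub>}\<rparr>" H L by fact
  interpret \<psi>: linear_map K U V \<psi> by fact
  have kerW: "W.ker = {v \<in> carrier V. W v = \<zero>\<^bsub>V\<^esub>}" by (simp add: W.ker_def)
  have imW: "W.im = W ` carrier V" by (simp add: W.im_def)
  have subI: "VectorSpace.subspace K W.im V" by (rule W.imT_is_subspace)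
  have fdN: "L.V.fin_dim"
    using W.V.subspace_fin_dim(1)[OF W.kerT_is_subspace fd] by (simp add: kerW)
  show fdH: "L.W.fin_dim"
    by (rule L.surj_fin_dim[OF fdN]) (simp add: onto)
  have 1: "vectorspace.dim K (V\<lparr>carrier := W.im\<rparr>) + L.V.dim = W.V.dim"
    using W.rank_nullity[OF fd] by (simp add: kerW)
  have "L.im = carrier H" using onto by (simp add: L.im_def)
  then have 2: "L.W.dim + vectorspace.dim K (V\<lparr>carrier := L.ker\<rparr>) = L.V.dim"
    using L.rank_nullity[OF fdN] by simp
  have "linear_map K U (V\<lparr>carrier := W.im\<rparr>) \<psi>"
    by (rule linear_map_into_subspace[OF \<psi> subI]) (use im imW in auto)
  from linear_map.inj_dim_le[OF this U _ inj] W.V.subspace_fin_dim(1)[OF subI fd]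
  have 3: "\<psi>.V.dim \<le> vectorspace.dim K (V\<lparr>carrier := W.im\<rparr>)" by simp
  have \<psi>N: "linear_map K U (V\<lparr>carrier := {v \<in> carrier V. W v = \<zero>\<^bsub>V\<^esub>}\<rparr>) \<psi>"
    by (rule linear_map_into_subspace[OF \<psi>])
       (use im kills(1) W.kerT_is_subspace in \<open>auto simp: kerW\<close>)
  have "linear_map K U (V\<lparr>carrier := {v \<in> carrier V. W v = \<zero>\<^bsub>V\<^esub>}, carrier := L.ker\<rparr>) \<psi>"
  proof (rule linear_map_into_subspace[OF \<psi>N L.kerT_is_subspace])
    fix u assume "u \<in> carrier U"
    then obtain v where "v \<in> carrier V" "\<psi> u = W v" using im by blast
    then show "\<psi> u \<in> L.ker" using kills by (simp add: L.ker_def)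
  qed
  from linear_map.inj_dim_le[OF this U _ inj] L.V.subspace_fin_dim(1)[OF L.kerT_is_subspace fdN]
  have 4: "\<psi>.V.dim \<le> vectorspace.dim K (V\<lparr>carrier := L.ker\<rparr>)" by simp
  from 1 2 3 4 show "L.W.dim + 2 * \<psi>.V.dim \<le> W.V.dim" by simp
qed

section \<open>The rank of multiplication by w on the exterior algebra\<close>
definition pr :: "nat \<Rightarrow> nat set" where
  "pr j = {2*j, 2*j+1}"

definition full :: "nat set \<Rightarrow> nat set" where
  "full S = {j \<in> {..<4}. pr j \<subseteq> S}"

lemma pr_disjoint: "i \<noteq> j \<Longrightarrow> pr i \<inter> pr j = {}"
  unfolding pr_def by (auto; presburger)

lemma pr_nonempty [simp]: "pr j \<noteq> {}"
  by (simp add: pr_def)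

lemma pr_subset: "j < 4 \<Longrightarrow> pr j \<subseteq> {..<8}"
  by (auto simp: pr_def)

lemma card_pr [simp]: "card (pr j) = 2" and finite_pr [simp]: "finite (pr j)"
  by (simp_all add: pr_def)

lemma finite_full [simp]: "finite (full S)"
  by (simp add: full_def)

text \<open>The pairs partition \<open>{..<8}\<close>, so a set meets at most as many of them as it has elements there.\<close>
lemma pairs_hit: "card {j \<in> {..<4}. pr j \<inter> A \<noteq> {}} \<le> card (A \<inter> {..<8})"
proof -
  have "{j \<in> {..<4}. pr j \<inter> A \<noteq> {}} \<subseteq> (\<lambda>a. a div 2) ` (A \<inter> {..<8})"
  proof
    fix j assume "j \<in> {j \<in> {..<4}. pr j \<inter> A \<noteq> {}}"
    then obtain a where "j < 4" "a \<in> pr j" "a \<in> A" by auto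
    moreover from this have "a div 2 = j" "a < 8" by (auto simp: pr_def)
    ultimately show "j \<in> (\<lambda>a. a div 2) ` (A \<inter> {..<8})" by blast
  qed
  then show ?thesis by (meson finite_Int finite_lessThan surj_card_le)
qed

text \<open>Injectivity of \<open>w\<close> in degrees at most 3 of the eight variables: the sums in \<open>eqn\<close> are the coefficients of
\<open>w d\<close>. A monomial of such a degree contains at most one full pair. If it contains none, some pair is
disjoint from it, and adding this pair gives an equation with a single term. If it contains the pair \<open>i\<close>,
then there are two more pairs \<open>j\<close> and \<open>k\<close> that may be exchanged for \<open>i\<close>, and the pairwise sums of the three
coefficients vanish.\<close>
lemma (in abelian_group) lefschetz_low_injective:
  assumes d: "\<And>S. d S \<in> carrier G"
    and supp: "\<And>S. d S \<noteq> \<zero> \<Longrightarrow> r \<in> S \<and> S \<subseteq> {..r} \<and> card (S \<inter> {..<8}) \<le> 3"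
    and eqn: "\<And>T. T \<subseteq> {..<r} \<Longrightarrow> card (T \<inter> {..<8}) \<le> 5 \<Longrightarrow> (\<Oplus>j\<in>full T. d (insert r (T - pr j))) = \<zero>"
    and r: "8 \<le> r"
    and two: "\<And>a. a \<in> carrier G \<Longrightarrow> a \<oplus> a = \<zero> \<Longrightarrow> a = \<zero>"
  shows "d S = \<zero>"
proof (rule ccontr)
  assume nz: "d S \<noteq> \<zero>"
  define S0 where "S0 = S - {r}"
  have S: "S = insert r S0" "r \<notin> S0" "S0 \<subseteq> {..<r}" "card (S0 \<inter> {..<8}) \<le> 3"
  proof -
    show "S = insert r S0" "r \<notin> S0" "S0 \<subseteq> {..<r}" using supp[OF nz] by (auto simp: S0_def)
    have "S0 \<inter> {..<8} = S \<inter> {..<8}" using r by (auto simp: S0_def)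
    then show "card (S0 \<inter> {..<8}) \<le> 3" using supp[OF nz] by simp
  qed
  have prr: "pr j \<subseteq> {..<r}" if "j < 4" for j using pr_subset[OF that] r by auto
  have card_Un: "card ((A \<union> pr j) \<inter> {..<8}) \<le> card (A \<inter> {..<8}) + 2" for A j
  proof -
    have "card ((A \<union> pr j) \<inter> {..<8}) \<le> card ((A \<inter> {..<8}) \<union> pr j)" by (intro card_mono) auto
    also have "\<dots> \<le> card (A \<inter> {..<8}) + card (pr j)" by (rule card_Un_le)
    finally show ?thesis by simp
  qed
  show False
  proof (cases "full S0 = {}")
    case True
    have "\<not> {..<4} \<subseteq> {j \<in> {..<4}. pr j \<inter> S0 \<noteq> {}}"
      using card_mono[of "{j \<in> {..<4}. pr j \<inter> S0 \<noteq> {}}" "{..<4}"] pairs_hit[of S0] S(4) by auto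
    then obtain j where j: "j < 4" "pr j \<inter> S0 = {}" by auto
    have full: "full (S0 \<union> pr j) = {j}"
    proof (intro equalityI subsetI)
      fix l assume l: "l \<in> full (S0 \<union> pr j)"
      show "l \<in> {j}"
      proof (rule ccontr)
        assume "l \<notin> {j}"
        with l pr_disjoint[of l j] have "l \<in> full S0" by (auto simp: full_def)
        with True show False by simp
      qed
    qed (use j in \<open>auto simp: full_def\<close>)
    have "(\<Oplus>l\<in>full (S0 \<union> pr j). d (insert r (S0 \<union> pr j - pr l))) = \<zero>"
      by (rule eqn) (use S prr[OF j(1)] card_Un[of S0 j] in auto)
    moreover have "S0 \<union> pr j - pr j = S0" using j by auto
    ultimately have "d S = \<zero>" using S(1) d by (simp add: full)
    with nz show False by simp
  next
    case False
    then obtain i where i: "i < 4" "pr i \<subseteq> S0" by (auto simp: full_def)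
    define R where "R = S0 - pr i"
    have "R \<inter> {..<8} = (S0 \<inter> {..<8}) - pr i" by (auto simp: R_def)
    moreover have "card ((S0 \<inter> {..<8}) - pr i) = card (S0 \<inter> {..<8}) - 2"
      using i pr_subset[OF i(1)] by (subst card_Diff_subset) auto
    ultimately have cR: "card (R \<inter> {..<8}) \<le> 1" using S(4) by simp
    have Rr: "R \<subseteq> {..<r}" using S by (auto simp: R_def)
    have fullR: "\<not> pr l \<subseteq> R" if "l < 4" for l
    proof
      assume "pr l \<subseteq> R"
      then have "card (pr l) \<le> card (R \<inter> {..<8})" using pr_subset[OF that] by (intro card_mono) auto
      with cR show False by simp
    qed
    let ?F = "{..<4} - {i} - {j \<in> {..<4}. pr j \<inter> R \<noteq> {}}"
    have "card ({..<4} - {i}) - card {j \<in> {..<4}. pr j \<inter> R \<noteq> {}} \<le> card ?F"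
      by (rule diff_card_le_card_Diff) simp
    then have "2 \<le> card ?F" using pairs_hit[of R] cR i(1) by simp
    then obtain Q where Q: "Q \<subseteq> ?F" "card Q = 2"
      by (rule obtain_subset_with_card_n)
    obtain j k where "Q = {j, k}" "j \<noteq> k" using Q(2) by (meson card_2_iff)
    with Q(1) have jk: "j \<in> ?F" "k \<in> ?F" "j \<noteq> k" by simp_all
    have pair: "d (insert r (R \<union> pr a)) \<oplus> d (insert r (R \<union> pr b)) = \<zero>"
      if a: "a < 4" "pr a \<inter> R = {}" and b: "b < 4" "pr b \<inter> R = {}" and ab: "a \<noteq> b" for a b
    proof -
      let ?T = "R \<union> pr a \<union> pr b"
      have full: "full ?T = {a, b}"
      proof (intro equalityI subsetI)
        fix l assume l: "l \<in> full ?T"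
        show "l \<in> {a, b}"
        proof (rule ccontr)
          assume "l \<notin> {a, b}"
          with l pr_disjoint[of l a] pr_disjoint[of l b] have "pr l \<subseteq> R" "l < 4" by (auto simp: full_def)
          with fullR show False by blast
        qed
      qed (use a b in \<open>auto simp: full_def\<close>)
      have "(\<Oplus>l\<in>full ?T. d (insert r (?T - pr l))) = \<zero>"
        by (rule eqn) (use Rr prr a b card_Un[of "R \<union> pr a" b] card_Un[of R a] cR in auto)
      moreover have "?T - pr a = R \<union> pr b" "?T - pr b = R \<union> pr a"
        using a b pr_disjoint[OF ab] by auto
      ultimately show ?thesis using ab d by (simp add: full a_comm)
    qed
    let ?d = "\<lambda>l. d (insert r (R \<union> pr l))"
    have iR: "pr i \<inter> R = {}" by (auto simp: R_def)
    have "?d i \<oplus> ?d j = \<zero>" "?d i \<oplus> ?d k = \<zero>" "?d j \<oplus> ?d k = \<zero>"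
      using pair[of i j] pair[of i k] pair[of j k] jk i(1) iR by auto
    then have "\<ominus> ?d j = ?d i" "\<ominus> ?d k = ?d i" "\<ominus> (?d j \<oplus> ?d k) = \<zero>"
      using d by (simp_all add: minus_equality)
    then have "?d i \<oplus> ?d i = \<zero>" using minus_add[of "?d j" "?d k"] d by simp
    then have "?d i = \<zero>" using two d by blast
    moreover have "insert r (R \<union> pr i) = S" using S(1) i by (auto simp: R_def)
    ultimately show False using nz by simp
  qed
qed

context cone_operators
begin

lemma lefschetz_alt: "lefschetz c S = (if r \<in> S then 0 else \<Sum>j\<in>full S. c (insert r (S - pr j)))"
proof -
  have "(\<Sum>j<4. if pr j \<subseteq> S then c (insert r (S - pr j)) else 0) = (\<Sum>j\<in>full S. c (insert r (S - pr j)))"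
    unfolding full_def by (rule sum.inter_filter[symmetric]) simp
  then show ?thesis by (simp only: lefschetz_def pr_def[symmetric])
qed

lemma lefschetz_scale: "lefschetz (\<lambda>x. k * c x) S = k * lefschetz c S"
  by (simp add: lefschetz_alt sum_distrib_left)

lemma pr_less_r: "j < 4 \<Longrightarrow> pr j \<subseteq> {..<r}"
  using pr_subset[of j] r_ge by auto

lemma lefschetz_delta:
  assumes "r \<notin> Q"
  shows "lefschetz (delta (insert r Q)) S = (\<Sum>l<4. if pr l \<inter> Q = {} \<and> S = Q \<union> pr l then 1 else 0)"
proof (cases "r \<in> S")
  case True
  then have "\<not> (pr l \<inter> Q = {} \<and> S = Q \<union> pr l)" if "l < 4" for l
    using assms pr_less_r[OF that] by auto
  then have "(\<Sum>l<4. if pr l \<inter> Q = {} \<and> S = Q \<union> pr l then 1 else 0) = (0::int)"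
    by (intro sum.neutral) auto
  then show ?thesis using True by (simp add: lefschetz_alt)
next
  case False
  have "(if pr l \<subseteq> S then delta (insert r Q) (insert r (S - pr l)) else 0)
     = (if pr l \<inter> Q = {} \<and> S = Q \<union> pr l then 1 else 0)" for l
  proof -
    have "insert r (S - pr l) = insert r Q \<longleftrightarrow> S - pr l = Q" by (subst insert_ident) (use False assms in auto)
    then show ?thesis by (auto simp: delta_def)
  qed
  then show ?thesis using False by (simp only: lefschetz_def pr_def[symmetric] if_False)
qed

text \<open>The monomials of degree at most 3 in the first eight variables in the source copy, on which \<open>w\<close> is injective,
and those of degree at least 6 in the target copy, which lie in its image.\<close>
definition low :: "nat set set" where
  "low = {S \<in> Pow {..r}. r \<in> S \<and> card (S \<inter> {..<8}) \<le> 3}"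

definition high :: "nat set set" where
  "high = {S \<in> Pow {..r}. r \<notin> S \<and> 6 \<le> card (S \<inter> {..<8})}"

text \<open>A monomial of degree at least 6 misses at most two of the eight variables. If it meets all pairs, it
is the product of \<open>w\<close> with the monomial without one of its full pairs. Otherwise it misses exactly
one pair \<open>e\<close>. Write \<open>t\<^sub>x\<close> for the product of the pairs other than \<open>x\<close>; then the multiples of \<open>w\<close> by products
of two pairs are \<open>w \<cdot> ab = t\<^sub>e + t\<^sub>c\<close>, \<open>w \<cdot> ac = t\<^sub>e + t\<^sub>b\<close> and \<open>w \<cdot> ae = t\<^sub>c + t\<^sub>b\<close>, so \<open>w (ab + ac - ae) = 2 t\<^sub>e\<close>.\<close>
lemma high_in_image:
  assumes "T \<in> high"
  shows "\<exists>g. \<forall>S. lefschetz g S = 2 * delta T S"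
proof -
  have T: "T \<subseteq> {..<r}" "6 \<le> card (T \<inter> {..<8})"
    using assms by (auto simp: high_def less_le)
  have compl: "card ({..<8} - T) \<le> 2"
  proof -
    have "card ({..<8} - T) = card {..<8::nat} - card ({..<8} \<inter> T)" by (rule card_Diff_subset_Int) simp
    then show ?thesis using T(2) by (simp add: Int_commute)
  qed
  show ?thesis
  proof (cases "\<exists>e<4. pr e \<inter> T = {}")
    case False
    have "\<not> {..<4} \<subseteq> {j \<in> {..<4}. pr j \<inter> ({..<8} - T) \<noteq> {}}"
    proof
      assume "{..<4} \<subseteq> {j \<in> {..<4}. pr j \<inter> ({..<8} - T) \<noteq> {}}"
      then have "card {..<4::nat} \<le> card {j \<in> {..<4}. pr j \<inter> ({..<8} - T) \<noteq> {}}"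
        by (rule card_mono[rotated]) simp
      also have "\<dots> \<le> card (({..<8} - T) \<inter> {..<8})" by (rule pairs_hit)
      also have "({..<8} - T) \<inter> {..<8} = {..<8} - T" by auto
      finally show False using compl by simp
    qed
    then obtain j where j: "j < 4" "pr j \<inter> ({..<8} - T) = {}" by auto
    then have jT: "pr j \<subseteq> T" using pr_subset[OF j(1)] by blast
    have "lefschetz (delta (insert r (T - pr j))) S = delta T S" for S
    proof -
      have "pr l \<inter> (T - pr j) = {} \<longleftrightarrow> l = j" if "l < 4" for l
        using that False pr_disjoint[of l j] by blast
      then have "lefschetz (delta (insert r (T - pr j))) S = (\<Sum>l<4. if l = j \<and> S = T then 1 else 0)"
        using T jT by (subst lefschetz_delta) (auto intro!: sum.cong)
      also have "\<dots> = delta T S" using j by (simp add: delta_def)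
      finally show ?thesis .
    qed
    then have "lefschetz (\<lambda>x. 2 * delta (insert r (T - pr j)) x) S = 2 * delta T S" for S
      by (simp add: lefschetz_scale)
    then show ?thesis by blast
  next
    case True
    then obtain e where e: "e < 4" "pr e \<inter> T = {}" by blast
    have "pr e \<subseteq> {..<8} - T" using e pr_subset by blast
    then have "{..<8} - T = pr e" using compl by (intro card_seteq[symmetric]) auto
    then have others: "pr l \<subseteq> T" if "l < 4" "l \<noteq> e" for l
      using pr_subset[OF that(1)] pr_disjoint[OF that(2)] by blast
    have "card ({..<4} - {e}) = 3" using e by simp
    then obtain a b c where abc: "{..<4} - {e} = {a, b, c}" "a \<noteq> b" "b \<noteq> c" "a \<noteq> c"
      by (auto simp: card_3_iff)
    have four: "{..<4} = {a, b, c, e}" "e \<notin> {a, b, c}" using abc e by auto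
    define R where "R = T - (pr a \<union> pr b \<union> pr c)"
    have sub: "pr a \<subseteq> T" "pr b \<subseteq> T" "pr c \<subseteq> T" using others abc(1) by auto
    have dis: "pr a \<inter> R = {}" "pr b \<inter> R = {}" "pr c \<inter> R = {}" "pr e \<inter> R = {}"
      using e by (auto simp: R_def)
    have rR: "r \<notin> R" "R \<subseteq> {..<r}" using T by (auto simp: R_def)
    have key: "lefschetz (delta (insert r (R \<union> pr x \<union> pr y))) S
        = delta (R \<union> pr x \<union> pr y \<union> pr z) S + delta (R \<union> pr x \<union> pr y \<union> pr w) S"
      if xyzw: "{..<4} = {x, y, z, w}" "distinct [x, y, z, w]" for x y z w S
    proof -
      have lt: "x < 4" "y < 4" "z < 4" "w < 4" using xyzw(1) by auto
      have nr: "r \<notin> R \<union> pr x \<union> pr y" using rR pr_less_r lt by blast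
      have dR: "pr z \<inter> R = {}" "pr w \<inter> R = {}"
        using dis lt four(1) by auto
      have "pr z \<inter> (R \<union> pr x \<union> pr y) = {}" "pr w \<inter> (R \<union> pr x \<union> pr y) = {}"
        using dR pr_disjoint[of z x] pr_disjoint[of z y] pr_disjoint[of w x] pr_disjoint[of w y] xyzw(2) by auto
      moreover have "pr x \<inter> (R \<union> pr x \<union> pr y) \<noteq> {}" "pr y \<inter> (R \<union> pr x \<union> pr y) \<noteq> {}"
        using pr_nonempty[of x] pr_nonempty[of y] by blast+
      ultimately show ?thesis
        unfolding lefschetz_delta[OF nr] xyzw(1) using xyzw(2) by (simp add: delta_def)
    qed
    let ?u = "delta (insert r (R \<union> pr a \<union> pr b))" and ?v = "delta (insert r (R \<union> pr a \<union> pr c))"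
      and ?w = "delta (insert r (R \<union> pr a \<union> pr e))"
    have RT: "R \<union> pr a \<union> pr b \<union> pr c = T" "R \<union> pr a \<union> pr c \<union> pr b = T"
      using sub by (auto simp: R_def)
    have "lefschetz (\<lambda>x. ?u x + ?v x - ?w x) S = lefschetz ?u S + lefschetz ?v S - lefschetz ?w S" for S
      by (simp add: lefschetz_alt sum.distrib sum_subtractf)
    also have "lefschetz ?u S + lefschetz ?v S - lefschetz ?w S = 2 * delta T S" for S
    proof -
      have "R \<union> pr a \<union> pr e \<union> pr b = R \<union> pr a \<union> pr b \<union> pr e" "R \<union> pr a \<union> pr e \<union> pr c = R \<union> pr a \<union> pr c \<union> pr e" by auto
      then show ?thesis
        using key[of a b c e S] key[of a c b e S] key[of a e b c S] abc four RT by (auto simp: insert_commute)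
    qed
    finally show ?thesis by blast
  qed
qed

lemma finite_low: "finite low" and finite_high: "finite high"
  by (simp_all add: low_def high_def)

text \<open>An operator \<open>\<theta>\<close> that keeps the monomials in \<open>low\<close> and replaces those in \<open>high\<close> by preimages of their doubles, so
that everything in the image of \<open>lefschetz \<circ> \<theta>\<close> is a multiple of \<open>w\<close> by construction.\<close>
lemma lefschetz_lift:
  "\<exists>\<theta>. int_linear (low \<union> high) (Pow {..r}) \<theta> \<and> (\<forall>c. \<forall>S\<in>Pow {..r}. lefschetz (\<theta> c) S =
     lefschetz (\<lambda>S. if S \<in> low then c S else 0) S + (if S \<in> high then 2 * c S else 0))"
proof -
  obtain g where g: "\<And>T S. T \<in> high \<Longrightarrow> lefschetz (g T) S = 2 * delta T S"
    using high_in_image by metis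
  let ?\<theta> = "\<lambda>(c :: _ \<Rightarrow> int) S. (if S \<in> low then c S else 0) + (\<Sum>T\<in>high. c T * g T S)"
  have "int_linear (low \<union> high) (Pow {..r}) ?\<theta>"
  proof (rule int_linearI)
    fix u v :: "nat set \<Rightarrow> int" and S assume uv: "\<And>T. T \<in> low \<union> high \<Longrightarrow> u T = v T"
    have "(\<Sum>T\<in>high. u T * g T S) = (\<Sum>T\<in>high. v T * g T S)"
      by (intro sum.cong refl) (simp add: uv)
    then show "?\<theta> u S = ?\<theta> v S" using uv[of S] by simp
  qed (auto simp: algebra_simps sum.distrib sum_distrib_left)
  moreover have "lefschetz (?\<theta> c) S = lefschetz (\<lambda>S. if S \<in> low then c S else 0) S + (if S \<in> high then 2 * c S else 0)"
    if S: "S \<in> Pow {..r}" for c S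
  proof -
    have "lefschetz (?\<theta> c) S = lefschetz (\<lambda>S. if S \<in> low then c S else 0) S + (\<Sum>T\<in>high. lefschetz (\<lambda>S. c T * g T S) S)"
      by (simp only: int_linear_add[OF int_linear_lefschetz S] int_linear_sum_apply[OF int_linear_lefschetz S])
    also have "(\<Sum>T\<in>high. lefschetz (\<lambda>S. c T * g T S) S) = (\<Sum>T\<in>high. if S = T then 2 * c T else 0)"
      by (intro sum.cong refl) (simp add: lefschetz_scale g delta_def)
    also have "\<dots> = (if S \<in> high then 2 * c S else 0)"
      by (simp add: finite_high)
    finally show ?thesis .
  qed
  ultimately show ?thesis by blast
qed

lemma card_by_low_part:
  "card {S \<in> Pow {..<r}. Q (card (S \<inter> {..<8}))} = card {A \<in> Pow {..<8::nat}. Q (card A)} * 2 ^ (r - 8)"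
proof -
  have "bij_betw (\<lambda>(A, C). A \<union> C) ({A \<in> Pow {..<8}. Q (card A)} \<times> Pow {8..<r}) {S \<in> Pow {..<r}. Q (card (S \<inter> {..<8}))}"
  proof (rule bij_betw_byWitness[of _ "\<lambda>S. (S \<inter> {..<8}, S \<inter> {8..<r})"])
    have i: "(A \<union> C) \<inter> {..<8} = A" "(A \<union> C) \<inter> {8..<r} = C"
      if "A \<subseteq> {..<8}" "C \<subseteq> {8..<r}" for A :: "nat set" and C :: "nat set"
      using that by (auto simp: subset_eq not_le[symmetric])
    then show "\<forall>a\<in>{A \<in> Pow {..<8}. Q (card A)} \<times> Pow {8..<r}. (case case a of (A, C) \<Rightarrow> A \<union> C of S \<Rightarrow> (S \<inter> {..<8}, S \<inter> {8..<r})) = a"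
      by auto
    show "(\<lambda>(A, C). A \<union> C) ` ({A \<in> Pow {..<8}. Q (card A)} \<times> Pow {8..<r}) \<subseteq> {S \<in> Pow {..<r}. Q (card (S \<inter> {..<8}))}"
    proof (rule image_subsetI)
      fix x :: "nat set \<times> nat set" assume x: "x \<in> {A \<in> Pow {..<8}. Q (card A)} \<times> Pow {8..<r}"
      obtain A C where AC: "x = (A, C)" by force
      with x r_ge have "A \<subseteq> {..<8}" "C \<subseteq> {8..<r}" "A \<union> C \<subseteq> {..<r}" "Q (card A)" by auto
      then show "(case x of (A, C) \<Rightarrow> A \<union> C) \<in> {S \<in> Pow {..<r}. Q (card (S \<inter> {..<8}))}"
        using i(1)[of A C] AC by auto
    qed
  qed auto
  then have "card {S \<in> Pow {..<r}. Q (card (S \<inter> {..<8}))} = card ({A \<in> Pow {..<8::nat}. Q (card A)} \<times> Pow {8..<r})"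
    by (rule bij_betw_same_card[symmetric])
  then show ?thesis by (simp add: card_cartesian_product card_Pow)
qed

lemma card_subsets_of_size:
  assumes "finite M"
  shows "card {A \<in> Pow {..<8::nat}. card A \<in> M} = (\<Sum>k\<in>M. 8 choose k)"
proof -
  have "{A \<in> Pow {..<8::nat}. card A \<in> M} = (\<Union>k\<in>M. {A. A \<subseteq> {..<8} \<and> card A = k})" by auto
  also have "card \<dots> = (\<Sum>k\<in>M. card {A. A \<subseteq> {..<8::nat} \<and> card A = k})"
    by (rule card_UN_disjoint) (use assms in auto)
  finally show ?thesis by (simp add: n_subsets)
qed

text \<open>With \<open>1 + 8 + 28 + 56 = 93\<close> and \<open>28 + 8 + 1 = 37\<close> choices in the first eight variables.\<close>
lemma card_low_high: "card (low \<union> high) = 130 * 2 ^ (r - 8)"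
proof -
  have "low = insert r ` {S \<in> Pow {..<r}. card (S \<inter> {..<8}) \<in> {..3}}"
  proof (intro equalityI subsetI)
    fix S assume S: "S \<in> low"
    have "(S - {r}) \<inter> {..<8} = S \<inter> {..<8}" using r_ge by auto
    moreover have "S - {r} \<subseteq> {..<r}" using S by (auto simp: low_def less_le)
    ultimately have "S - {r} \<in> {S \<in> Pow {..<r}. card (S \<inter> {..<8}) \<in> {..3}}"
      using S by (simp add: low_def)
    moreover have "S = insert r (S - {r})" using S by (auto simp: low_def)
    ultimately show "S \<in> insert r ` {S \<in> Pow {..<r}. card (S \<inter> {..<8}) \<in> {..3}}" by (rule rev_image_eqI)
  next
    fix S assume "S \<in> insert r ` {S \<in> Pow {..<r}. card (S \<inter> {..<8}) \<in> {..3}}"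
    then obtain T where T: "T \<subseteq> {..<r}" "card (T \<inter> {..<8}) \<le> 3" "S = insert r T" by auto
    have "insert r T \<inter> {..<8} = T \<inter> {..<8}" using r_ge by auto
    then show "S \<in> low" using T by (auto simp: low_def)
  qed
  moreover have "inj_on (insert r) {S \<in> Pow {..<r}. card (S \<inter> {..<8}) \<in> {..3}}"
  proof (rule inj_onI)
    fix S T assume "S \<in> {S \<in> Pow {..<r}. card (S \<inter> {..<8}) \<in> {..3}}" "T \<in> {S \<in> Pow {..<r}. card (S \<inter> {..<8}) \<in> {..3}}"
      and eq: "insert r S = insert r T"
    then have "r \<notin> S" "r \<notin> T" by auto
    with eq show "S = T" by (simp add: insert_ident)
  qed
  ultimately have "card low = (\<Sum>k\<le>3. 8 choose k) * 2 ^ (r - 8)"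
    by (simp only: card_image card_by_low_part[of "\<lambda>k. k \<in> {..3}"] card_subsets_of_size finite_atMost)
  also have "(\<Sum>k\<le>3. 8 choose k) = 93" by (simp add: eval_nat_numeral)
  finally have 1: "card low = 93 * 2 ^ (r - 8)" .
  have le8: "card (S \<inter> {..<8::nat}) \<le> 8" for S
    using card_mono[of "{..<8::nat}" "S \<inter> {..<8}"] by simp
  have "high = {S \<in> Pow {..<r}. card (S \<inter> {..<8}) \<in> {6..8}}"
  proof (intro equalityI subsetI)
    fix S assume S: "S \<in> high"
    then have "S \<subseteq> {..<r}" by (auto simp: high_def less_le)
    with S le8[of S] show "S \<in> {S \<in> Pow {..<r}. card (S \<inter> {..<8}) \<in> {6..8}}" by (simp add: high_def)
  qed (auto simp: high_def)
  then have "card high = (\<Sum>k\<in>{6..8}. 8 choose k) * 2 ^ (r - 8)"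
    by (simp only: card_by_low_part[of "\<lambda>k. k \<in> {6..8}"] card_subsets_of_size finite_atLeastAtMost)
  also have "(\<Sum>k\<in>{6..8}. 8 choose k) = (37 :: nat)" by (simp add: eval_nat_numeral)
  finally have 2: "card high = 37 * 2 ^ (r - 8)" .
  have "low \<inter> high = {}" by (auto simp: low_def high_def)
  then show ?thesis by (simp add: card_Un_disjoint finite_low finite_high 1 2)
qed

end

lemma (in abelian_group) act_select:
  assumes "finite X" "u \<in> X \<rightarrow>\<^sub>E carrier G" "y \<in> Y" "Z \<subseteq> X"
  shows "act X Y (\<lambda>u y. if y \<in> Z then k * u y else 0) u y = (if y \<in> Z then [(k :: int)] \<cdot> u y else \<zero>)"
proof (cases "y \<in> Z")
  case True
  then have yX: "y \<in> X" using assms by auto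
  have u': "u x \<in> carrier G" if "x \<in> X" for x using assms that by auto
  have "(\<Oplus>x\<in>X. [(k * delta x y)] \<cdot> u x) = [(k * delta y y)] \<cdot> u y"
    using yX u' assms(1) by (intro finsum_single) (auto simp: delta_def)
  then show ?thesis using True assms(3) by (simp add: act_def) (simp add: delta_def)
next
  case False
  then show ?thesis using assms by (simp add: act_def)
qed

locale cone_over_field = cone_operators p r + K: field K
  for p r :: nat and K :: "('k, 'a) ring_scheme" (structure) +
  assumes two_cancel: "a \<in> carrier K \<Longrightarrow> a \<oplus> a = \<zero> \<Longrightarrow> a = \<zero>"
begin

abbreviation Y :: "nat set set" where "Y \<equiv> Pow {..r}"

lemma act_lefschetz:
  assumes c: "c \<in> Y \<rightarrow>\<^sub>E carrier K" and T: "T \<in> Y"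
  shows "K.act Y Y lefschetz c T = (if r \<in> T then \<zero> else \<Oplus>j\<in>full T. c (insert r (T - pr j)))"
proof (cases "r \<in> T")
  case True
  then show ?thesis using T by (simp add: K.act_def lefschetz_alt)
next
  case False
  have c': "c S \<in> carrier K" if "S \<in> Y" for S using c that by (rule PiE_mem)
  have ins: "insert r (T - pr j) \<in> Y" for j using T by auto
  have "K.act Y Y lefschetz c T = (\<Oplus>S\<in>Y. [(\<Sum>j\<in>full T. delta S (insert r (T - pr j)))] \<cdot> c S)"
    using T False by (simp add: K.act_def lefschetz_alt)
  also have "\<dots> = (\<Oplus>S\<in>Y. \<Oplus>j\<in>full T. [(delta S (insert r (T - pr j)))] \<cdot> c S)"
    by (rule K.finsum_cong'[OF refl]) (use c' in \<open>auto simp: K.int_mult_sum_left intro!: K.finsum_closed\<close>)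
  also have "\<dots> = (\<Oplus>j\<in>full T. \<Oplus>S\<in>Y. [(delta S (insert r (T - pr j)))] \<cdot> c S)"
    by (rule K.finsum_commute) (use c' in auto)
  also have "\<dots> = (\<Oplus>j\<in>full T. c (insert r (T - pr j)))"
  proof (rule K.finsum_cong'[OF refl])
    fix j
    have "(\<Oplus>S\<in>Y. [(delta S (insert r (T - pr j)))] \<cdot> c S)
      = [(delta (insert r (T - pr j)) (insert r (T - pr j)))] \<cdot> c (insert r (T - pr j))"
      by (rule K.finsum_single) (use c' ins in \<open>auto simp: delta_def\<close>)
    then show "(\<Oplus>S\<in>Y. [(delta S (insert r (T - pr j)))] \<cdot> c S) = c (insert r (T - pr j))"
      using c'[OF ins] by (simp add: delta_def)
  qed (use c' ins in auto)
  finally show ?thesis using False by simp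
qed

text \<open>The two parts of the image live in different degrees: the equations at sets with at most five elements
below 8 involve the \<open>low\<close> part only and determine it, and after that the \<open>high\<close> part can be read off.\<close>
lemma lefschetz_lift_injective:
  assumes \<theta>: "\<And>c S. S \<in> Y \<Longrightarrow> lefschetz (\<theta> c) S =
       lefschetz (\<lambda>S. if S \<in> low then c S else 0) S + (if S \<in> high then 2 * c S else 0)"
    and c: "c \<in> low \<union> high \<rightarrow>\<^sub>E carrier K"
    and zero: "\<And>S. S \<in> Y \<Longrightarrow> K.act (low \<union> high) Y (\<lambda>c. lefschetz (\<theta> c)) c S = \<zero>"
    and S: "S \<in> low \<union> high"
  shows "c S = \<zero>"
proof -
  let ?Z = "low \<union> high"
  let ?f1 = "\<lambda>(c :: _ \<Rightarrow> int) S. if S \<in> low then 1 * c S else 0"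
  let ?f2 = "\<lambda>(c :: _ \<Rightarrow> int) S. if S \<in> high then 2 * c S else 0"
  have fin: "finite ?Z" "finite Y" by (simp_all add: finite_low finite_high)
  have ZY: "low \<subseteq> Y" "high \<subseteq> Y" by (auto simp: low_def high_def)
  have c': "c T \<in> carrier K" if "T \<in> ?Z" for T using c that by (rule PiE_mem)
  define d0 where "d0 = K.act ?Z Y ?f1 c"
  have d0_closed: "d0 \<in> Y \<rightarrow>\<^sub>E carrier K" unfolding d0_def by (rule K.act_closed[OF c])
  define d where "d = (\<lambda>S. if S \<in> low then c S else \<zero>)"
  have d_closed: "d T \<in> carrier K" for T using c' by (simp add: d_def)
  have d0: "d0 T = d T" if "T \<in> Y" for T
    unfolding d0_def d_def K.act_select[OF fin(1) c that Un_upper1] using c' by simp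
  have f1: "int_linear ?Z Y ?f1" by (rule int_linearI) (auto simp: algebra_simps)
  have split: "K.act Y Y lefschetz d0 T \<oplus> (if T \<in> high then c T \<oplus> c T else \<zero>) = \<zero>"
    if T: "T \<in> Y" for T
  proof -
    have "K.act ?Z Y (\<lambda>c. lefschetz (\<theta> c)) c = K.act ?Z Y (\<lambda>c S. lefschetz (?f1 c) S + ?f2 c S) c"
      by (rule K.act_cong[OF _ c]) (simp add: \<theta> cong: if_cong)
    then have "K.act ?Z Y (\<lambda>c. lefschetz (\<theta> c)) c T
        = K.act ?Z Y (\<lambda>c. lefschetz (?f1 c)) c T \<oplus> K.act ?Z Y ?f2 c T"
      by (simp only: K.act_plus[OF c T])
    then have "\<zero> = K.act ?Z Y (\<lambda>c. lefschetz (?f1 c)) c T \<oplus> K.act ?Z Y ?f2 c T"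
      by (simp only: zero[OF T])
    also have "K.act ?Z Y (\<lambda>c. lefschetz (?f1 c)) c = K.act Y Y lefschetz d0"
      unfolding d0_def by (rule K.act_comp[OF fin int_linear_lefschetz c, symmetric])
    also have "K.act ?Z Y ?f2 c T = (if T \<in> high then c T \<oplus> c T else \<zero>)"
      unfolding K.act_select[OF fin(1) c T Un_upper2]
      using c'[of T] K.add.int_pow_mult[of "c T" 1 1] by auto
    finally show ?thesis by simp
  qed
  have d_zero: "d T = \<zero>" for T
  proof (rule K.lefschetz_low_injective[where r = r])
    fix T assume T: "T \<subseteq> {..<r}" "card (T \<inter> {..<8}) \<le> 5"
    then have TY: "T \<in> Y" "r \<notin> T" "T \<notin> high" by (auto simp: high_def)
    have "(\<Oplus>j\<in>full T. d (insert r (T - pr j))) = (\<Oplus>j\<in>full T. d0 (insert r (T - pr j)))"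
    proof (rule K.finsum_cong'[OF refl])
      have ins: "insert r (T - pr j) \<in> Y" for j using TY(1) by auto
      show "(\<lambda>j. d0 (insert r (T - pr j))) \<in> full T \<rightarrow> carrier K"
        using d0[OF ins] d_closed by simp
      show "d (insert r (T - pr j)) = d0 (insert r (T - pr j))" for j
        using d0[OF ins] by simp
    qed
    also have "\<dots> = K.act Y Y lefschetz d0 T"
      using act_lefschetz[OF d0_closed TY(1)] TY(2) by simp
    also have "\<dots> = \<zero>"
      using split[OF TY(1)] TY(3) PiE_mem[OF K.act_closed[OF d0_closed] TY(1)] by simp
    finally show "(\<Oplus>j\<in>full T. d (insert r (T - pr j))) = \<zero>" .
  next
    show "r \<in> T \<and> T \<subseteq> {..r} \<and> card (T \<inter> {..<8}) \<le> 3" if "d T \<noteq> \<zero>" for T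
      using that by (auto simp: d_def low_def split: if_splits)
  qed (fact d_closed r_ge two_cancel)+
  show ?thesis
  proof (cases "S \<in> low")
    case True
    then show ?thesis using d_zero[of S] by (simp add: d_def)
  next
    case False
    with S have Sh: "S \<in> high" "S \<in> Y" "r \<notin> S" using ZY by (auto simp: high_def)
    have "d0 (insert r (S - pr j)) = \<zero>" for j
      using d0[of "insert r (S - pr j)"] d_zero Sh(2) by auto
    then have "K.act Y Y lefschetz d0 S = \<zero>"
      unfolding act_lefschetz[OF d0_closed Sh(2)] using Sh(3) by simp
    with split[OF Sh(2)] Sh(1) c'[OF S] have "c S \<oplus> c S = \<zero>" by simp
    then show ?thesis using two_cancel c'[OF S] by blast
  qed
qed

end

section \<open>The homology of the mapping cone\<close>
lemma (in cone_operators) elementary_abelian_exponents: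
  assumes "elementary_abelian p r E"
  shows "comm_group E" and "finite (carrier E)"
    and "\<exists>\<kappa>. bij_betw \<kappa> (carrier E) exps \<and>
           (\<forall>x\<in>carrier E. \<forall>y\<in>carrier E. \<kappa> (x \<otimes>\<^bsub>E\<^esub> y) = translate (\<kappa> x) (\<kappa> y))"
proof -
  let ?G = "product_group {..<r} (\<lambda>_. integer_mod_group p)"
  interpret E: group E using assms by (simp add: elementary_abelian_def)
  obtain \<phi> where "\<phi> \<in> iso E ?G" using assms by (auto simp: elementary_abelian_def is_iso_def)
  then have bij: "bij_betw \<phi> (carrier E) (carrier ?G)"
    and hom: "\<And>x y. x \<in> carrier E \<Longrightarrow> y \<in> carrier E \<Longrightarrow> \<phi> (x \<otimes>\<^bsub>E\<^esub> y) = \<phi> x \<otimes>\<^bsub>?G\<^esub> \<phi> y"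
    by (auto simp: iso_def hom_def)
  have carr: "carrier ?G = {..<r} \<rightarrow>\<^sub>E {0..<int p}"
    using p_pos by (simp add: carrier_integer_mod_group)
  have mult: "(f \<otimes>\<^bsub>?G\<^esub> g) i = (f i + g i) mod int p" if "i < r" for f g i
    using p_pos that by (simp add: mult_integer_mod_group)
  show "comm_group E"
  proof (rule E.group_comm_groupI)
    fix x y assume xy: "x \<in> carrier E" "y \<in> carrier E"
    have "\<phi> (x \<otimes>\<^bsub>E\<^esub> y) = \<phi> (y \<otimes>\<^bsub>E\<^esub> x)"
      unfolding hom[OF xy] hom[OF xy(2,1)] using p_pos
      by (auto simp: mult_integer_mod_group add.commute)
    with bij xy show "x \<otimes>\<^bsub>E\<^esub> y = y \<otimes>\<^bsub>E\<^esub> x"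
      by (auto simp: bij_betw_def dest: inj_onD)
  qed
  have "finite (carrier ?G)" unfolding carr by (intro finite_PiE) auto
  then show "finite (carrier E)" using bij bij_betw_finite by blast
  let ?n = "\<lambda>f i. if i < r then nat (f i) else 0"
  have "bij_betw ?n (carrier ?G) exps"
  proof (rule bij_betw_byWitness[of _ "\<lambda>\<alpha>. \<lambda>i\<in>{..<r}. int (\<alpha> i)"])
    show "\<forall>f\<in>carrier ?G. (\<lambda>i\<in>{..<r}. int (?n f i)) = f"
    proof
      fix f assume f: "f \<in> carrier ?G"
      show "(\<lambda>i\<in>{..<r}. int (?n f i)) = f"
      proof
        fix i show "(\<lambda>i\<in>{..<r}. int (?n f i)) i = f i"
          using PiE_mem[OF f[unfolded carr], of i] PiE_arb[OF f[unfolded carr], of i]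
          by (cases "i < r") simp_all
      qed
    qed
    show "\<forall>\<alpha>\<in>exps. ?n (\<lambda>i\<in>{..<r}. int (\<alpha> i)) = \<alpha>"
      by (auto simp: exps_def fun_eq_iff)
    show "?n ` carrier ?G \<subseteq> exps"
    proof (rule image_subsetI)
      fix f assume f: "f \<in> carrier ?G"
      have "nat (f i) < p" if "i < r" for i
        using PiE_mem[OF f[unfolded carr], of i] that by (simp add: nat_less_iff)
      then show "?n f \<in> exps" by (simp add: exps_def)
    qed
    show "(\<lambda>\<alpha>. \<lambda>i\<in>{..<r}. int (\<alpha> i)) ` exps \<subseteq> carrier ?G"
      unfolding carr by (rule image_subsetI) (auto simp: exps_def)
  qed
  from bij_betw_trans[OF bij this] have 1: "bij_betw (?n \<circ> \<phi>) (carrier E) exps" .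
  have 2: "(?n \<circ> \<phi>) (x \<otimes>\<^bsub>E\<^esub> y) = translate ((?n \<circ> \<phi>) x) ((?n \<circ> \<phi>) y)"
    if xy: "x \<in> carrier E" "y \<in> carrier E" for x y
  proof
    fix i
    show "(?n \<circ> \<phi>) (x \<otimes>\<^bsub>E\<^esub> y) i = translate ((?n \<circ> \<phi>) x) ((?n \<circ> \<phi>) y) i"
    proof (cases "i < r")
      case True
      have "\<phi> x \<in> carrier ?G" "\<phi> y \<in> carrier ?G" using bij xy by (auto simp: bij_betw_def)
      then have "\<phi> x i \<in> {0..<int p}" "\<phi> y i \<in> {0..<int p}"
        using True unfolding carr by (blast intro: PiE_mem)+
      then have "0 \<le> \<phi> x i" "0 \<le> \<phi> y i" by simp_all
      then show ?thesis using True
        by (simp add: hom[OF xy] mult[OF True] translate_def nat_mod_distrib nat_add_distrib del: mult_product_group)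
    qed (simp add: translate_def)
  qed
  from 1 2 show "\<exists>\<kappa>. bij_betw \<kappa> (carrier E) exps \<and>
           (\<forall>x\<in>carrier E. \<forall>y\<in>carrier E. \<kappa> (x \<otimes>\<^bsub>E\<^esub> y) = translate (\<kappa> x) (\<kappa> y))" by blast
qed

lemma (in field) dim_func_space:
  assumes "finite X"
  shows "vectorspace.fin_dim R (func_space X)" and "vectorspace.dim R (func_space X) = card X"
    and "vectorspace R (func_space X)"
proof -
  show vs: "vectorspace R (func_space X)"
    by (intro vectorspace.intro func_space_is_module field_axioms)
  interpret V: vectorspace R "func_space X" by (rule vs)
  have b: "finite (unit_fun X ` X) \<and> V.basis (unit_fun X ` X)"
    using finite_basis_func_space[OF assms one_not_zero] by (simp add: V.basis_iff_finite_basis)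
  then show "V.fin_dim" unfolding V.fin_dim_def V.basis_def by blast
  have "V.dim = card (unit_fun X ` X)" using V.dim_basis b by blast
  then show "V.dim = card X" using card_image[OF inj_unit_fun[OF one_not_zero]] by simp
qed

lemma (in cone_operators) translate_inj:
  assumes "\<gamma> \<in> exps" "\<alpha> \<in> exps" "\<beta> \<in> exps" "translate \<gamma> \<alpha> = translate \<gamma> \<beta>"
  shows "\<alpha> = \<beta>"
proof
  fix i
  show "\<alpha> i = \<beta> i"
  proof (cases "i < r")
    case True
    have "(\<gamma> i + \<alpha> i) mod p = (\<gamma> i + \<beta> i) mod p"
      using fun_cong[OF assms(4), of i] by (simp add: translate_def)
    then have "(int (\<gamma> i) + int (\<alpha> i)) mod int p = (int (\<gamma> i) + int (\<beta> i)) mod int p"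
      by (metis of_nat_add of_nat_mod)
    from mod_diff_cong[OF this refl, of "int (\<gamma> i)"] have "\<alpha> i mod p = \<beta> i mod p"
      by (simp flip: of_nat_mod)
    with True assms(2,3) show ?thesis by (simp add: exps_def)
  qed (use assms in \<open>auto simp: exps_def\<close>)
qed

context cone_over_field
begin

lemma cone_equivariant_complex:
  assumes E: "comm_group E" "finite (carrier E)"
    and bij: "bij_betw \<kappa> (carrier E) exps"
    and hom: "\<And>x y. x \<in> carrier E \<Longrightarrow> y \<in> carrier E \<Longrightarrow> \<kappa> (x \<otimes>\<^bsub>E\<^esub> y) = translate (\<kappa> x) (\<kappa> y)"
  shows "equivariant_complex K E Y deg set_encode exps \<kappa> cone_d"
proof -
  interpret E: comm_group E by (rule E(1))
  have \<kappa>: "\<kappa> x \<in> exps" if "x \<in> carrier E" for x using bij that by (auto simp: bij_betw_def)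
  show ?thesis
  proof (intro equivariant_complex.intro finite_group_algebra.intro finite_group_algebra_axioms.intro
      equivariant_complex_axioms.intro)
    show "inj_on set_encode Y"
      by (rule inj_on_subset[OF inj_on_set_encode]) (auto intro: finite_subset)
    show "int_linear (Y \<times> exps) (Y \<times> exps) cone_d" using int_linear_cone_d by (simp add: idx_def)
    show "cone_d (cone_d u) w = 0" if "w \<in> Y \<times> exps" for u w using cone_d_square that by (simp add: idx_def)
    show "cone_d (delta (b, \<alpha>)) (b', \<alpha>') = 0"
      if "b \<in> Y" "b' \<in> Y" "\<alpha> \<in> exps" "\<alpha>' \<in> exps" "deg b' \<noteq> deg b - 1" for b b' \<alpha> \<alpha>'
      by (rule cone_d_degree[of "deg b"]) (use that in \<open>auto simp: delta_def idx_def\<close>)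
    show "cone_d (delta (b, \<kappa> (z \<otimes>\<^bsub>E\<^esub> y))) (b', \<kappa> (z \<otimes>\<^bsub>E\<^esub> x)) = cone_d (delta (b, \<kappa> y)) (b', \<kappa> x)"
      if "b \<in> Y" "b' \<in> Y" "x \<in> carrier E" "y \<in> carrier E" "z \<in> carrier E" for b b' x y z
    proof -
      have "cone_d (delta (b, \<kappa> (z \<otimes>\<^bsub>E\<^esub> y))) (b', \<kappa> (z \<otimes>\<^bsub>E\<^esub> x))
          = cone_d (\<lambda>(S, \<alpha>). delta (b, translate (\<kappa> z) (\<kappa> y)) (S, translate (\<kappa> z) \<alpha>)) (b', \<kappa> x)"
        using that by (simp add: hom cone_d_translate)
      also have "\<dots> = cone_d (delta (b, \<kappa> y)) (b', \<kappa> x)"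
      proof (rule int_linear_cong[OF int_linear_cone_d])
        fix w assume "w \<in> idx"
        then obtain S \<alpha> where w: "w = (S, \<alpha>)" "\<alpha> \<in> exps" by (auto simp: idx_def)
        then show "(case w of (S, \<alpha>) \<Rightarrow> delta (b, translate (\<kappa> z) (\<kappa> y)) (S, translate (\<kappa> z) \<alpha>)) = delta (b, \<kappa> y) w"
          using translate_inj[of "\<kappa> z" \<alpha> "\<kappa> y"] \<kappa> that by (auto simp: delta_def)
      qed (use that \<kappa> in \<open>simp add: idx_def\<close>)
      finally show ?thesis .
    qed
  qed (use E bij K.field_axioms in auto)
qed

text \<open>The homotopy equivalence of \<open>emb_retr\<close> makes the total homology a quotient of the kernel of \<open>w\<close> on two
copies of the exterior algebra by a subspace containing the image, to which \<open>dim_subquotient_le\<close> applies.\<close>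
lemma exists_small_complex:
  assumes E: "comm_group E" "finite (carrier E)"
    and bij: "bij_betw \<kappa> (carrier E) exps"
    and hom: "\<And>x y. x \<in> carrier E \<Longrightarrow> y \<in> carrier E \<Longrightarrow> \<kappa> (x \<otimes>\<^bsub>E\<^esub> y) = translate (\<kappa> x) (\<kappa> y)"
  shows "\<exists>(F :: int \<Rightarrow> ('e \<Rightarrow> 'k, nat \<Rightarrow> 'e \<Rightarrow> 'k) module) d.
           bounded_free_complex (group_algebra K E) F d \<and>
           carrier (total_homology F d) \<noteq> {\<zero>\<^bsub>total_homology F d\<^esub>} \<and>
           rank_over K (restrict_scalars (group_algebra_scalar K E) (total_homology F d)) < 2 ^ r"
proof -
  interpret C: equivariant_complex K E Y deg set_encode exps \<kappa> cone_d
    by (rule cone_equivariant_complex[OF assms])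
  let ?V = "K.func_space Y" and ?N = "{c \<in> carrier (K.func_space Y). K.act Y Y lefschetz c = \<zero>\<^bsub>K.func_space Y\<^esub>}"
  have finY: "finite Y" by simp
  have X: "C.X = idx" by (simp add: idx_def)
  have Vidx: "C.V = K.func_space idx" by (simp add: C.V_def X)
  have DV: "C.DV = K.act idx idx cone_d" by (simp add: C.DV_def X)
  define \<iota> where "\<iota> = K.act Y idx emb"
  define W where "W = K.act Y Y lefschetz"
  have car: "carrier ?V = Y \<rightarrow>\<^sub>E carrier K" "carrier C.V = idx \<rightarrow>\<^sub>E carrier K"
    by (simp_all only: Vidx K.func_space_simps)
  have mh\<iota>: "mod_hom K ?V C.V \<iota>" unfolding Vidx \<iota>_def by (rule K.act_mod_hom[OF finY])
  have mhW: "mod_hom K ?V ?V W" unfolding W_def by (rule K.act_mod_hom[OF finY])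
  interpret \<iota>: mod_hom K ?V C.V \<iota> by (rule mh\<iota>)
  interpret W: mod_hom K ?V ?V W by (rule mhW)
  note VY = K.dim_func_space[OF finY]
  have W_linear: "linear_map K ?V ?V W"
    using VY(3) mhW by (simp add: linear_map_def)
  have W_closed: "W c \<in> carrier ?V" if "c \<in> carrier ?V" for c using that by (rule W.f_im)
  have \<iota>_closed: "\<iota> c \<in> carrier C.V" if "c \<in> carrier ?V" for c using that by (rule \<iota>.f_im)
  have D\<iota>: "C.DV (\<iota> c) = \<iota> (W c)" if "c \<in> carrier ?V" for c
  proof -
    have c: "c \<in> Y \<rightarrow>\<^sub>E carrier K" using that by (simp only: car)
    have "C.DV (\<iota> c) = K.act Y idx (\<lambda>u. cone_d (emb u)) c"
      unfolding DV \<iota>_def by (rule K.act_comp[OF finY finite_idx int_linear_cone_d c])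
    also have "\<dots> = K.act Y idx (\<lambda>u. emb (lefschetz u)) c"
      by (rule K.act_cong[OF _ c]) (rule cone_d_emb)
    also have "\<dots> = \<iota> (W c)"
      unfolding W_def \<iota>_def by (rule K.act_comp[OF finY finY int_linear_emb c, symmetric])
    finally show ?thesis .
  qed
  have \<iota>_ev: "K.act idx Y (\<lambda>u S. u (S, \<lambda>_. 0)) (\<iota> c) = c" if "c \<in> carrier ?V" for c
  proof -
    have c: "c \<in> Y \<rightarrow>\<^sub>E carrier K" using that by (simp only: car)
    have "int_linear idx Y (\<lambda>(u :: _ \<Rightarrow> int) S. u (S, \<lambda>_. 0))"
      by (rule int_linearI) (auto simp: idx_def zero_exps)
    then have "K.act idx Y (\<lambda>u S. u (S, \<lambda>_. 0)) (\<iota> c) = K.act Y Y (\<lambda>u S. emb u (S, \<lambda>_. 0)) c"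
      unfolding \<iota>_def by (rule K.act_comp[OF finY finite_idx _ c])
    also have "\<dots> = K.act Y Y (\<lambda>u. u) c"
      by (rule K.act_cong[OF _ c]) (simp add: emb_def)
    also have "\<dots> = c" by (rule K.act_id[OF finY c])
    finally show ?thesis .
  qed
  have \<iota>_inj: "c = c'" if "c \<in> carrier ?V" "c' \<in> carrier ?V" "\<iota> c = \<iota> c'" for c c'
    using HOL.trans[OF \<iota>_ev[OF that(1), symmetric, unfolded that(3)] \<iota>_ev[OF that(2)]] .
  have N: "?N = {c \<in> carrier ?V. W c = \<zero>\<^bsub>?V\<^esub>}" by (simp only: W_def)
  have \<iota>_cycle: "\<iota> c \<in> C.ZV" if "c \<in> ?N" for c
    using that D\<iota>[of c] by (simp add: N C.ZV_def \<iota>_closed)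
  let ?L = "\<lambda>c. C.hclass (\<iota> c)"
  interpret hc: linear_map K "C.V\<lparr>carrier := C.ZV\<rparr>" C.H C.hclass by (rule C.hclass_linear)
  have N_sub: "VectorSpace.subspace K ?N ?V"
    using linear_map.kerT_is_subspace[OF W_linear] unfolding N W.ker_def .
  have N_vs: "vectorspace K (?V\<lparr>carrier := ?N\<rparr>)"
    by (rule vectorspace.subspace_is_vs[OF VY(3) N_sub])
  have L_linear: "linear_map K (?V\<lparr>carrier := ?N\<rparr>) C.H ?L"
  proof -
    have "?L \<in> LinearCombinations.module_hom K (?V\<lparr>carrier := ?N\<rparr>) C.H"
      unfolding LinearCombinations.module_hom_def
    proof (rule CollectI, intro conjI allI impI)
      show "?L \<in> carrier (?V\<lparr>carrier := ?N\<rparr>) \<rightarrow> carrier C.H"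
        using \<iota>_cycle C.hclass_onto by auto
      fix c c' assume "c \<in> carrier (?V\<lparr>carrier := ?N\<rparr>) \<and> c' \<in> carrier (?V\<lparr>carrier := ?N\<rparr>)"
      then have cc: "c \<in> ?N" "c' \<in> ?N" "c \<in> carrier ?V" "c' \<in> carrier ?V" by simp_all
      have "\<iota> (c \<oplus>\<^bsub>?V\<^esub> c') = \<iota> c \<oplus>\<^bsub>C.V\<^esub> \<iota> c'" using cc by (intro \<iota>.f_add)
      then show "?L (c \<oplus>\<^bsub>?V\<lparr>carrier := ?N\<rparr>\<^esub> c') = ?L c \<oplus>\<^bsub>C.H\<^esub> ?L c'"
        using C.hclass_add[OF \<iota>_cycle[OF cc(1)] \<iota>_cycle[OF cc(2)]] by simp
    next
      fix a c assume "a \<in> carrier K \<and> c \<in> carrier (?V\<lparr>carrier := ?N\<rparr>)"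
      then have ac: "a \<in> carrier K" "c \<in> ?N" "c \<in> carrier ?V" by simp_all
      have "\<iota> (a \<odot>\<^bsub>?V\<^esub> c) = a \<odot>\<^bsub>C.V\<^esub> \<iota> c" using ac by (intro \<iota>.f_smult)
      then show "?L (a \<odot>\<^bsub>?V\<lparr>carrier := ?N\<rparr>\<^esub> c) = a \<odot>\<^bsub>C.H\<^esub> ?L c"
        using C.hclass_smult[OF ac(1) \<iota>_cycle[OF ac(2)]] by simp
    qed
    then show ?thesis
      using N_vs hc.W.vectorspace_axioms
      by (simp add: linear_map_def mod_hom_def mod_hom_axioms_def vectorspace_def)
  qed
  have L_onto: "?L ` ?N = carrier C.H"
  proof (intro equalityI subsetI)
    fix h assume "h \<in> ?L ` ?N"
    then show "h \<in> carrier C.H" using \<iota>_cycle C.hclass_onto by auto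
  next
    fix h assume "h \<in> carrier C.H"
    then obtain z where z: "z \<in> C.ZV" "h = C.hclass z" using C.hclass_onto by auto
    then have zV: "z \<in> carrier C.V" "C.DV z = \<zero>\<^bsub>C.V\<^esub>" by (simp_all add: C.ZV_def)
    then have z': "z \<in> idx \<rightarrow>\<^sub>E carrier K" by (simp only: car)
    define c where "c = K.act idx Y retr z"
    define w where "w = K.act idx idx (homotopy r) z"
    have c: "c \<in> carrier ?V" unfolding c_def car by (rule K.act_closed[OF z'])
    have w: "w \<in> carrier C.V" unfolding w_def car by (rule K.act_closed[OF z'])
    have hD: "K.act idx idx (\<lambda>u. homotopy r (cone_d u)) z = \<zero>\<^bsub>C.V\<^esub>"
    proof -
      have "K.act idx idx (\<lambda>u. homotopy r (cone_d u)) z = K.act idx idx (homotopy r) (C.DV z)"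
        unfolding DV by (rule K.act_comp[OF finite_idx finite_idx int_linear_homotopy z', symmetric]) simp
      also have "\<dots> = \<zero>\<^bsub>C.V\<^esub>"
        unfolding zV(2) Vidx by (rule mod_hom.f0_is_0[OF K.act_mod_hom[OF finite_idx]])
      finally show ?thesis .
    qed
    \<comment> \<open>The cycle \<open>z\<close> is homologous to a cycle in the image of \<open>\<iota>\<close>: this is \<open>emb_retr\<close>, where the last term
    vanishes on cycles.\<close>
    have decomp: "z = \<iota> c \<oplus>\<^bsub>C.V\<^esub> C.DV w"
    proof (rule PiE_ext[OF z'])
      show "\<iota> c \<oplus>\<^bsub>C.V\<^esub> C.DV w \<in> idx \<rightarrow>\<^sub>E carrier K"
        unfolding car(2)[symmetric] using \<iota>_closed[OF c] C.DV_closed[OF w]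
        by (rule abelian_monoid.a_closed[OF abelian_group.axioms(1)[OF module.axioms(2)[OF C.V_module]]])
      fix y assume y: "y \<in> idx"
      have "z y = K.act idx idx (\<lambda>u. u) z y" by (simp only: K.act_id[OF finite_idx z'])
      also have "\<dots> = K.act idx idx (\<lambda>u x. emb (retr u) x + (cone_d (homotopy r u) x + homotopy r (cone_d u) x)) z y"
        by (rule fun_cong, rule K.act_cong[OF _ z']) (simp add: emb_retr)
      also have "\<dots> = K.act idx idx (\<lambda>u. emb (retr u)) z y \<oplus>
          (K.act idx idx (\<lambda>u. cone_d (homotopy r u)) z y \<oplus> K.act idx idx (\<lambda>u. homotopy r (cone_d u)) z y)"
        by (simp only: K.act_plus[OF z' y])
      also have "K.act idx idx (\<lambda>u. emb (retr u)) z = \<iota> c"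
        unfolding \<iota>_def c_def by (rule K.act_comp[OF finite_idx finY int_linear_emb z', symmetric])
      also have "K.act idx idx (\<lambda>u. cone_d (homotopy r u)) z = C.DV w"
        unfolding DV w_def by (rule K.act_comp[OF finite_idx finite_idx int_linear_cone_d z', symmetric])
      also have "K.act idx idx (\<lambda>u. homotopy r (cone_d u)) z y = \<zero>"
        unfolding hD by (rule C.V_simps(3)) (use y X in simp)
      also have "\<iota> c y \<oplus> (C.DV w y \<oplus> \<zero>) = (\<iota> c \<oplus>\<^bsub>C.V\<^esub> C.DV w) y"
        using C.V_simps(1)[of y "\<iota> c" "C.DV w"] y PiE_mem[OF C.DV_closed[OF w, unfolded car] y] X by simp
      finally show "z y = (\<iota> c \<oplus>\<^bsub>C.V\<^esub> C.DV w) y" .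
    qed
    interpret V: Module.module K C.V by (rule C.V_module)
    have "abelian_monoid C.H"
      by (rule abelian_group.axioms(1)[OF module.axioms(2)[OF vectorspace.axioms(1)[OF hc.W.vectorspace_axioms]]])
    note H_r_zero = abelian_monoid.r_zero[OF this]
    have "\<zero>\<^bsub>C.V\<^esub> = C.DV (\<iota> c) \<oplus>\<^bsub>C.V\<^esub> C.DV (C.DV w)"
      using zV(2) decomp C.DV_add[OF \<iota>_closed[OF c] C.DV_closed[OF w]] by simp
    then have "\<iota> (W c) = \<iota> \<zero>\<^bsub>?V\<^esub>"
      using C.DV_DV[OF w] D\<iota>[OF c] \<iota>_closed[OF W_closed[OF c]] by simp
    then have "W c = \<zero>\<^bsub>?V\<^esub>" by (rule \<iota>_inj[OF W_closed[OF c] \<iota>.M.M.zero_closed])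
    then have cN: "c \<in> ?N" using c by (simp add: N)
    have "C.DV w \<in> C.ZV" using w by (simp add: C.ZV_def C.DV_closed C.DV_DV)
    moreover from this have "C.hclass (C.DV w) = \<zero>\<^bsub>C.H\<^esub>" using w C.hclass_zero_iff by blast
    ultimately have "h = ?L c \<oplus>\<^bsub>C.H\<^esub> \<zero>\<^bsub>C.H\<^esub>"
      using z(2) decomp C.hclass_add[OF \<iota>_cycle[OF cN], of "C.DV w"] by simp
    moreover have "?L c \<in> carrier C.H" using \<iota>_cycle[OF cN] C.hclass_onto by blast
    ultimately have "h = ?L c" by (simp add: H_r_zero)
    with cN show "h \<in> ?L ` ?N" by blast
  qed
  have WW: "W (W c) = \<zero>\<^bsub>?V\<^esub>" if "c \<in> carrier ?V" for c
  proof -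
    have "\<iota> (W (W c)) = \<iota> \<zero>\<^bsub>?V\<^esub>"
      using D\<iota>[OF W_closed[OF that]] D\<iota>[OF that] C.DV_DV[OF \<iota>_closed[OF that]] by simp
    then show ?thesis by (rule \<iota>_inj[OF W_closed[OF W_closed[OF that]] \<iota>.M.M.zero_closed])
  qed
  have LW: "?L (W c) = \<zero>\<^bsub>C.H\<^esub>" if "c \<in> carrier ?V" for c
  proof -
    have "W c \<in> ?N" using WW[OF that] W_closed[OF that] by (simp add: N)
    then have "\<iota> (W c) \<in> C.ZV" by (rule \<iota>_cycle)
    moreover have "\<iota> (W c) \<in> C.DV ` carrier C.V"
      using D\<iota>[OF that] \<iota>_closed[OF that] by (metis imageI)
    ultimately show ?thesis by (simp add: C.hclass_zero_iff)
  qed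
  obtain \<theta> where \<theta>: "int_linear (low \<union> high) Y \<theta>" "\<And>c S. S \<in> Y \<Longrightarrow> lefschetz (\<theta> c) S =
       lefschetz (\<lambda>S. if S \<in> low then c S else 0) S + (if S \<in> high then 2 * c S else 0)"
    using lefschetz_lift by blast
  have finZ: "finite (low \<union> high)" by (simp add: finite_low finite_high)
  note U = K.dim_func_space[OF finZ]
  let ?U = "K.func_space (low \<union> high)" and ?\<psi> = "K.act (low \<union> high) Y (\<lambda>c. lefschetz (\<theta> c))"
  have \<psi>_linear: "linear_map K ?U ?V ?\<psi>"
    using U(3) VY(3) K.act_mod_hom[OF finZ] by (simp add: linear_map_def)
  interpret \<psi>: linear_map K ?U ?V ?\<psi> by (rule \<psi>_linear)
  have \<psi>_inj: "inj_on ?\<psi> (carrier ?U)"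
  proof (rule \<psi>.Ke0_imp_inj)
    show "carrier (?U\<lparr>carrier := \<psi>.ker\<rparr>) = {\<zero>\<^bsub>?U\<^esub>}"
    proof (intro equalityI subsetI)
      fix c assume "c \<in> carrier (?U\<lparr>carrier := \<psi>.ker\<rparr>)"
      then have c: "c \<in> low \<union> high \<rightarrow>\<^sub>E carrier K" "?\<psi> c = \<zero>\<^bsub>?V\<^esub>"
        by (simp_all add: \<psi>.ker_def K.func_space_simps(1))
      have z: "?\<psi> c S = \<zero>" if "S \<in> Y" for S
        unfolding c(2) using that by (simp add: K.func_space_simps(4))
      have "c S = \<zero>" if S: "S \<in> low \<union> high" for S
        by (rule lefschetz_lift_injective[where \<theta> = \<theta>]) (fact \<theta>(2) c(1) z S)+
      then have "c = (\<lambda>S\<in>low \<union> high. \<zero>)"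
        by (intro PiE_ext[OF c(1)]) simp_all
      then have "c = \<zero>\<^bsub>?U\<^esub>" by (simp only: K.func_space_simps(4))
      then show "c \<in> {\<zero>\<^bsub>?U\<^esub>}" by simp
    qed (simp add: \<psi>.ker_def)
  qed
  have \<psi>_im: "?\<psi> ` carrier ?U \<subseteq> W ` carrier ?V"
  proof (rule image_subsetI)
    fix c assume "c \<in> carrier ?U"
    then have c: "c \<in> low \<union> high \<rightarrow>\<^sub>E carrier K" by (simp only: K.func_space_simps)
    have "?\<psi> c = W (K.act (low \<union> high) Y \<theta> c)"
      unfolding W_def by (rule K.act_comp[OF finZ finY int_linear_lefschetz c, symmetric])
    moreover have "K.act (low \<union> high) Y \<theta> c \<in> carrier ?V" unfolding car by (rule K.act_closed[OF c])
    ultimately show "?\<psi> c \<in> W ` carrier ?V" by blast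
  qed
  have fdH: "hc.W.fin_dim" and "hc.W.dim + 2 * vectorspace.dim K ?U \<le> vectorspace.dim K ?V"
    using dim_subquotient_le[where K = K and V = ?V and W = W and H = C.H and L = ?L and U = ?U and \<psi> = ?\<psi>,
        OF W_linear VY(1) L_linear[unfolded N] L_onto[unfolded N] WW LW \<psi>_linear U(1) \<psi>_inj \<psi>_im]
    by blast+
  then have "hc.W.dim + 260 * 2 ^ (r - 8) \<le> 2 ^ (r + 1)"
    by (simp add: U(2) VY(2) card_low_high card_Pow)
  moreover have "(2::nat) ^ r = 256 * 2 ^ (r - 8)"
    using r_ge power_add[of "2::nat" 8 "r - 8"] by simp
  moreover have "(0::nat) < 2 ^ (r - 8)" by simp
  ultimately have dimH: "hc.W.dim < 2 ^ r" unfolding power_add power_one_right by linarith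
  have "rank_over K C.H = enat hc.W.dim" by (rule hc.W.rank_over_eq_dim[OF fdH])
  also have "\<dots> < enat (2 ^ r)" using dimH by simp
  also have "enat (2 ^ r) = 2 ^ r" by (simp add: of_nat_eq_enat[symmetric])
  finally have rank: "rank_over K C.H < 2 ^ r" .
  have nonzero: "carrier (total_homology C.Fm C.dd) \<noteq> {\<zero>\<^bsub>total_homology C.Fm C.dd\<^esub>}"
  proof
    assume triv: "carrier (total_homology C.Fm C.dd) = {\<zero>\<^bsub>total_homology C.Fm C.dd\<^esub>}"
    define c where "c = K.unit_fun Y {}"
    have c': "c \<in> Y \<rightarrow>\<^sub>E carrier K" unfolding c_def by (rule K.unit_fun_closed)
    then have c: "c \<in> carrier ?V" by (simp only: car)
    have "W c = \<zero>\<^bsub>?V\<^esub>"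
    proof (rule PiE_ext)
      show "W c \<in> Y \<rightarrow>\<^sub>E carrier K" using W_closed[OF c] by (simp only: car)
      show "\<zero>\<^bsub>?V\<^esub> \<in> Y \<rightarrow>\<^sub>E carrier K" using \<iota>.M.M.zero_closed by (simp only: car)
      fix S assume S: "S \<in> Y"
      have "c (insert r (S - pr j)) = \<zero>" for j using S by (auto simp: c_def K.unit_fun_def)
      then show "W c S = \<zero>\<^bsub>?V\<^esub> S"
        unfolding W_def act_lefschetz[OF c' S] using S by (simp add: K.func_space_simps)
    qed
    then have "\<iota> c \<in> C.ZV" using c by (intro \<iota>_cycle) (simp add: N)
    moreover have "C.hclass (\<iota> c) = \<zero>\<^bsub>C.H\<^esub>"
      using triv C.hclass_onto \<open>\<iota> c \<in> C.ZV\<close> by (auto simp: restrict_scalars_def)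
    ultimately obtain v where v: "v \<in> carrier C.V" "\<iota> c = C.DV v" using C.hclass_zero_iff by blast
    have v': "v \<in> idx \<rightarrow>\<^sub>E carrier K" using v(1) by (simp only: car)
    \<comment> \<open>The class of \<open>1\<close> is detected by the augmentation, which kills boundaries.\<close>
    let ?aug = "\<lambda>(u :: chain) (_ :: unit). \<Sum>\<alpha>\<in>exps. u ({}, \<alpha>)"
    have aug: "int_linear idx UNIV ?aug"
    proof (rule int_linearI)
      fix u v :: chain and y :: unit
      assume "\<And>x. x \<in> idx \<Longrightarrow> u x = v x"
      then show "?aug u y = ?aug v y" by (intro sum.cong refl) (simp add: idx_def)
    qed (simp_all add: sum.distrib sum_distrib_left)
    have "K.act idx UNIV ?aug (C.DV v) = K.act idx UNIV (\<lambda>u. ?aug (cone_d u)) v"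
      unfolding DV by (rule K.act_comp[OF finite_idx finite_idx aug v'])
    then have 0: "K.act idx UNIV ?aug (C.DV v) () = \<zero>"
      by (simp add: K.act_def cone_d_augmentation)
    have emb_aug: "?aug (emb u) y = u {}" for u and y :: unit
    proof -
      have "emb u ({}, \<alpha>) = (if \<alpha> = (\<lambda>_. 0) then u {} else 0)" if "\<alpha> \<in> exps" for \<alpha>
      proof -
        have "(\<forall>i<r. \<alpha> i = 0) \<longleftrightarrow> \<alpha> = (\<lambda>_. 0)"
          using that unfolding exps_def fun_eq_iff by (metis (mono_tags, lifting) mem_Collect_eq not_less)
        then show ?thesis by (simp add: emb_def)
      qed
      then have "?aug (emb u) y = (\<Sum>\<alpha>\<in>exps. if \<alpha> = (\<lambda>_. 0) then u {} else 0)"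
        by (intro sum.cong refl)
      then show ?thesis by (simp add: finite_exps zero_exps)
    qed
    have "K.act idx UNIV ?aug (\<iota> c) = K.act Y UNIV (\<lambda>u. ?aug (emb u)) c"
      unfolding \<iota>_def by (rule K.act_comp[OF finY finite_idx aug c'])
    then have "K.act idx UNIV ?aug (\<iota> c) () = (\<Oplus>S\<in>Y. [(delta S {})] \<cdot> c S)"
      by (simp add: K.act_def emb_aug)
    also have "\<dots> = [(delta {} ({} :: nat set))] \<cdot> c {}"
      using c' by (intro K.finsum_single[where a = "{}" and f = "\<lambda>S. [(delta S {})] \<cdot> c S"])
        (auto simp: delta_def)
    also have "\<dots> = \<one>" by (simp add: delta_def c_def K.unit_fun_def)
    finally show False using 0 v(2) by simp
  qed
  show ?thesis using C.bounded_free_complex_Fm nonzero rank by blast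
qed

end

lemma ring_characteristic_two_cancel:
  assumes "field K" "ring_characteristic K = p" "prime p" "odd p"
    and a: "a \<in> carrier K" "a \<oplus>\<^bsub>K\<^esub> a = \<zero>\<^bsub>K\<^esub>"
  shows "a = \<zero>\<^bsub>K\<^esub>"
proof (rule ccontr)
  interpret K: field K by fact
  assume nz: "a \<noteq> \<zero>\<^bsub>K\<^esub>"
  have "a \<otimes>\<^bsub>K\<^esub> (\<one>\<^bsub>K\<^esub> \<oplus>\<^bsub>K\<^esub> \<one>\<^bsub>K\<^esub>) = \<zero>\<^bsub>K\<^esub>" using a by (simp add: K.r_distr)
  then have "\<one>\<^bsub>K\<^esub> \<oplus>\<^bsub>K\<^esub> \<one>\<^bsub>K\<^esub> = \<zero>\<^bsub>K\<^esub>" using nz a K.integral_iff by auto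
  moreover have "[(2::nat)] \<cdot>\<^bsub>K\<^esub> \<one>\<^bsub>K\<^esub> = \<one>\<^bsub>K\<^esub> \<oplus>\<^bsub>K\<^esub> \<one>\<^bsub>K\<^esub>"
    by (simp add: numeral_2_eq_2 K.add.nat_pow_Suc)
  ultimately have two: "[(2::nat)] \<cdot>\<^bsub>K\<^esub> \<one>\<^bsub>K\<^esub> = \<zero>\<^bsub>K\<^esub>" by simp
  then have ex: "\<exists>n>0. [(n::nat)] \<cdot>\<^bsub>K\<^esub> \<one>\<^bsub>K\<^esub> = \<zero>\<^bsub>K\<^esub>"
    by (intro exI[of _ 2]) simp
  have "p = (LEAST n. n > 0 \<and> [(n::nat)] \<cdot>\<^bsub>K\<^esub> \<one>\<^bsub>K\<^esub> = \<zero>\<^bsub>K\<^esub>)"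
    unfolding assms(2)[symmetric] ring_characteristic_def using ex by (rule if_P)
  also have "\<dots> \<le> 2" by (rule Least_le) (simp add: two)
  finally have "p \<le> 2" .
  moreover have "2 \<le> p" using assms(3) by (rule prime_ge_2_nat)
  ultimately have "p = 2" by simp
  with assms(4) show False by simp
qed

theorem corollary3p2:
  fixes p r :: nat
    and K :: "('k, 'a) ring_scheme"
    and E :: "('e, 'b) monoid_scheme"
  assumes "prime p" and "odd p"
    and "field K" and "ring_characteristic K = p"
    and "elementary_abelian p r E"
    and "r \<ge> 8"
  shows "\<exists>(F :: int \<Rightarrow> ('e \<Rightarrow> 'k, nat \<Rightarrow> 'e \<Rightarrow> 'k) module) d.
           bounded_free_complex (group_algebra K E) F d \<and>
           carrier (total_homology F d) \<noteq> {\<zero>\<^bsub>total_homology F d\<^esub>} \<and>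
           rank_over K (restrict_scalars (group_algebra_scalar K E) (total_homology F d)) < 2 ^ r"
proof -
  interpret cone_over_field p r K
  proof (intro cone_over_field.intro cone_operators.intro cone_over_field_axioms.intro)
    show "0 < p" using assms(1) by (rule prime_gt_0_nat)
    show "a = \<zero>\<^bsub>K\<^esub>" if "a \<in> carrier K" "a \<oplus>\<^bsub>K\<^esub> a = \<zero>\<^bsub>K\<^esub>" for a
      by (rule ring_characteristic_two_cancel[OF assms(3,4,1,2) that])
  qed (fact assms)+
  obtain \<kappa> where "bij_betw \<kappa> (carrier E) exps"
    "\<And>x y. x \<in> carrier E \<Longrightarrow> y \<in> carrier E \<Longrightarrow> \<kappa> (x \<otimes>\<^bsub>E\<^esub> y) = translate (\<kappa> x) (\<kappa> y)"
    using elementary_abelian_exponents(3)[OF assms(5)] by blast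
  then show ?thesis
    by (rule exists_small_complex[OF elementary_abelian_exponents(1,2)[OF assms(5)]])
qed

end
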